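(* For every fixed integer $m\ge 1$, the height $H_n$ of the $m$-ary recursive tree with highest label $n$ satisfies $$\frac{H_n}{\log n}\to e\qquad\text{almost surely, as } n\to\infty.$$ Furthermore, the sequence of random variables $$\Big(H_n-e\log n+\frac32\log\log n\Big)_{n\ge 2}$$ is tight.
   Context: Fix an integer $m\ge 1$. The $m$-ary recursive tree grows as follows. It starts as a single root node labeled $1$. For each $n\ge 1$, given the tree with highest label $n$ (which has $m(n-1)+1$ nodes), one of its nodes is selected uniformly at random, and $m$ new nodes, all receiving the label $n+1$, are attached as children of the selected node; the trees for all $n$ are thus defined on one probability space as a growing sequence. The height $H_n$ is the longest root-to-leaf distance (in edges) in the tree when the highest label in it is $n$. *)

theory Defs
  imports "HOL-Probability.Probability"
begin

text \<open>
  A node is a pair \<open>(label, index)\<close>: the root is \<open>(1, 0)\<close>, and the \<open>m\<close> children attached when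
  label \<open>n + 1\<close> is introduced are \<open>(n + 1, 0), \<dots>, (n + 1, m - 1)\<close>. With this naming the node set of
  the tree with highest label \<open>n\<close> is deterministic; the randomness is in the edges.
\<close>

type_synonym node = "nat \<times> nat"

definition tree_root :: node where
  "tree_root = (1, 0)"

definition tree_nodes :: "nat \<Rightarrow> nat \<Rightarrow> node set" where
  "tree_nodes m n = insert tree_root ({2..n} \<times> {..<m})"

lemma card_tree_nodes: "card (tree_nodes m n) = m * (n - 1) + 1"
  by (simp add: tree_nodes_def tree_root_def card_cartesian_product)

text \<open>
  \<open>s k\<close> is the node selected in the tree with highest label \<open>k\<close>, for \<open>k \<ge> 1\<close> (\<open>s 0\<close> is irrelevant).
  Edges are directed from parent to child.
\<close>

definition tree_edges :: "nat \<Rightarrow> (nat \<Rightarrow> node) \<Rightarrow> nat \<Rightarrow> (node \<times> node) set" where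
  "tree_edges m s n = {(s k, (Suc k, i)) | k i. 1 \<le> k \<and> k < n \<and> i < m}"

definition tree_leaves :: "nat \<Rightarrow> (nat \<Rightarrow> node) \<Rightarrow> nat \<Rightarrow> node set" where
  "tree_leaves m s n = {v \<in> tree_nodes m n. \<forall>w. (v, w) \<notin> tree_edges m s n}"

text \<open>
  The directed path from the root to a node of the tree is unique, so
  \<open>(tree_root, v) \<in> tree_edges m s n ^^ d\<close> says that \<open>v\<close> has distance \<open>d\<close> from the root.
\<close>

definition tree_height :: "nat \<Rightarrow> (nat \<Rightarrow> node) \<Rightarrow> nat \<Rightarrow> nat" where
  "tree_height m s n = Max {d. \<exists>v \<in> tree_leaves m s n. (tree_root, v) \<in> tree_edges m s n ^^ d}"

text \<open>
  The tree with highest label \<open>n\<close> is a function of \<open>S 1, \<dots>, S (n - 1)\<close> and, conversely, determines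
  them, while its node set is deterministic. So selecting, given the past, a uniform node at every
  step means that the selections are independent and that \<open>S n\<close> is uniform on \<open>tree_nodes m n\<close>.
\<close>

locale recursive_tree = prob_space M for M :: "'a measure" +
  fixes m :: nat and S :: "nat \<Rightarrow> 'a \<Rightarrow> node"
  assumes m_pos: "m \<ge> 1"
    and indep_selections: "indep_vars (\<lambda>_. count_space UNIV) S {1..}"
    and uniform_selections:
      "n \<ge> 1 \<Longrightarrow> distr M (count_space UNIV) (S n) = measure_pmf (pmf_of_set (tree_nodes m n))"

lemma recursive_tree_exists:
  assumes "m \<ge> 1"
  shows "recursive_tree (PiM {1..} (\<lambda>n. measure_pmf (pmf_of_set (tree_nodes m n)))) m
    (\<lambda>n \<omega>. \<omega> n)"
proof -
  define P where "P n = measure_pmf (pmf_of_set (tree_nodes m n))" for n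
  have P: "prob_space (P n)" and sets_P: "sets (P n) = sets (count_space UNIV)" for n
    by (auto simp: P_def prob_space_measure_pmf)
  interpret prob_space "PiM {1..} P"
    by (rule prob_space_PiM) (rule P)
  have meas: "(\<lambda>\<omega>. \<omega> n) \<in> PiM {1..} P \<rightarrow>\<^sub>M count_space UNIV" if "n \<in> {1..}" for n
    using measurable_component_singleton[OF that, of P]
    unfolding measurable_cong_sets[OF refl sets_P] .
  have D: "distr (PiM {1..} P) (count_space UNIV) (\<lambda>\<omega>. \<omega> n) = P n" if "n \<in> {1..}" for n
    using distr_PiM_component[of "{1..}" P n, OF P that] distr_cong[OF refl sets_P refl]
    by metis
  have "distr (PiM {1..} P) (PiM {1..} (\<lambda>_. count_space UNIV)) (\<lambda>\<omega>. \<lambda>i\<in>{1..}. \<omega> i)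
      = distr (PiM {1..} P) (PiM {1..} P) (\<lambda>\<omega>. \<omega>)"
    by (intro distr_cong sets_PiM_cong)
       (auto simp: sets_P space_PiM PiE_restrict)
  also have "\<dots> = PiM {1..} (\<lambda>n. distr (PiM {1..} P) (count_space UNIV) (\<lambda>\<omega>. \<omega> n))"
    unfolding distr_id2[OF refl] by (rule PiM_cong) (simp_all only: D)
  finally have "indep_vars (\<lambda>_. count_space UNIV) (\<lambda>n \<omega>. \<omega> n) {1..}"
    by (subst indep_vars_iff_distr_eq_PiM') ((rule meas, assumption) | simp)+
  then have "recursive_tree (PiM {1..} P) m (\<lambda>n \<omega>. \<omega> n)"
    using assms D by unfold_locales (simp_all add: P_def)
  then show ?thesis
    by (simp add: P_def[abs_def])
qed

end

theory Submission
  imports Defs "HOL-Real_Asymp.Real_Asymp" "HOL-Library.Discrete_Functions"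
begin

text \<open>
  A label \<open>k\<close> is given the time \<open>tau m k\<close>, which differs from \<open>ln k\<close> by a bounded amount. In this clock
  the expected number of nodes of depth \<open>j\<close> obeys the recursion of the iterated integral of \<open>1\<close> over
  \<open>t\<^sub>1 < \<dots> < t\<^sub>j\<close>, and under a linear barrier \<open>b * i \<le> t\<^sub>i\<close> the integral is the Abel polynomial
  \<open>ballot b j t\<close>, which is smaller than the unconstrained \<open>t ^ j / fact j\<close> by a factor of order \<open>1 / j\<close>.
  This factor turns the \<open>1 / 2\<close> of the plain first moment into the \<open>3 / 2\<close> of the theorem.

  Upper tail: a node of depth \<open>J\<close> that is born too early either has an ancestor which is exceptionally
  early for its own depth, or its path stays below the line plus a logarithmic barrier. The first event is
  bounded by induction on the label. In the second one the path is cut at its highest point above the line,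
  and the two pieces are bounded by ballot polynomials.

  Lower tail: the second moment method is applied to the paths under a linear barrier that start at any
  of the nodes of the tree with highest label \<open>K\<close>. As paths from different nodes are nearly
  uncorrelated, the failure probability is of order \<open>1 / K\<close>.

  Almost sure convergence follows by Borel--Cantelli along the labels \<open>2 ^ r\<close>, since the height is monotone.
\<close>

section \<open>Factorial bounds\<close>

text \<open>The critical slope is \<open>1 / exp 1\<close>: at \<open>t = b * j\<close>, Stirling
  turns \<open>t ^ j / fact j\<close> into \<open>(b * exp 1) ^ j\<close> up to a factor of order
  \<open>1 / sqrt j\<close>. All estimates carry \<open>(b * exp 1) ^ J\<close> with
  \<open>b * exp 1 = 1 + O(ln J / J)\<close>. This is a power of \<open>J\<close>, and it has to
  balance the \<open>3 / 2\<close> of the ballot polynomial. The unconstrained expectation is too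
  large because it is dominated by rare trees with an unusually early node. Path counts solve a
  difference equation in the label, ballot polynomials a differential equation in time. As ballot
  polynomials increase in time above the barrier, they are supersolutions in the clock
  \<open>tau\<close>, whose steps are the exact expected numbers of children. For a subsolution the
  steps have to be shortened, hence the second clock \<open>theta\<close>. The clocks differ by a
  bounded amount, which only costs constants. Moments are finite averages over initial segments of
  the selections, so that conditioning is a one-step recursion in the highest label. Probabilities
  are read off afterwards by \<open>prob_eq_avg\<close>.\<close>

lemma ln_add_one_ge:
  fixes x :: real
  assumes "x \<ge> 0"
  shows "2 * x / (2 + x) \<le> ln (1 + x)"
proof -
  let ?f = "\<lambda>x::real. ln (1 + x) + 4 / (2 + x)"
  have "?f 0 \<le> ?f x"
  proof (rule DERIV_nonneg_imp_nondecreasing[OF assms])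
    fix z :: real assume z: "0 \<le> z" "z \<le> x"
    have "(?f has_real_derivative 1 / (1 + z) - 4 / (2 + z)\<^sup>2) (at z)"
      using z by (auto intro!: derivative_eq_intros simp: power2_eq_square)
    moreover have "4 / (2 + z)\<^sup>2 \<le> 1 / (1 + z)"
    proof -
      have "4 * (1 + z) \<le> (2 + z)\<^sup>2" by (simp add: power2_eq_square algebra_simps)
      then show ?thesis using z by (simp add: pos_divide_le_eq pos_le_divide_eq mult.commute)
    qed
    ultimately show "\<exists>y. (?f has_real_derivative y) (at z) \<and> 0 \<le> y"
      by (intro exI conjI) auto
  qed
  moreover have "2 * x / (2 + x) = 2 - 4 / (2 + x)" using assms by (simp add: field_simps)
  ultimately show ?thesis by simp
qed

text \<open>Counterpart of \<open>ln_add_one_ge\<close>: the midpoint and the trapezoidal rule for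
  the integral of 1 / u over [1, 1 + x] err on opposite sides, because 1 / u is convex.\<close>

lemma ln_add_one_le:
  fixes x :: real
  assumes "x \<ge> 0"
  shows "ln (1 + x) \<le> x * (2 + x) / (2 * (1 + x))"
proof -
  let ?f = "\<lambda>x::real. ((1 + x) - 1 / (1 + x)) / 2 - ln (1 + x)"
  have "?f 0 \<le> ?f x"
  proof (rule DERIV_nonneg_imp_nondecreasing[OF assms])
    fix z :: real assume z: "0 \<le> z" "z \<le> x"
    have "(?f has_real_derivative (1 + 1 / (1 + z)\<^sup>2) / 2 - 1 / (1 + z)) (at z)"
      using z by (auto intro!: derivative_eq_intros simp: power2_eq_square)
    moreover have "(1 + 1 / (1 + z)\<^sup>2) / 2 - 1 / (1 + z) = (1 - 1 / (1 + z))\<^sup>2 / 2"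
      by (simp add: power2_diff power_one_over field_simps)
    moreover have "\<dots> \<ge> 0" by simp
    ultimately show "\<exists>y. (?f has_real_derivative y) (at z) \<and> 0 \<le> y"
      by (intro exI conjI) auto
  qed
  moreover have "x * (2 + x) / (2 * (1 + x)) = ((1 + x) - 1 / (1 + x)) / 2"
    using assms by (simp add: field_simps)
  ultimately show ?thesis using \<open>?f 0 \<le> ?f x\<close> by (simp only:) simp
qed

text \<open>The error starts at 1 for \<open>n = 1\<close> and decreases by at most
  \<open>1 / (4 * n) - 1 / (4 * (n + 1))\<close> per step. The lower bound keeps the unspent part of
  this telescoping sum, which makes it inductive.\<close>

lemma stirling_ln_bounds:
  fixes n :: nat
  assumes "n \<ge> 1"
  shows "3 / 4 + 1 / (4 * real n) \<le> ln (fact n) - (real n + 1 / 2) * ln n + n"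
    and "ln (fact n) - (real n + 1 / 2) * ln n + n \<le> 1"
proof -
  define D where "D n = ln (fact n) - (real n + 1 / 2) * ln n + n" for n :: nat
  have step: "D n - D (Suc n) = (real n + 1 / 2) * ln (1 + 1 / n) - 1" if "n \<ge> 1" for n
  proof -
    have "ln (1 + 1 / n) = ln (real n + 1) - ln n"
    proof -
      have "1 + 1 / real n = (real n + 1) / n" using that by (simp add: field_simps)
      then show ?thesis using that by (simp add: ln_div)
    qed
    moreover have "ln (fact (Suc n)) = ln (real n + 1) + ln (fact n)"
      by (simp add: ln_mult add.commute)
    moreover have "D n - D (Suc n) = (real n + 1 / 2) * (ln (real n + 1) - ln n) - 1
        + (ln (fact n) + ln (real n + 1) - ln (fact (Suc n)))"
      by (simp add: D_def algebra_simps)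
    ultimately show ?thesis by simp
  qed
  have "D n \<le> 1 \<and> 3 / 4 + 1 / (4 * real n) \<le> D n"
    using assms
  proof (induction n rule: dec_induct)
    case base
    then show ?case by (simp add: D_def)
  next
    case (step n)
    let ?x = "1 / real n"
    have n: "real n \<ge> 1" using step by simp
    have "1 = (real n + 1 / 2) * (2 * ?x / (2 + ?x))"
      using n by (simp add: divide_simps) 
    also have "\<dots> \<le> (real n + 1 / 2) * ln (1 + ?x)"
      by (intro mult_left_mono ln_add_one_ge) auto
    finally have 1: "D (Suc n) \<le> D n"
      using \<open>\<And>n. n \<ge> 1 \<Longrightarrow> D n - D (Suc n) = _ n\<close>[of n] step.hyps by simp
    have "(real n + 1 / 2) * ln (1 + ?x) \<le> (real n + 1 / 2) * (?x * (2 + ?x) / (2 * (1 + ?x)))"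
      by (intro mult_left_mono ln_add_one_le) auto
    also have "\<dots> = 1 + 1 / (4 * real n) - 1 / (4 * real (Suc n))"
      using n by (simp add: divide_simps) (simp add: algebra_simps)
    finally have "D n - D (Suc n) \<le> 1 / (4 * real n) - 1 / (4 * real (Suc n))"
      using \<open>\<And>n. n \<ge> 1 \<Longrightarrow> D n - D (Suc n) = _ n\<close>[of n] step.hyps by simp
    then show ?case using 1 step.IH by auto
  qed
  then show "3 / 4 + 1 / (4 * real n) \<le> ln (fact n) - (real n + 1 / 2) * ln n + n"
    and "ln (fact n) - (real n + 1 / 2) * ln n + n \<le> 1"
    by (auto simp: D_def)
qed

lemma fact_bounds:
  fixes n :: nat
  assumes "n \<ge> 1"
  shows "sqrt n * (n / exp 1) ^ n \<le> fact n"
    and "fact n \<le> exp 1 * sqrt n * (n / exp 1) ^ n"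
proof -
  have n: "real n > 0" using assms by simp
  have eq: "sqrt n * (n / exp 1) ^ n = exp ((real n + 1 / 2) * ln n - n)"
  proof -
    have "exp ((real n + 1 / 2) * ln n - n) = exp (ln n / 2) * (exp (real n * ln n) / exp n)"
      by (simp add: exp_add[symmetric] exp_diff[symmetric] algebra_simps)
    also have "exp (ln n / 2) = sqrt n"
      using n by (simp add: powr_half_sqrt[symmetric] powr_def)
    also have "exp (real n * ln n) = real n ^ n"
      using n by (simp add: exp_of_nat_mult)
    also have "exp (real n) = exp 1 ^ n"
      by (simp add: exp_of_nat_mult[symmetric])
    finally show ?thesis by (simp add: power_divide)
  qed
  have f: "fact n = exp (ln (fact n :: real))"
    by simp
  show "sqrt n * (n / exp 1) ^ n \<le> fact n"
    unfolding eq by (subst f, subst exp_le_cancel_iff)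
      (use stirling_ln_bounds(1)[OF assms] n in \<open>smt (verit) divide_nonneg_nonneg\<close>)
  have "fact n \<le> exp (1 + ((real n + 1 / 2) * ln n - n))"
    by (subst f, subst exp_le_cancel_iff) (use stirling_ln_bounds(2)[OF assms] in linarith)
  also have "\<dots> = exp 1 * sqrt n * (n / exp 1) ^ n"
    unfolding exp_add eq[symmetric] by simp
  finally show "fact n \<le> exp 1 * sqrt n * (n / exp 1) ^ n" .
qed

section \<open>Ballot polynomials\<close>

text \<open>For \<open>0 \<le> b * j \<le> t\<close>, this is the volume of the set of all \<open>0 \<le> t\<^sub>1 \<le> \<dots> \<le> t\<^sub>j \<le> t\<close> with
  \<open>b * i \<le> t\<^sub>i\<close> for all \<open>i\<close>.\<close>

definition ballot :: "real \<Rightarrow> nat \<Rightarrow> real \<Rightarrow> real" where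
  "ballot b j t = (if j = 0 then 1 else (t - b * j) * t ^ (j - 1) / fact j)"

lemma ballot_Suc: "ballot b (Suc j) t = (t - b * Suc j) * t ^ j / fact (Suc j)"
  by (simp add: ballot_def)

text \<open>Differentiating the iterated integral fixes the last time and leaves the barrier at the
  earlier depths alone, so the same \<open>b\<close> and \<open>t\<close> reappear. Together with
  the zero of \<open>ballot b (Suc j)\<close> at \<open>b * Suc j\<close>, this recursion determines
  the polynomials.\<close>

lemma has_real_derivative_ballot:
  "(ballot b (Suc j) has_real_derivative ballot b j t) (at t)"
proof (cases j)
  case 0
  have [simp]: "ballot b (Suc 0) = (\<lambda>t. t - b)" by (auto simp: ballot_def)
  show ?thesis using 0 by (auto intro!: derivative_eq_intros simp: ballot_def)
next
  case (Suc i)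
  then have ji: "j - Suc 0 = i" by simp
  have "ballot b (Suc j) = (\<lambda>t. (t - b * Suc j) * t ^ j / fact (Suc j))"
    by (auto simp: ballot_Suc)
  moreover have "((\<lambda>t. (t - b * Suc j) * t ^ j / fact (Suc j)) has_real_derivative
      (t ^ j + (t - b * Suc j) * (j * t ^ i)) / fact (Suc j)) (at t)"
    using ji by (auto intro!: derivative_eq_intros)
  moreover have "(t ^ j + (t - b * Suc j) * (j * t ^ i)) / fact (Suc j) = ballot b j t"
  proof -
    have "t ^ j + (t - b * Suc j) * (j * t ^ i) = real (Suc j) * ((t - b * j) * t ^ i)"
      by (simp add: Suc algebra_simps)
    then show ?thesis by (simp add: ballot_def Suc)
  qed
  ultimately show ?thesis by simp
qed

lemma ballot_nonneg: "0 \<le> b \<Longrightarrow> b * j \<le> t \<Longrightarrow> 0 \<le> ballot b j t"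
  unfolding ballot_def
  by (smt (verit, best) divide_nonneg_pos fact_gt_zero mult_nonneg_nonneg of_nat_0_le_iff zero_le_power)

lemma ballot_nonpos: "0 \<le> t \<Longrightarrow> t \<le> b * j \<Longrightarrow> 0 < j \<Longrightarrow> ballot b j t \<le> 0"
  unfolding ballot_def
  by (auto intro!: divide_nonpos_pos mult_nonpos_nonneg)

lemma ballot_mono:
  assumes "0 \<le> b" "b * j \<le> s" "s \<le> t"
  shows "ballot b j s \<le> ballot b j t"
proof -
  have "0 \<le> s" using assms by (smt (verit) mult_nonneg_nonneg of_nat_0_le_iff)
  then show ?thesis
    using assms unfolding ballot_def
    by (auto intro!: divide_right_mono mult_mono power_mono)
qed

lemma ballot_increment:
  assumes "0 \<le> w"
  obtains z where "T \<le> z" "z \<le> T + w"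
    "ballot b (Suc j) (T + w) - ballot b (Suc j) T = w * ballot b j z"
proof (cases "w = 0")
  case True
  then show ?thesis using that[of T] by simp
next
  case False
  then have "T < T + w" using assms by simp
  from MVT2[OF this, of "ballot b (Suc j)" "ballot b j"] has_real_derivative_ballot
  obtain z where "T < z" "z < T + w"
    "ballot b (Suc j) (T + w) - ballot b (Suc j) T = (T + w - T) * ballot b j z"
    by blast
  then show ?thesis using that[of z] by simp
qed

lemma ballot_increment_ge:
  assumes "0 \<le> b" "b * j \<le> T" "0 \<le> w"
  shows "ballot b (Suc j) T + w * ballot b j T \<le> ballot b (Suc j) (T + w)"
proof -
  obtain z where z: "T \<le> z" "z \<le> T + w"
    "ballot b (Suc j) (T + w) - ballot b (Suc j) T = w * ballot b j z"
    using ballot_increment[OF assms(3)] by blast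
  have "w * ballot b j T \<le> w * ballot b j z"
    using ballot_mono assms z by (intro mult_left_mono) auto
  then show ?thesis using z by simp
qed

lemma ballot_increment_le:
  assumes "0 \<le> b" "b * j \<le> T" "0 \<le> w"
  shows "ballot b (Suc j) (T + w) \<le> ballot b (Suc j) T + w * ballot b j (T + w)"
proof -
  obtain z where z: "T \<le> z" "z \<le> T + w"
    "ballot b (Suc j) (T + w) - ballot b (Suc j) T = w * ballot b j z"
    using ballot_increment[OF assms(3)] by blast
  have "w * ballot b j z \<le> w * ballot b j (T + w)"
    using ballot_mono assms z by (intro mult_left_mono) auto
  then show ?thesis using z by simp
qed

text \<open>Stirling alone gives \<open>(b * exp 1) ^ M * exp (a / b) / sqrt M\<close>. The further
  factor \<open>a / (b * M)\<close> bounds the share of the volume that the barrier leaves.\<close>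

lemma ballot_upper:
  assumes "0 < b" "0 \<le> a" "1 \<le> M"
  shows "ballot b M (b * M + a) \<le> a * (b * exp 1) ^ M * exp (a / b) / (b * M * sqrt M)"
proof -
  define T where "T = b * M + a"
  have M: "real M > 0" and bM: "b * M > 0" using assms by auto
  have T: "T \<ge> b * M" "T > 0" using assms bM unfolding T_def by linarith+
  have "T ^ M = (b * M) ^ M * (1 + a / (b * M)) ^ M"
  proof -
    have "T = (b * M) * (1 + a / (b * M))" using bM unfolding T_def
      by (metis less_numeral_extra(3) mult.right_neutral nonzero_eq_divide_eq distrib_left mult.commute)
    then show ?thesis by (simp only: power_mult_distrib)
  qed
  also have "(1 + a / (b * M)) ^ M \<le> exp (a / (b * M)) ^ M"
    using assms bM by (intro power_mono exp_ge_add_one_self) (auto intro!: add_nonneg_nonneg)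
  also have "exp (a / (b * M)) ^ M = exp (a / b)"
    using M by (simp add: exp_of_nat_mult[symmetric])
  finally have 1: "T ^ M \<le> (b * M) ^ M * exp (a / b)"
    using bM by (simp add: mult_left_mono)
  have "(b * M) ^ M = (b * exp 1) ^ M * (M / exp 1) ^ M"
    unfolding power_mult_distrib[symmetric] by simp
  then have 2: "(b * M) ^ M * sqrt M \<le> (b * exp 1) ^ M * fact M"
    using mult_left_mono[OF fact_bounds(1)[OF assms(3)], of "(b * exp 1) ^ M"] assms(1)
    by (simp add: mult_ac)
  have "T ^ (M - 1) * (b * M) \<le> T ^ (M - 1) * T"
    using T by (intro mult_left_mono) auto
  also have "\<dots> = T ^ M"
    using assms by (metis Suc_diff_1 less_eq_Suc_le One_nat_def power_Suc2)
  finally have "T ^ (M - 1) * (b * M) * sqrt M \<le> T ^ M * sqrt M"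
    by (intro mult_right_mono) auto
  also have "\<dots> \<le> (b * M) ^ M * exp (a / b) * sqrt M"
    using 1 by (intro mult_right_mono) auto
  also have "\<dots> \<le> (b * exp 1) ^ M * fact M * exp (a / b)"
    using mult_right_mono[OF 2, of "exp (a / b)"] by (simp add: mult_ac)
  finally have "T ^ (M - 1) / fact M \<le> (b * exp 1) ^ M * exp (a / b) / (b * M * sqrt M)"
    using assms(1) M by (simp add: field_simps)
  then have "a * (T ^ (M - 1) / fact M) \<le> a * ((b * exp 1) ^ M * exp (a / b) / (b * M * sqrt M))"
    by (intro mult_left_mono assms)
  then show ?thesis using assms by (simp add: ballot_def T_def mult_ac)
qed

text \<open>The second-order term of the logarithm measures the loss against \<open>exp x\<close>.
  It stays bounded as long as \<open>x\<^sup>2\<close> is of order \<open>k\<close>.\<close>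

lemma one_plus_power_ge:
  fixes x :: real
  assumes "0 \<le> x" "1 \<le> (k::nat)"
  shows "exp (x - x\<^sup>2 / (2 * k)) \<le> (1 + x / k) ^ k"
proof -
  have k: "real k \<ge> 1" using assms by simp
  let ?y = "x / k"
  have "?y - ?y\<^sup>2 / 2 \<le> 2 * ?y / (2 + ?y)"
  proof -
    have y: "?y \<ge> 0" using assms by simp
    have "(y - y\<^sup>2 / 2) * (2 + y) = 2 * y - y ^ 3 / 2" for y :: real
      by (simp add: algebra_simps power2_eq_square power3_eq_cube)
    then have "(?y - ?y\<^sup>2 / 2) * (2 + ?y) = 2 * ?y - ?y ^ 3 / 2" .
    also have "\<dots> \<le> 2 * ?y" using y by simp
    finally show ?thesis using y by (subst pos_le_divide_eq) auto
  qed
  also have "\<dots> \<le> ln (1 + ?y)" using assms by (intro ln_add_one_ge) auto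
  finally have "real k * (?y - ?y\<^sup>2 / 2) \<le> real k * ln (1 + ?y)"
    by (intro mult_left_mono) auto
  also have "real k * (?y - ?y\<^sup>2 / 2) = x - x\<^sup>2 / (2 * k)"
    using k by (simp add: field_simps power2_eq_square)
  finally have "exp (x - x\<^sup>2 / (2 * k)) \<le> exp (real k * ln (1 + ?y))" by simp
  also have "\<dots> = (1 + ?y) ^ k"
    using assms by (simp add: exp_of_nat_mult add_pos_nonneg)
  finally show ?thesis .
qed

text \<open>The condition \<open>u\<^sup>2 \<le> real k\<close> keeps the second-order loss below
  \<open>exp 8\<close>, because \<open>b\<close> is at least \<open>1 / 4\<close>. Stirling's upper
  bound costs one more \<open>exp 1\<close>, and \<open>T \<le> 2 * k\<close> the factor 2.\<close>

lemma ballot_lower: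
  assumes "1 / 4 \<le> b" "b \<le> 1 / 2" "1 \<le> u" "u\<^sup>2 \<le> real k"
  shows "u * (b * exp 1) ^ k * exp (u / b - 9) / (2 * real k * sqrt k) \<le> ballot b k (b * k + u)"
proof -
  define T where "T = b * k + u"
  have "u \<le> u\<^sup>2" using assms by (simp add: power2_eq_square)
  then have sk: "u \<le> real k" using assms by simp
  then have k1: "1 \<le> k" using assms by simp
  then have k: "real k > 0" and bk: "b * k > 0" using assms by auto
  have "b * k \<le> 1 / 2 * k" using assms by (intro mult_right_mono) auto
  then have T: "T \<le> 2 * k" "T > 0" using sk bk assms(3) \<open>b * k \<le> 1 / 2 * k\<close> unfolding T_def by linarith+
  have "u / b - 8 \<le> u / b - (u / b)\<^sup>2 / (2 * k)"
  proof -
    have "(u / b)\<^sup>2 / (2 * k) \<le> (u / (1 / 4))\<^sup>2 / (2 * k)"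
      using assms by (intro divide_right_mono power_mono divide_left_mono) auto
    also have "\<dots> = 8 * (u\<^sup>2 / k)" by (simp add: power2_eq_square)
    also have "\<dots> \<le> 8 * 1" using assms k by (intro mult_left_mono) auto
    finally show ?thesis by simp
  qed
  then have "exp (u / b - 8) \<le> exp (u / b - (u / b)\<^sup>2 / (2 * k))" by simp
  also have "\<dots> \<le> (1 + u / b / k) ^ k"
    using assms k1 by (intro one_plus_power_ge) auto
  finally have 1: "exp (u / b - 8) * (b * k) ^ k \<le> (1 + u / b / k) ^ k * (b * k) ^ k"
    using bk by (intro mult_right_mono) auto
  have "(1 + u / b / k) ^ k * (b * k) ^ k = T ^ k"
  proof -
    have "T = (1 + u / b / k) * (b * k)" using bk assms(1) k by (simp add: T_def distrib_left distrib_right)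
    then show ?thesis by (simp only: power_mult_distrib)
  qed
  with 1 have 2: "exp (u / b - 8) * (b * k) ^ k \<le> T ^ k" by simp
  have "(b * exp 1) ^ k * fact k \<le> (b * exp 1) ^ k * (exp 1 * sqrt k * (k / exp 1) ^ k)"
    using assms by (intro mult_left_mono fact_bounds(2)[OF k1]) auto
  also have "\<dots> = exp 1 * sqrt k * (b * k) ^ k"
  proof -
    have "(b * k) ^ k = (b * exp 1) ^ k * (k / exp 1) ^ k"
      unfolding power_mult_distrib[symmetric] by simp
    then show ?thesis by (simp only: mult_ac)
  qed
  finally have 3: "(b * exp 1) ^ k * fact k \<le> exp 1 * sqrt k * (b * k) ^ k" .
  have "(b * exp 1) ^ k * exp (u / b - 9) * fact k
      = ((b * exp 1) ^ k * fact k) * exp (u / b - 9)" by simp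
  also have "\<dots> \<le> exp 1 * sqrt k * (b * k) ^ k * exp (u / b - 9)"
    using 3 by (intro mult_right_mono) auto
  also have "\<dots> = sqrt k * (exp (u / b - 8) * (b * k) ^ k)"
    by (simp add: mult_exp_exp)
  also have "\<dots> \<le> sqrt k * T ^ k" using 2 by (intro mult_left_mono) auto
  also have "T ^ k = T ^ (k - 1) * T"
    using k1 by (metis Suc_diff_1 less_eq_Suc_le One_nat_def power_Suc2)
  also have "sqrt k * (T ^ (k - 1) * T) \<le> sqrt k * (T ^ (k - 1) * (2 * k))"
    using T by (intro mult_left_mono) auto
  finally have "(b * exp 1) ^ k * exp (u / b - 9) / (2 * real k * sqrt k) \<le> T ^ (k - 1) / fact k"
    using k by (simp add: field_simps)
  then have "u * ((b * exp 1) ^ k * exp (u / b - 9) / (2 * real k * sqrt k)) \<le> u * (T ^ (k - 1) / fact k)"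
    using assms by (intro mult_left_mono) auto
  then show ?thesis using k1 by (simp add: ballot_def T_def mult_ac)
qed

text \<open>The prolongation \<open>k\<close> is the least that \<open>ballot_lower\<close> admits,
  as its cost \<open>k * sqrt k / u\<close> grows with \<open>k\<close>; it is of order
  \<open>u\<^sup>2\<close>. The growth over the \<open>k\<close> extra steps cancels in the
  quotient.\<close>

lemma ballot_ratio:
  assumes "1 / 4 \<le> b" "b \<le> 1 / 2" "1 \<le> u" "0 \<le> a"
  obtains k where "1 \<le> k" "0 < ballot b k (b * k + u)"
    "ballot b (d + k) (b * (d + k) + a) \<le>
      24 * exp 9 * a * u\<^sup>2 * (b * exp 1) ^ d * exp ((a - u) / b) / real (d + 1) powr (3 / 2)
        * ballot b k (b * k + u)"
proof -
  define k where "k = nat \<lceil>u\<^sup>2\<rceil>"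
  have s1: "1 \<le> u\<^sup>2" using assms by simp
  have ks: "u\<^sup>2 \<le> real k" and k2: "real k \<le> 2 * u\<^sup>2"
    using s1 unfolding k_def by linarith+
  have k: "1 \<le> k" using s1 ks by linarith
  then have kp: "real k > 0" by simp
  have pw: "x * sqrt x = x powr (3 / 2)" if "x > 0" for x :: real
  proof -
    have "x powr (3 / 2) = x powr (1 + 1 / 2)" by simp
    then show ?thesis using that by (simp only: powr_add powr_half_sqrt) simp
  qed
  define B where "B = ballot b k (b * k + u)"
  define M where "M = d + k"
  have M: "1 \<le> M" using k by (simp add: M_def)
  have low: "u * (b * exp 1) ^ k * exp (u / b - 9) / (2 * real k * sqrt k) \<le> B"
    unfolding B_def by (rule ballot_lower) (use assms ks in auto)
  moreover have "0 < u * (b * exp 1) ^ k * exp (u / b - 9) / (2 * real k * sqrt k)"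
    using assms kp by (auto intro!: divide_pos_pos mult_pos_pos)
  ultimately have B: "0 < B" by linarith
  have low2: "(b * exp 1) ^ k \<le> B * (2 * real k * sqrt k) * exp (9 - u / b) / u"
  proof -
    have "u * (b * exp 1) ^ k * exp (u / b - 9) \<le> B * (2 * real k * sqrt k)"
      using low kp by (simp add: field_simps)
    then have "u * (b * exp 1) ^ k * exp (u / b - 9) * exp (9 - u / b)
        \<le> B * (2 * real k * sqrt k) * exp (9 - u / b)"
      by (intro mult_right_mono) auto
    then have "u * (b * exp 1) ^ k \<le> B * (2 * real k * sqrt k) * exp (9 - u / b)"
      by (simp add: mult.assoc mult_exp_exp)
    then show ?thesis using assms by (simp add: pos_le_divide_eq mult.commute)
  qed
  have k3: "k * sqrt k \<le> 3 * u ^ 3"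
  proof -
    have "sqrt k \<le> sqrt (2 * u\<^sup>2)" using k2 by simp
    also have "\<dots> = sqrt 2 * u" using assms by (simp add: real_sqrt_mult)
    also have "\<dots> \<le> 3 / 2 * u" using assms by (intro mult_right_mono real_le_lsqrt) (auto simp: power2_eq_square)
    finally have "k * sqrt k \<le> (2 * u\<^sup>2) * (3 / 2 * u)"
      using k2 by (intro mult_mono) auto
    then show ?thesis by (simp add: power2_eq_square power3_eq_cube)
  qed
  have "ballot b M (b * M + a) \<le> a * (b * exp 1) ^ M * exp (a / b) / (b * M * sqrt M)"
    using assms M by (intro ballot_upper) auto
  also have "\<dots> \<le> a * (b * exp 1) ^ M * exp (a / b) / (1 / 4 * (real (d + 1) powr (3 / 2)))"
  proof (intro divide_left_mono mult_nonneg_nonneg mult_pos_pos)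
    have "real (d + 1) * sqrt (d + 1) \<le> M * sqrt M"
      using k by (intro mult_mono) (auto simp: M_def)
    then have "real (d + 1) powr (3 / 2) \<le> M * sqrt M"
      by (subst (asm) pw) auto
    then have "1 / 4 * (real (d + 1) powr (3 / 2)) \<le> b * (M * sqrt M)"
      using assms by (intro mult_mono) auto
    then show "1 / 4 * (real (d + 1) powr (3 / 2)) \<le> b * M * sqrt M" by simp
  qed (use assms M in auto)
  also have "\<dots> = 4 * a * (b * exp 1) ^ d * exp (a / b) / real (d + 1) powr (3 / 2) * (b * exp 1) ^ k"
    by (simp add: M_def power_add)
  also have "\<dots> \<le> 4 * a * (b * exp 1) ^ d * exp (a / b) / real (d + 1) powr (3 / 2)
      * (B * (2 * real k * sqrt k) * exp (9 - u / b) / u)"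
    using assms by (intro mult_left_mono low2) auto
  also have "\<dots> = 8 * a * (b * exp 1) ^ d * (exp (a / b) * exp (9 - u / b)) / real (d + 1) powr (3 / 2)
      * B / u * (k * sqrt k)"
    by simp
  also have "\<dots> \<le> 8 * a * (b * exp 1) ^ d * (exp (a / b) * exp (9 - u / b)) / real (d + 1) powr (3 / 2)
      * B / u * (3 * u ^ 3)"
    using assms B by (intro mult_left_mono k3) auto
  also have "exp (a / b) * exp (9 - u / b) = exp 9 * exp ((a - u) / b)"
    by (simp add: mult_exp_exp diff_divide_distrib algebra_simps)
  also have "8 * a * (b * exp 1) ^ d * (exp 9 * exp ((a - u) / b)) / real (d + 1) powr (3 / 2)
      * B / u * (3 * u ^ 3) = 24 * exp 9 * a * u\<^sup>2 * (b * exp 1) ^ d * exp ((a - u) / b) / real (d + 1) powr (3 / 2)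
        * B"
    using assms by (simp add: power2_eq_square power3_eq_cube)
  finally show ?thesis
    using that[of k] k B unfolding B_def M_def by simp
qed

section \<open>Expected numbers of paths under a barrier\<close>

text \<open>The expected number of children with label \<open>k\<close> that a given older node
  receives: \<open>m\<close> children, divided by the number of nodes that compete for them.\<close>

definition wt :: "nat \<Rightarrow> nat \<Rightarrow> real" where
  "wt m k = real m / real (m * (k - 2) + 1)"

definition tau :: "nat \<Rightarrow> nat \<Rightarrow> real" where
  "tau m k = (\<Sum>i\<in>{2..k}. wt m i)"

lemma wt_nonneg [simp]: "0 \<le> wt m k"
  by (simp add: wt_def)

lemma wt_le: "wt m k \<le> real m"
proof -
  have "1 \<le> real (m * (k - 2) + 1)" by linarith
  then show ?thesis unfolding wt_def using frac_le[of "real m" "real m" 1] by (metis div_by_1 of_nat_0_le_iff order_refl zero_less_one)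
qed

lemma wt_Suc: "wt m (Suc k) = real m / real (m * (k - 1) + 1)"
  by (simp add: wt_def)

lemma wt_Suc_ge:
  assumes "1 \<le> m" "1 \<le> k"
  shows "1 / real k \<le> wt m (Suc k)"
proof -
  have "real (m * (k - 1) + 1) = real m * (real k - 1) + 1" using assms by (simp add: of_nat_diff)
  also have "\<dots> \<le> real m * real k" using assms by (simp add: algebra_simps)
  finally have "real (m * (k - 1) + 1) \<le> real m * real k" .
  moreover have "0 < real (m * (k - 1) + 1)" by linarith
  ultimately show ?thesis using assms unfolding wt_Suc
    by (simp add: divide_le_eq pos_le_divide_eq mult.commute del: of_nat_add of_nat_Suc of_nat_mult)
qed

lemma wt_Suc_le:
  assumes "2 \<le> k"
  shows "wt m (Suc k) \<le> 1 / (real k - 1)"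
proof -
  have "real m * (real k - 1) \<le> real (m * (k - 1) + 1)" using assms by (simp add: of_nat_diff)
  moreover have "0 < real (m * (k - 1) + 1)" by linarith
  ultimately show ?thesis using assms unfolding wt_Suc
    by (simp add: divide_le_eq pos_le_divide_eq mult.commute del: of_nat_add of_nat_Suc of_nat_mult)
qed

lemma tau_Suc: "1 \<le> k \<Longrightarrow> tau m (Suc k) = tau m k + wt m (Suc k)"
  by (simp add: tau_def)

lemma tau_one [simp]: "tau m (Suc 0) = 0"
  by (simp add: tau_def)

lemma tau_mono: "j \<le> k \<Longrightarrow> tau m j \<le> tau m k"
  unfolding tau_def by (intro sum_mono2) auto

lemma tau_nonneg: "0 \<le> tau m k"
  unfolding tau_def by (intro sum_nonneg) auto

lemma tau_le_ln:
  assumes "1 \<le> k"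
  shows "tau m k \<le> real m + 1 + ln (real k)"
proof -
  have 2: "tau m 2 = real m" by (simp add: tau_def wt_def)
  \<comment> \<open>The shift by 2 matches \<open>wt m (Suc k) \<le> 1 / (real k - 1)\<close>, which
    is at most the increment of the logarithm from \<open>k - 2\<close> to \<open>k - 1\<close>. The
    first two clock steps account for \<open>m\<close> and 1.\<close>
  have "tau m k \<le> real m + 1 + ln (real k - 2)" if "3 \<le> k" for k
    using that
  proof (induction k rule: dec_induct)
    case base
    have "tau m 3 = tau m 2 + wt m 3" using tau_Suc[of 2 m] by (simp add: numeral_eq_Suc)
    moreover have "wt m 3 \<le> 1" using wt_Suc_le[of 2 m] by (simp add: numeral_eq_Suc)
    ultimately show ?case using 2 by simp
  next
    case (step k)
    let ?x = "1 / (real k - 1)"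
    have "?x < 1" using step by simp
    then have "ln (1 - ?x) \<le> - ?x" using ln_le_minus_one[of "1 - ?x"] by simp
    moreover have "ln (1 - ?x) = ln (real k - 2) - ln (real k - 1)"
    proof -
      have "1 - ?x = (real k - 2) / (real k - 1)" using step by (simp add: field_simps)
      then show ?thesis using step by (simp add: ln_div)
    qed
    moreover have "wt m (Suc k) \<le> ?x" using step by (intro wt_Suc_le) auto
    ultimately show ?case using step by (simp add: tau_Suc)
  qed
  moreover have "ln (real k - 2) \<le> ln (real k)" if "3 \<le> k" using that by simp
  ultimately have 3: "tau m k \<le> real m + 1 + ln (real k)" if "3 \<le> k" using that by (meson add_left_mono order_trans)
  have "ln (real k) \<ge> 0" using assms by simp
  consider "k = 1" | "k = 2" | "3 \<le> k" using assms by linarith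
  then show ?thesis using 2 3 by cases (auto simp: add_increasing2)
qed

text \<open>The expected number of nodes at relative depth \<open>j\<close> with label at most \<open>n\<close>, per node of the tree
  with highest label \<open>K\<close>, whose ancestor of relative depth \<open>i\<close> has a label \<open>k\<close> with \<open>A i k\<close>.\<close>

fun green :: "nat \<Rightarrow> (nat \<Rightarrow> nat \<Rightarrow> bool) \<Rightarrow> nat \<Rightarrow> nat \<Rightarrow> nat \<Rightarrow> real" where
  "green m A K 0 n = 1"
| "green m A K (Suc j) 0 = 0"
| "green m A K (Suc j) (Suc n) = green m A K (Suc j) n
    + (if K \<le> n \<and> A (Suc j) (Suc n) then wt m (Suc n) * green m A K j n else 0)"

lemma green_nonneg [simp]: "0 \<le> green m A K j n"
  by (induction m A K j n rule: green.induct) auto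

lemma green_eq_0: "n \<le> K \<Longrightarrow> green m A K (Suc j) n = 0"
  by (induction n) auto

text \<open>Ballot polynomials require that the barrier starts at the origin. A path with initial slack \<open>u\<close>
  is therefore prolonged backwards by \<open>\<kappa>\<close> steps, which take time \<open>b * \<kappa> + u\<close>. With \<open>\<kappa>\<close> of order
  \<open>u\<^sup>2\<close> this only loses a polynomial factor, see \<open>ballot_ratio\<close>.\<close>

lemma green_mult_ballot_le:
  assumes "0 \<le> b" "0 \<le> u" "1 \<le> K" "K \<le> n"
    and barrier: "\<And>j k. K \<le> k \<Longrightarrow> A (Suc j) (Suc k) \<Longrightarrow> b * real (Suc j) - u \<le> tau m k - tau m K"
  shows "green m A K j n * ballot b \<kappa> (b * \<kappa> + u)
    \<le> max 0 (ballot b (j + \<kappa>) (tau m n - tau m K + b * \<kappa> + u))"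
  using assms(4)
proof (induction n arbitrary: j rule: dec_induct)
  case base
  then show ?case by (cases j) (auto simp: green_eq_0)
next
  case (step n)
  let ?T = "\<lambda>n. tau m n - tau m K + b * \<kappa> + u"
  have T: "?T (Suc n) = ?T n + wt m (Suc n)" using step assms by (simp add: tau_Suc)
  have Tn: "?T n \<ge> b * \<kappa> + u" using tau_mono[OF step(1)] by simp
  \<comment> \<open>Below the barrier the polynomial is nonpositive and need not be monotone; only
    its positive part increases along the clock.\<close>
  have mono: "max 0 (ballot b i (?T n)) \<le> max 0 (ballot b i (?T (Suc n)))" for i
  proof (cases "b * i \<le> ?T n")
    case True
    then have "ballot b i (?T n) \<le> ballot b i (?T (Suc n))"
      using T by (intro ballot_mono assms) auto
    then show ?thesis by simp
  next
    case False
    then have "i > 0" using Tn assms by (cases i) auto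
    moreover have "0 \<le> ?T n" using Tn assms by (smt (verit) mult_nonneg_nonneg of_nat_0_le_iff)
    ultimately have "ballot b i (?T n) \<le> 0" using False by (intro ballot_nonpos) auto
    then show ?thesis by simp
  qed
  show ?case
  proof (cases j)
    case 0
    then show ?thesis using step.IH[of 0] mono[of \<kappa>] by simp
  next
    case (Suc i)
    show ?thesis
    proof (cases "A (Suc i) (Suc n)")
      case False
      then show ?thesis using step.IH[of "Suc i"] mono[of "Suc i + \<kappa>"] Suc by simp
    next
      case True
      \<comment> \<open>The barrier is read at the time before the step to label
        \<open>Suc n\<close>, since the supersolution inequality expands the polynomial at the left
        end of the step.\<close>
      have b: "b * real (Suc i) - u \<le> tau m n - tau m K" using barrier[OF step(1) True] .
      have b1: "b * real (Suc i + \<kappa>) \<le> ?T n" using b by (simp add: algebra_simps)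
      have b0: "b * real (i + \<kappa>) \<le> ?T n" using b assms(1) by (simp add: algebra_simps)
      let ?B = "ballot b \<kappa> (b * \<kappa> + u)"
      have "green m A K j (Suc n) * ?B
          = green m A K (Suc i) n * ?B + wt m (Suc n) * (green m A K i n * ?B)"
        using Suc step True by (simp add: algebra_simps)
      also have "green m A K (Suc i) n * ?B \<le> ballot b (Suc (i + \<kappa>)) (?T n)"
        using step.IH[of "Suc i"] ballot_nonneg[OF assms(1) b1] by simp
      also have "green m A K i n * ?B \<le> ballot b (i + \<kappa>) (?T n)"
        using step.IH[of i] ballot_nonneg[OF assms(1) b0] by simp
      also have "ballot b (Suc (i + \<kappa>)) (?T n) + wt m (Suc n) * ballot b (i + \<kappa>) (?T n)
          \<le> ballot b (Suc (i + \<kappa>)) (?T n + wt m (Suc n))"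
        by (intro ballot_increment_ge assms b0) auto
      finally have "green m A K j (Suc n) * ?B \<le> ballot b (Suc (i + \<kappa>)) (?T (Suc n))"
        unfolding T by (simp add: mult_left_mono)
      then show ?thesis using Suc by (simp only: add_Suc max.coboundedI2)
    qed
  qed
qed

text \<open>Here \<open>u\<close> is the slack at the start and \<open>a\<close> the slack at the
  end; for negative \<open>a\<close> there is no path at all. Of the exponent \<open>3 / 2\<close>,
  the part \<open>1 / 2\<close> is Stirling's and 1 is the effect of the barrier. The bound follows
  by dividing out the prolongation of \<open>green_mult_ballot_le\<close>.\<close>

lemma green_le:
  assumes "1 / 4 \<le> b" "b \<le> 1 / 2" "1 \<le> u" "1 \<le> K" "K \<le> n"
    and barrier: "\<And>j k. K \<le> k \<Longrightarrow> A (Suc j) (Suc k) \<Longrightarrow> b * real (Suc j) - u \<le> tau m k - tau m K"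
    and a: "a = tau m n - tau m K + u - b * j"
  shows "green m A K j n \<le> 24 * exp 9 * max 0 a * u\<^sup>2 * (b * exp 1) ^ j * exp ((a - u) / b)
    / real (j + 1) powr (3 / 2)"
proof -
  obtain k where k: "1 \<le> k" "0 < ballot b k (b * k + u)" and ratio:
    "ballot b (j + k) (b * (j + k) + max 0 a) \<le>
      24 * exp 9 * max 0 a * u\<^sup>2 * (b * exp 1) ^ j * exp ((max 0 a - u) / b) / real (j + 1) powr (3 / 2)
        * ballot b k (b * k + u)"
    using ballot_ratio[of b u "max 0 a" j] assms by auto
  have le: "green m A K j n * ballot b k (b * k + u)
    \<le> max 0 (ballot b (j + k) (tau m n - tau m K + b * k + u))"
    using assms by (intro green_mult_ballot_le) auto
  have eq: "tau m n - tau m K + b * k + u = b * (j + k) + a"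
    by (simp add: a algebra_simps)
  have pos: "0 \<le> tau m n - tau m K + b * k + u"
    using tau_mono[OF assms(5), of m] assms by (intro add_nonneg_nonneg) auto
  show ?thesis
  proof (cases "a < 0")
    case True
    then have "ballot b (j + k) (tau m n - tau m K + b * k + u) \<le> 0"
      using k pos eq by (intro ballot_nonpos) auto
    then have "green m A K j n * ballot b k (b * k + u) \<le> 0" using le by simp
    then have "green m A K j n \<le> 0" using k by (simp add: mult_le_0_iff)
    then show ?thesis using True by simp
  next
    case False
    then have "0 \<le> ballot b (j + k) (b * (j + k) + a)"
      using assms by (intro ballot_nonneg) auto
    then have "green m A K j n * ballot b k (b * k + u) \<le> ballot b (j + k) (b * (j + k) + a)"
      using le unfolding eq by simp
    also have "\<dots> \<le> 24 * exp 9 * max 0 a * u\<^sup>2 * (b * exp 1) ^ j * exp ((a - u) / b) / real (j + 1) powr (3 / 2)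
        * ballot b k (b * k + u)"
      using ratio False by (simp add: max_def)
    finally show ?thesis using k(2) by (rule mult_right_le_imp_le)
  qed
qed

text \<open>The supersolution argument with slope 0, where the ballot polynomial is
  \<open>t ^ j / fact j\<close> and no slack is required.\<close>

lemma green_le_power:
  assumes "1 \<le> n"
  shows "green m A 1 j n \<le> tau m n ^ j / fact j"
proof -
  have b: "ballot 0 j t = t ^ j / fact j" for t j by (cases j) (auto simp: ballot_def)
  show ?thesis using assms
  proof (induction n arbitrary: j rule: dec_induct)
    case base
    then show ?case by (cases j) (auto simp: green_eq_0)
  next
    case (step n)
    show ?case
    proof (cases j)
      case (Suc i)
      have "green m A 1 j (Suc n) \<le> green m A 1 (Suc i) n + wt m (Suc n) * green m A 1 i n"
        using Suc by (auto simp: mult_nonneg_nonneg)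
      also have "\<dots> \<le> ballot 0 (Suc i) (tau m n) + wt m (Suc n) * ballot 0 i (tau m n)"
        unfolding b by (intro add_mono mult_left_mono step.IH) auto
      also have "\<dots> \<le> ballot 0 (Suc i) (tau m n + wt m (Suc n))"
        by (intro ballot_increment_ge) (auto simp: tau_nonneg)
      finally show ?thesis using step Suc by (simp add: tau_Suc b)
    qed auto
  qed
qed

text \<open>If only the label \<open>x\<close> is allowed at depth \<open>Suc i\<close>, a path
  consists of \<open>i\<close> steps before \<open>x\<close>, the step to \<open>x\<close>, and a
  path restarted from \<open>x\<close>; the expectations multiply.\<close>

lemma green_pinned:
  assumes "\<And>k. A (Suc i) k \<Longrightarrow> k = x" "1 \<le> x"
  shows "green m A 1 (Suc i + j) n
    \<le> (if x \<le> n then wt m x * green m A 1 i (x - 1) * green m (\<lambda>l. A (Suc i + l)) x j n else 0)"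
proof (induction n arbitrary: j)
  case 0
  then show ?case using assms by simp
next
  case (Suc n)
  have IH: "n < x \<Longrightarrow> green m A 1 (Suc i + j) n = 0" for j
    using Suc[of j] by (intro antisym[OF _ green_nonneg]) simp
  show ?case
  proof (cases j)
    case 0
    show ?thesis
    proof (cases "Suc n = x")
      case True
      then show ?thesis using 0 IH[of 0] by (auto simp: mult_nonneg_nonneg)
    next
      case False
      then have "\<not> A (Suc i) (Suc n)" using assms by blast
      then show ?thesis using 0 Suc[of 0] False by (auto split: if_splits)
    qed
  next
    case (Suc l)
    consider "Suc n < x" | "Suc n = x" | "x \<le> n" by linarith
    then show ?thesis
    proof cases
      case 3
      let ?c = "wt m x * green m A 1 i (x - 1)"
      let ?A = "\<lambda>l. A (Suc i + l)"
      have "green m A 1 (Suc i + j) (Suc n) = green m A 1 (Suc i + Suc l) n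
        + (if A (Suc i + Suc l) (Suc n) then wt m (Suc n) * green m A 1 (Suc i + l) n else 0)"
        using Suc 3 assms by simp
      also have "\<dots> \<le> ?c * green m ?A x (Suc l) n
        + (if A (Suc i + Suc l) (Suc n) then wt m (Suc n) * (?c * green m ?A x l n) else 0)"
      proof (intro add_mono)
        show "green m A 1 (Suc i + Suc l) n \<le> ?c * green m ?A x (Suc l) n"
          using Suc.IH[of "Suc l"] 3 by simp
        have "green m A 1 (Suc i + l) n \<le> ?c * green m ?A x l n"
          using Suc.IH[of l] 3 by simp
        then show "(if A (Suc i + Suc l) (Suc n) then wt m (Suc n) * green m A 1 (Suc i + l) n else 0)
          \<le> (if A (Suc i + Suc l) (Suc n) then wt m (Suc n) * (?c * green m ?A x l n) else 0)"
          by (auto intro: mult_left_mono)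
      qed
      also have "\<dots> = ?c * green m ?A x j (Suc n)"
        using Suc 3 by (simp add: algebra_simps)
      finally show ?thesis using 3 by simp
    qed (use IH[of "Suc l"] IH[of l] Suc in \<open>auto simp: mult_nonneg_nonneg\<close>)
  qed
qed

text \<open>A clock that is slower than \<open>tau\<close> by a bounded amount, such that \<open>ballot b j (theta K n)\<close> is a
  subsolution of the recursion of \<open>green\<close>.\<close>

definition theta :: "nat \<Rightarrow> nat \<Rightarrow> real" where
  "theta K k = (\<Sum>i\<in>{K<..k}. 1 / (real i + 11))"

lemma theta_self [simp]: "theta K K = 0"
  by (simp add: theta_def)

lemma theta_Suc: "K \<le> k \<Longrightarrow> theta K (Suc k) = theta K k + 1 / (real k + 12)"
proof -
  assume "K \<le> k"
  then have "{K<..Suc k} = insert (Suc k) {K<..k}" by auto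
  then show ?thesis by (simp add: theta_def)
qed

lemma theta_nonneg: "0 \<le> theta K k"
  unfolding theta_def by (intro sum_nonneg) auto

lemma theta_ge_ln:
  assumes "K \<le> k"
  shows "ln ((real k + 12) / (real K + 12)) \<le> theta K k"
  using assms
proof (induction k rule: dec_induct)
  case (step k)
  have "ln ((real (Suc k) + 12) / (real K + 12)) - ln ((real k + 12) / (real K + 12)) = ln (1 + 1 / (real k + 12))"
  proof -
    have "1 + 1 / (real k + 12) = (real (Suc k) + 12) / (real k + 12)" by (simp add: field_simps)
    then show ?thesis by (simp add: ln_div)
  qed
  also have "\<dots> \<le> 1 / (real k + 12)" by (rule ln_add_one_self_le_self) simp
  finally show ?case using step by (simp add: theta_Suc)
qed simp

lemma theta_le_tau:
  assumes "1 \<le> m" "1 \<le> K" "K \<le> k"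
  shows "theta K k \<le> tau m k - tau m K"
  using assms(3)
proof (induction k rule: dec_induct)
  case (step k)
  have "1 / (real k + 12) \<le> 1 / real k" using step assms by (intro divide_left_mono) auto
  also have "\<dots> \<le> wt m (Suc k)" using step assms by (intro wt_Suc_ge) auto
  finally show ?case using step assms by (simp add: theta_Suc tau_Suc)
qed simp

lemma tau_le_theta:
  assumes "1 \<le> K" "K \<le> n"
  shows "tau m n - tau m K \<le> theta K n + real m + 13"
proof -
  \<comment> \<open>A step of \<open>tau\<close> exceeds one of \<open>theta\<close> by at most
    \<open>13 / ((k - 1) * (k + 12))\<close>, which is below the telescoping
    \<open>13 / (k - 1) - 13 / k\<close>. The correction term keeps track of this sum.\<close>
  have *: "tau m k - tau m K \<le> theta K k + real m + 13 - 13 / (real k - 1)" if "2 \<le> k" "K \<le> k" for k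
  proof -
    have "max 2 K \<le> k" using that by simp
    then show ?thesis
    proof (induction k rule: dec_induct)
      case base
      show ?case
      proof (cases "K = 1")
        case True
        then show ?thesis using theta_nonneg[of "Suc 0" "Suc (Suc 0)"] by (simp add: tau_def wt_def)
      next
        case False
        then have "2 \<le> K" using assms by simp
        then have "13 / (real K - 1) \<le> 13 / 1" by (intro divide_left_mono) auto
        then show ?thesis using \<open>2 \<le> K\<close> by (simp add: max_def)
      qed
    next
      case (step k)
      have "wt m (Suc k) \<le> 1 / (real k - 1)" using step by (intro wt_Suc_le) auto
      moreover have "1 / (real k - 1) - 1 / (real k + 12) \<le> 13 / (real k - 1) - 13 / real k"
      proof -
        have k: "real k \<ge> 2" using step by simp
        have "1 / (real k - 1) - 1 / (real k + 12) = 13 / ((real k - 1) * (real k + 12))"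
          using k by (simp add: field_simps)
        also have "\<dots> \<le> 13 / ((real k - 1) * real k)"
          using k by (intro divide_left_mono mult_left_mono mult_pos_pos) auto
        also have "\<dots> = 13 / (real k - 1) - 13 / real k"
          using k by (simp add: field_simps)
        finally show ?thesis .
      qed
      ultimately show ?case using step by (simp add: tau_Suc theta_Suc)
    qed
  qed
  show ?thesis
  proof (cases "2 \<le> n")
    case True
    have "0 \<le> 13 / (real n - 1)" using True by simp
    then show ?thesis using *[OF True assms(2)] by linarith
  next
    case False
    then have "n = K" using assms by simp
    then show ?thesis by simp
  qed
qed

text \<open>The constant is \<open>12 = 8 + 4\<close>. The distance to the barrier is at least
  \<open>1 / 8\<close>, so the linear factor grows by at most \<open>exp (8 * e)\<close>. The degree
  of the power is at most \<open>4 * t\<close>, so the power grows by at most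
  \<open>exp (4 * e)\<close>.\<close>

lemma ballot_ratio_shift:
  assumes "1 / 4 \<le> b" "0 \<le> e" "b * real j + 1 / 8 \<le> t"
  shows "ballot b j (t + e) \<le> exp (12 * e) * ballot b j t"
proof (cases j)
  case 0
  then show ?thesis using assms by (simp add: ballot_def)
next
  case (Suc i)
  have bj: "b * real j \<ge> real j / 4" using mult_right_mono[OF assms(1), of "real j"] by simp
  then have t: "t > 0" "real i \<le> 4 * t" using assms(3) Suc by linarith+
  let ?a = "t - b * real j"
  have a: "1 / 8 \<le> ?a" using assms by simp
  have "?a + e \<le> ?a * (1 + 8 * e)"
    using mult_right_mono[OF a assms(2)] by (simp add: algebra_simps)
  also have "\<dots> \<le> ?a * exp (8 * e)" using a by (intro mult_left_mono) auto
  finally have 1: "t + e - b * real j \<le> ?a * exp (8 * e)" by simp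
  have "(t + e) ^ i = t ^ i * (1 + e / t) ^ i"
  proof -
    have "t + e = t * (1 + e / t)" using t by (simp add: field_simps)
    then show ?thesis by (simp only: power_mult_distrib)
  qed
  also have "(1 + e / t) ^ i \<le> exp (e / t) ^ i"
    using assms t by (intro power_mono) (auto intro: add_nonneg_nonneg)
  also have "exp (e / t) ^ i = exp (real i / t * e)"
    by (simp add: exp_of_nat_mult[symmetric])
  also have "\<dots> \<le> exp (4 * e)"
    using mult_right_mono[of "real i / t" 4 e] t assms(2) by (simp add: pos_divide_le_eq)
  finally have 2: "(t + e) ^ i \<le> t ^ i * exp (4 * e)" using t by simp
  have "(t + e - b * real j) * (t + e) ^ i \<le> (?a * exp (8 * e)) * (t ^ i * exp (4 * e))"
    using 1 2 a assms t by (intro mult_mono) auto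
  also have "\<dots> = exp (12 * e) * (?a * t ^ i)" by (simp add: mult_exp_exp)
  finally show ?thesis using Suc
    by (simp add: ballot_def divide_right_mono)
qed

text \<open>The increment of the polynomial is bounded by its derivative at the right end of a clock
  step, while \<open>green\<close> uses the left end. Moving back costs \<open>exp (12 * e)\<close>
  by \<open>ballot_ratio_shift\<close>, and the slow clock is built to pay for it. Below the barrier
  the left-hand side is nonpositive.\<close>

lemma ballot_le_green:
  assumes "1 / 4 \<le> b" "1 \<le> m" "1 \<le> K" "K \<le> n"
    and barrier: "\<And>j k. K \<le> k \<Longrightarrow> b * real (Suc j) \<le> theta K (Suc k) \<Longrightarrow> A (Suc j) (Suc k)"
  shows "ballot b j (theta K n) \<le> green m A K j n"
  using assms(4)
proof (induction n arbitrary: j rule: dec_induct)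
  case base
  have "ballot b j 0 \<le> 0" if "0 < j" using that assms by (intro ballot_nonpos) auto
  then show ?case by (cases j) (auto simp: ballot_def green_eq_0)
next
  case (step n)
  show ?case
  proof (cases j)
    case 0
    then show ?thesis by (simp add: ballot_def)
  next
    case (Suc i)
    define e where "e = 1 / (real n + 12)"
    have e: "0 < e" "e \<le> 1 / 12" "theta K (Suc n) = theta K n + e"
      using step by (auto simp: e_def theta_Suc divide_simps)
    show ?thesis
    proof (cases "b * real j \<le> theta K (Suc n)")
      case False
      then have "ballot b j (theta K (Suc n)) \<le> 0"
        using Suc by (intro ballot_nonpos theta_nonneg) auto
      then show ?thesis using green_nonneg[of m A K j "Suc n"] by linarith
    next
      case True
      then have A: "A (Suc i) (Suc n)" using barrier step Suc by simp
      \<comment> \<open>One depth less lowers the barrier by at least \<open>1 / 4\<close>, and the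
        time only by \<open>e \<le> 1 / 12\<close>; the difference exceeds
        \<open>1 / 8\<close>.\<close>
      have t: "b * real i + 1 / 8 \<le> theta K n"
        using True e Suc assms(1) by (simp add: algebra_simps)
      have n: "real n \<ge> 1" using step assms by simp
      have "12 * e < 1" using n by (simp add: e_def)
      \<comment> \<open>This fixes the clock: with \<open>e = 1 / (n + 12)\<close> the identity
        \<open>1 - 12 * e = e * n\<close> makes the factor \<open>exp (12 * e)\<close> turn
        \<open>e\<close> into at most \<open>1 / n\<close>.\<close>
      have "e * exp (12 * e) \<le> 1 / real n"
      proof -
        have "1 - 12 * e \<le> exp (- (12 * e))" using exp_ge_add_one_self[of "- (12 * e)"] by simp
        then have "(1 - 12 * e) * exp (12 * e) \<le> 1"
          by (simp add: exp_minus field_simps)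
        moreover have "1 - 12 * e = e * real n" using n by (simp add: e_def field_simps)
        ultimately have "e * exp (12 * e) * real n \<le> 1" by (simp add: mult_ac)
        then show ?thesis using n by (simp add: pos_le_divide_eq)
      qed
      also have "\<dots> \<le> wt m (Suc n)" using step assms by (intro wt_Suc_ge) auto
      finally have w: "e * exp (12 * e) \<le> wt m (Suc n)" .
      have "ballot b j (theta K n + e) \<le> ballot b j (theta K n) + e * ballot b i (theta K n + e)"
        unfolding Suc using assms t e by (intro ballot_increment_le) auto
      also have "e * ballot b i (theta K n + e) \<le> e * (exp (12 * e) * ballot b i (theta K n))"
        using assms t e by (intro mult_left_mono ballot_ratio_shift) auto
      also have "\<dots> = (e * exp (12 * e)) * ballot b i (theta K n)" by simp
      also have "\<dots> \<le> wt m (Suc n) * ballot b i (theta K n)"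
        using assms t by (intro mult_right_mono w ballot_nonneg) auto
      also have "\<dots> \<le> wt m (Suc n) * green m A K i n"
        by (intro mult_left_mono step.IH) auto
      also have "ballot b j (theta K n) \<le> green m A K j n" by (rule step.IH)
      finally show ?thesis using A step Suc e by simp
    qed
  qed
qed

text \<open>A lower Riemann sum of exp (- t) in the clock \<open>tau\<close>. The first cell may
  begin before \<open>t\<close>, but by at most one clock step, which is no longer than
  \<open>m\<close>. The same overshoot appears in \<open>sum_wt_le\<close>.\<close>

lemma sum_wt_exp_le:
  assumes "finite X" "\<And>x. x \<in> X \<Longrightarrow> 2 \<le> x \<and> t \<le> tau m x"
  shows "(\<Sum>x\<in>X. wt m x * exp (- tau m x)) \<le> exp (real m - t)"
proof (cases "X = {}")
  case False
  define a where "a = Min X"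
  define b where "b = Max X"
  have a: "a \<in> X" "2 \<le> a" "t \<le> tau m a" and sub: "X \<subseteq> {a..b}" and ab: "a \<le> b"
    using assms False Min_in[OF assms(1) False] Max_in[OF assms(1) False] by (auto simp: a_def b_def)
  have tl: "tau m x = tau m (x - 1) + wt m x" if "2 \<le> x" for x
    using tau_Suc[of "x - 1" m] that by simp
  have "(\<Sum>x\<in>{a..b}. wt m x * exp (- tau m x)) \<le> exp (- tau m (a - 1)) - exp (- tau m b)"
    using ab
  proof (induction b rule: dec_induct)
    case base
    have "(1 + wt m a) * exp (- tau m a) \<le> exp (wt m a) * exp (- tau m a)"
      by (intro mult_right_mono) auto
    also have "\<dots> = exp (- tau m (a - 1))" using tl[of a] a by (simp add: mult_exp_exp)
    finally show ?case by (simp add: algebra_simps)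
  next
    case (step b)
    have "(1 + wt m (Suc b)) * exp (- tau m (Suc b)) \<le> exp (wt m (Suc b)) * exp (- tau m (Suc b))"
      by (intro mult_right_mono) auto
    also have "\<dots> = exp (- tau m b)" using tl[of "Suc b"] a step by (simp add: mult_exp_exp)
    finally show ?case using step by (simp add: algebra_simps)
  qed
  also have "\<dots> \<le> exp (- tau m (a - 1))" by simp
  also have "\<dots> = exp (wt m a - tau m a)" using tl[of a] a by simp
  also have "\<dots> \<le> exp (real m - t)" using a wt_le[of m a] by simp
  finally have "(\<Sum>x\<in>{a..b}. wt m x * exp (- tau m x)) \<le> exp (real m - t)" .
  moreover have "(\<Sum>x\<in>X. wt m x * exp (- tau m x)) \<le> (\<Sum>x\<in>{a..b}. wt m x * exp (- tau m x))"
    using sub by (intro sum_mono2) auto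
  ultimately show ?thesis by linarith
qed simp

lemma sum_wt_le:
  assumes "finite X" "0 \<le> u - t" "\<And>x. x \<in> X \<Longrightarrow> 2 \<le> x \<and> t \<le> tau m x \<and> tau m x \<le> u"
  shows "(\<Sum>x\<in>X. wt m x) \<le> u - t + real m"
proof (cases "X = {}")
  case False
  define a where "a = Min X"
  define b where "b = Max X"
  have a: "a \<in> X" "2 \<le> a" "t \<le> tau m a" and b: "tau m b \<le> u" and sub: "X \<subseteq> {a..b}" and ab: "a \<le> b"
    using assms False Min_in[OF assms(1) False] Max_in[OF assms(1) False] by (auto simp: a_def b_def)
  have "(\<Sum>x\<in>X. wt m x) \<le> (\<Sum>x\<in>{a..b}. wt m x)"
    using sub by (intro sum_mono2) auto
  also have "\<dots> = tau m b - tau m (a - 1)"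
    using ab
  proof (induction b rule: dec_induct)
    case base
    then show ?case using tau_Suc[of "a - 1" m] a by simp
  next
    case (step b)
    then show ?case using tau_Suc[of b m] a by (simp add: sum.cl_ivl_Suc)
  qed
  also have "tau m (a - 1) = tau m a - wt m a" using tau_Suc[of "a - 1" m] a by simp
  finally show ?thesis using a b wt_le[of m a] by linarith
qed (use assms in simp)

section \<open>Moments of level counts\<close>

lemma finite_tree_nodes [simp]: "finite (tree_nodes m n)"
  by (simp add: tree_nodes_def)

lemma tree_root_in_nodes [simp]: "tree_root \<in> tree_nodes m n"
  by (simp add: tree_nodes_def)

lemma tree_nodes_nonempty [simp]: "tree_nodes m n \<noteq> {}"
  by (auto simp: tree_nodes_def)

lemma tree_nodes_mono: "k \<le> n \<Longrightarrow> tree_nodes m k \<subseteq> tree_nodes m n"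
  by (auto simp: tree_nodes_def)

lemma label_le: "v \<in> tree_nodes m n \<Longrightarrow> 1 \<le> n \<Longrightarrow> fst v \<le> n"
  by (auto simp: tree_nodes_def tree_root_def)

lemma tree_nodes_Suc: "1 \<le> n \<Longrightarrow> tree_nodes m (Suc n) = tree_nodes m n \<union> {Suc n} \<times> {..<m}"
  by (auto simp: tree_nodes_def tree_root_def)

lemma new_notin_tree_nodes: "1 \<le> n \<Longrightarrow> (Suc n, i) \<notin> tree_nodes m n"
  by (auto simp: tree_nodes_def tree_root_def)

section \<open>Averages over selection histories\<close>

definition choices :: "nat \<Rightarrow> nat \<Rightarrow> (nat \<Rightarrow> node) set" where
  "choices m n = PiE {1..<n} (tree_nodes m)"

text \<open>The expectation over the selections made before label \<open>n\<close> appears and up to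
  its creation, as an elementary finite sum; \<open>prob_eq_avg\<close> identifies it with the
  probability.\<close>

definition avg :: "nat \<Rightarrow> nat \<Rightarrow> ((nat \<Rightarrow> node) \<Rightarrow> real) \<Rightarrow> real" where
  "avg m n f = (\<Sum>s\<in>choices m n. f s) / (\<Prod>i\<in>{1..<n}. card (tree_nodes m i))"

lemma card_choices_pos: "(\<Prod>i\<in>{1..<n}. real (card (tree_nodes m i))) > 0"
  by (intro prod_pos) (simp add: card_gt_0_iff)

lemma card_choices: "real (card (choices m n)) = (\<Prod>i\<in>{1..<n}. real (card (tree_nodes m i)))"
  by (simp add: choices_def card_PiE)

lemma avg_const [simp]: "avg m n (\<lambda>_. c) = c"
  using card_choices_pos[of m n] by (simp add: avg_def card_choices)

lemma avg_add: "avg m n (\<lambda>s. f s + g s) = avg m n f + avg m n g"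
  by (simp add: avg_def sum.distrib add_divide_distrib)

lemma avg_diff: "avg m n (\<lambda>s. f s - g s) = avg m n f - avg m n g"
  by (simp add: avg_def sum_subtractf diff_divide_distrib)

lemma avg_mult: "avg m n (\<lambda>s. c * f s) = c * avg m n f"
  by (simp add: avg_def sum_distrib_left)

lemma avg_sum: "avg m n (\<lambda>s. \<Sum>i\<in>I. f i s) = (\<Sum>i\<in>I. avg m n (f i))"
  unfolding avg_def by (subst sum.swap) (simp add: sum_divide_distrib)

lemma avg_mono: "(\<And>s. s \<in> choices m n \<Longrightarrow> f s \<le> g s) \<Longrightarrow> avg m n f \<le> avg m n g"
  unfolding avg_def using card_choices_pos[of m n]
  by (intro divide_right_mono sum_mono) (auto intro: less_imp_le)

lemma avg_cong: "(\<And>s. s \<in> choices m n \<Longrightarrow> f s = g s) \<Longrightarrow> avg m n f = avg m n g"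
  unfolding avg_def by (simp cong: sum.cong)

lemma choicesD: "s \<in> choices m n \<Longrightarrow> 1 \<le> k \<Longrightarrow> k < n \<Longrightarrow> s k \<in> tree_nodes m k"
  by (auto simp: choices_def PiE_def)

text \<open>The tower property: given the tree with highest label \<open>n\<close>, its uniform
  selection is averaged first.\<close>

lemma avg_Suc:
  assumes "1 \<le> n"
  shows "avg m (Suc n) f
    = avg m n (\<lambda>s. (\<Sum>v\<in>tree_nodes m n. f (s(n := v))) / real (card (tree_nodes m n)))"
proof -
  have ins: "{1..<Suc n} = insert n {1..<n}" using assms by auto
  have eq: "choices m (Suc n) = (\<lambda>(v, s). s(n := v)) ` (tree_nodes m n \<times> choices m n)"
    unfolding choices_def ins by (rule PiE_insert_eq)
  have inj: "inj_on (\<lambda>(v, s). s(n := v)) (tree_nodes m n \<times> choices m n)"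
    unfolding choices_def by (rule inj_combinator) simp
  have "(\<Sum>s\<in>choices m (Suc n). f s)
      = (\<Sum>(v, s)\<in>tree_nodes m n \<times> choices m n. f (s(n := v)))"
    unfolding eq sum.reindex[OF inj] by (simp add: case_prod_beta comp_def)
  also have "\<dots> = (\<Sum>v\<in>tree_nodes m n. \<Sum>s\<in>choices m n. f (s(n := v)))"
    by (simp add: sum.cartesian_product)
  also have "\<dots> = (\<Sum>s\<in>choices m n. \<Sum>v\<in>tree_nodes m n. f (s(n := v)))"
    by (rule sum.swap)
  finally show ?thesis
    unfolding avg_def ins using assms by (simp add: sum_divide_distrib[symmetric] mult.commute)
qed

lemma avg_prefix:
  assumes "1 \<le> k" "k \<le> n" "\<And>s i v. k \<le> i \<Longrightarrow> s \<in> choices m i \<Longrightarrow> f (s(i := v)) = f s"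
  shows "avg m n f = avg m k f"
  using assms(2)
proof (induction n rule: dec_induct)
  case (step n)
  have "avg m (Suc n) f = avg m n (\<lambda>s. (\<Sum>v\<in>tree_nodes m n. f s) / real (card (tree_nodes m n)))"
    using step.hyps assms(1) by (subst avg_Suc) (auto intro!: avg_cong sum.cong simp: assms(3) simp del: sum_constant)
  then show ?case using step by (simp add: card_gt_0_iff)
qed simp

text \<open>Depth relative to the tree with highest label \<open>K\<close>, along paths whose node of relative depth
  \<open>j\<close> has a label \<open>k\<close> with \<open>A j k\<close>.\<close>

inductive level :: "nat \<Rightarrow> (nat \<Rightarrow> nat \<Rightarrow> bool) \<Rightarrow> nat \<Rightarrow> (nat \<Rightarrow> node) \<Rightarrow> nat \<Rightarrow> node \<Rightarrow> bool"
  for m A K s where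
  level_0: "v \<in> tree_nodes m K \<Longrightarrow> level m A K s 0 v"
| level_Suc: "level m A K s j (s k) \<Longrightarrow> K \<le> k \<Longrightarrow> A (Suc j) (Suc k) \<Longrightarrow> i < m
    \<Longrightarrow> level m A K s (Suc j) (Suc k, i)"

lemma level_0_iff: "level m A K s 0 v \<longleftrightarrow> v \<in> tree_nodes m K"
  by (auto elim: level.cases intro: level_0)

lemma level_Suc_iff: "level m A K s (Suc j) (k, i)
    \<longleftrightarrow> K < k \<and> i < m \<and> A (Suc j) k \<and> level m A K s j (s (k - 1))"
proof
  assume "level m A K s (Suc j) (k, i)"
  then show "K < k \<and> i < m \<and> A (Suc j) k \<and> level m A K s j (s (k - 1))"
    by cases auto
next
  assume *: "K < k \<and> i < m \<and> A (Suc j) k \<and> level m A K s j (s (k - 1))"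
  then obtain l where "k = Suc l" "K \<le> l" by (cases k) auto
  then show "level m A K s (Suc j) (k, i)" using * by (auto intro!: level_Suc)
qed

lemma level_unique:
  assumes "1 \<le> K" "level m A K s j v" "level m A K s j' v"
  shows "j = j'"
  using assms(2,3)
proof (induction j arbitrary: j' v)
  case 0
  then show ?case using label_le[of v m K] assms(1)
    by (cases j'; cases v) (auto simp: level_0_iff level_Suc_iff)
next
  case (Suc j)
  obtain k i where v: "v = (k, i)" by force
  show ?case
  proof (cases j')
    case 0
    then show ?thesis using Suc.prems label_le[of v m K] assms(1)
      by (auto simp: level_0_iff level_Suc_iff v)
  next
    case (Suc l)
    then have "level m A K s j (s (k - 1))" "level m A K s l (s (k - 1))"
      using Suc.prems by (auto simp: level_Suc_iff v)
    then show ?thesis using Suc.IH Suc by blast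
  qed
qed

text \<open>Selection \<open>n\<close> only decides the parent of label \<open>Suc n\<close>. A
  valid history sends every smaller label to a still smaller one, so the ancestry of
  \<open>v\<close> never meets it.\<close>

lemma level_fun_upd:
  assumes "s \<in> choices m n" "1 \<le> K" "fst v \<le> n"
  shows "level m A K (s(n := w)) j v \<longleftrightarrow> level m A K s j v"
  using assms(3)
proof (induction j arbitrary: v)
  case (Suc j)
  obtain k i where v: "v = (k, i)" by force
  show ?case
  proof (cases "K < k")
    case True
    then have "s (k - 1) \<in> tree_nodes m (k - 1)"
      using Suc.prems assms by (intro choicesD) (auto simp: v)
    then have "fst (s (k - 1)) \<le> n"
      using label_le[of "s (k - 1)" m "k - 1"] Suc.prems True assms(2) unfolding v by fastforce
    then show ?thesis using Suc.IH[of "s (k - 1)"] Suc.prems True by (auto simp: v level_Suc_iff)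
  qed (simp add: v level_Suc_iff)
qed (simp add: level_0_iff)

definition level_count :: "nat \<Rightarrow> (nat \<Rightarrow> nat \<Rightarrow> bool) \<Rightarrow> nat \<Rightarrow> (nat \<Rightarrow> node) \<Rightarrow> nat \<Rightarrow> nat \<Rightarrow> nat" where
  "level_count m A K s j n = card {v \<in> tree_nodes m n. level m A K s j v}"

lemma level_count_0: "K \<le> n \<Longrightarrow> level_count m A K s 0 n = card (tree_nodes m K)"
proof -
  assume "K \<le> n"
  then have "{v \<in> tree_nodes m n. level m A K s 0 v} = tree_nodes m K"
    using tree_nodes_mono[of K n m] by (auto simp: level_0_iff)
  then show ?thesis by (simp add: level_count_def)
qed

lemma level_count_base: "1 \<le> K \<Longrightarrow> level_count m A K s (Suc j) K = 0"
proof -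
  assume "1 \<le> K"
  then have "{v \<in> tree_nodes m K. level m A K s (Suc j) v} = {}"
    using label_le[of _ m K] by (force simp: level_Suc_iff)
  then show ?thesis by (simp add: level_count_def)
qed

lemma level_count_Suc:
  assumes "s \<in> choices m n" "1 \<le> K" "K \<le> n" "v \<in> tree_nodes m n"
  shows "level_count m A K (s(n := v)) (Suc j) (Suc n)
    = level_count m A K s (Suc j) n + (if A (Suc j) (Suc n) \<and> level m A K s j v then m else 0)"
proof -
  let ?s = "s(n := v)"
  have n: "1 \<le> n" using assms by simp
  have 1: "{u \<in> tree_nodes m n. level m A K ?s (Suc j) u} = {u \<in> tree_nodes m n. level m A K s (Suc j) u}"
    using level_fun_upd[OF assms(1,2)] label_le[OF _ n] by blast
  have 2: "level m A K ?s (Suc j) (Suc n, i) \<longleftrightarrow> i < m \<and> A (Suc j) (Suc n) \<and> level m A K s j v" for i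
    using level_fun_upd[OF assms(1,2) label_le[OF assms(4) n]] assms(3) by (auto simp: level_Suc_iff)
  have "{u \<in> tree_nodes m (Suc n). level m A K ?s (Suc j) u}
      = {u \<in> tree_nodes m n. level m A K s (Suc j) u}
        \<union> (if A (Suc j) (Suc n) \<and> level m A K s j v then {Suc n} \<times> {..<m} else {})"
    unfolding tree_nodes_Suc[OF n] 1[symmetric] using 2 by auto
  moreover have "{u \<in> tree_nodes m n. level m A K s (Suc j) u} \<inter> {Suc n} \<times> {..<m} = {}"
    using new_notin_tree_nodes[OF n] by auto
  ultimately show ?thesis
    by (simp add: level_count_def card_Un_disjoint card_cartesian_product)
qed

lemma sum_level_indicator:
  "(\<Sum>v\<in>tree_nodes m n. if level m A K s j v then c else 0) = c * real (level_count m A K s j n)"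
  by (simp add: level_count_def sum.If_cases Int_def mult.commute)

text \<open>The definition of \<open>green\<close> peels off the last node of a path. This is the
  dual recursion, by whether the first new node has label \<open>Suc k\<close>; it yields the
  martingale property in the second moment.\<close>

lemma green_backward:
  assumes "k < n"
  shows "green m A k (Suc j) n = green m A (Suc k) (Suc j) n
    + (if A 1 (Suc k) then wt m (Suc k) * green m (\<lambda>l. A (Suc l)) (Suc k) j n else 0)"
proof -
  have "Suc k \<le> n" using assms by simp
  then show ?thesis
  proof (induction n arbitrary: j rule: dec_induct)
    case base
    show ?case by (cases j) (simp_all add: green_eq_0)
  next
    case (step n)
    show ?case
    proof (cases j)
      case 0
      then show ?thesis using step.hyps step.IH[of 0] by (simp add: algebra_simps)
    next
      case (Suc i)
      then show ?thesis using step.hyps step.IH[of j] step.IH[of i] by (simp add: algebra_simps)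
    qed
  qed
qed

lemma wt_Suc_card: "1 \<le> n \<Longrightarrow> wt m (Suc n) = real m / real (card (tree_nodes m n))"
  by (simp add: wt_Suc card_tree_nodes)

lemma avg_level_count:
  assumes "1 \<le> K" "K \<le> n"
  shows "avg m n (\<lambda>s. real (level_count m A K s j n)) = real (card (tree_nodes m K)) * green m A K j n"
  using assms(2)
proof (induction n arbitrary: j rule: dec_induct)
  case base
  then show ?case using assms(1)
    by (cases j) (simp_all add: level_count_0 level_count_base green_eq_0)
next
  case (step n)
  let ?c = "real (card (tree_nodes m n))"
  have n: "1 \<le> n" and c: "?c > 0" using step assms by (auto simp: card_gt_0_iff)
  show ?case
  proof (cases j)
    case 0
    then show ?thesis using step by (simp add: level_count_0)
  next
    case (Suc i)
    have "avg m (Suc n) (\<lambda>s. real (level_count m A K s j (Suc n)))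
        = avg m n (\<lambda>s. real (level_count m A K s j n)
            + (if A j (Suc n) then wt m (Suc n) else 0) * real (level_count m A K s i n))"
      unfolding avg_Suc[OF n]
    proof (rule avg_cong)
      fix s assume s: "s \<in> choices m n"
      have "(\<Sum>v\<in>tree_nodes m n. real (level_count m A K (s(n := v)) j (Suc n)))
          = (\<Sum>v\<in>tree_nodes m n. real (level_count m A K s j n)
              + (if level m A K s i v then if A j (Suc n) then real m else 0 else 0))"
        unfolding Suc using s step assms by (intro sum.cong) (auto simp: level_count_Suc)
      also have "\<dots> = ?c * real (level_count m A K s j n)
          + (if A j (Suc n) then real m else 0) * real (level_count m A K s i n)"
        by (simp only: sum.distrib sum_level_indicator sum_constant)
      finally show "(\<Sum>v\<in>tree_nodes m n. real (level_count m A K (s(n := v)) j (Suc n))) / ?c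
          = real (level_count m A K s j n)
            + (if A j (Suc n) then wt m (Suc n) else 0) * real (level_count m A K s i n)"
        using c wt_Suc_card[OF n] by (simp add: add_divide_distrib)
    qed
    also have "\<dots> = real (card (tree_nodes m K)) * green m A K j n
        + (if A j (Suc n) then wt m (Suc n) else 0) * (real (card (tree_nodes m K)) * green m A K i n)"
      by (simp only: avg_add avg_mult step.IH)
    also have "\<dots> = real (card (tree_nodes m K)) * green m A K j (Suc n)"
      using Suc step by (simp add: algebra_simps)
    finally show ?thesis .
  qed
qed

section \<open>The second moment of level counts\<close>

lemma sum_unique_square:
  fixes f :: "nat \<Rightarrow> real"
  assumes "finite I" "\<And>i j. i \<in> I \<Longrightarrow> j \<in> I \<Longrightarrow> P i \<Longrightarrow> P j \<Longrightarrow> i = j"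
  shows "(\<Sum>i\<in>I. if P i then f i else 0)\<^sup>2 = (\<Sum>i\<in>I. if P i then (f i)\<^sup>2 else 0)"
proof (cases "\<exists>i\<in>I. P i")
  case True
  then obtain i where i: "i \<in> I" "P i" by blast
  have "(\<Sum>j\<in>I. if P j then g j else 0) = g i" for g :: "nat \<Rightarrow> real"
  proof -
    have "(\<Sum>j\<in>I. if P j then g j else 0) = (\<Sum>j\<in>I. if j = i then g j else 0)"
      using i assms(2) by (intro sum.cong) auto
    then show ?thesis using assms(1) i by simp
  qed
  then show ?thesis by simp
qed (auto intro!: sum.neutral)

text \<open>The sum of the mean squared martingale jumps, per node of the tree with highest label
  \<open>K\<close>. A jump at a node of depth \<open>j\<close> is \<open>m\<close> times the
  expected continuation; squaring and dividing by the number of nodes leaves \<open>m * wt\<close>.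
  It amounts to counting pairs of paths that share a parent of label \<open>Suc k\<close> nodes and
  are then treated as independent.\<close>

definition pair_sum :: "nat \<Rightarrow> (nat \<Rightarrow> nat \<Rightarrow> bool) \<Rightarrow> nat \<Rightarrow> nat \<Rightarrow> nat \<Rightarrow> real" where
  "pair_sum m A K d n = (\<Sum>k\<in>{K..<n}. real m * wt m (Suc k) * (\<Sum>j<d. if A (Suc j) (Suc k) then
    green m A K j k * (green m (\<lambda>l. A (Suc j + l)) (Suc k) (d - Suc j) n)\<^sup>2 else 0))"

text \<open>Second moment of the number of nodes of relative depth \<open>d\<close>: it is the final value of a
  martingale, whose increment at step \<open>k\<close> is the centered contribution of the new label.\<close>

lemma avg_level_count_square_le:
  assumes "1 \<le> K" "K \<le> n"
  shows "avg m n (\<lambda>s. (real (level_count m A K s d n))\<^sup>2)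
    \<le> (real (card (tree_nodes m K)) * green m A K d n)\<^sup>2
      + real (card (tree_nodes m K)) * pair_sum m A K d n"
proof -
  define R where "R = real (card (tree_nodes m K))"
  define G where "G k j = green m (\<lambda>l. A (j + l)) k (d - j) n" for k j
  \<comment> \<open>\<open>Z s k\<close> is the conditional mean of the final count given the tree
    with highest label \<open>k\<close>: \<open>G k j\<close> counts the expected descendants,
    through labels above \<open>k\<close>, of one node of relative depth \<open>j\<close>.
    Descendants through older children are counted at these children.\<close>
  define Z where "Z s k = (\<Sum>j\<le>d. real (level_count m A K s j k) * G k j)" for s k
  define V where "V k = real m * wt m (Suc k) * (\<Sum>j<d. if A (Suc j) (Suc k) then
      R * green m A K j k * (G (Suc k) (Suc j))\<^sup>2 else 0)" for k
  have split: "G k j = G (Suc k) j + (if A (Suc j) (Suc k) then wt m (Suc k) * G (Suc k) (Suc j) else 0)"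
    if "k < n" "j < d" for k j
    using green_backward[OF that(1), of m "\<lambda>l. A (j + l)" "d - Suc j"] that(2)
    by (simp add: G_def Suc_diff_Suc)
  have top: "G k d = 1" for k by (simp add: G_def)
  have step: "avg m (Suc k) (\<lambda>s. (Z s (Suc k))\<^sup>2) \<le> avg m k (\<lambda>s. (Z s k)\<^sup>2) + V k"
    if k: "K \<le> k" "k < n" for k
  proof -
    let ?c = "real (card (tree_nodes m k))"
    have k1: "1 \<le> k" and c: "?c > 0" using k assms by (auto simp: card_gt_0_iff)
    have w: "wt m (Suc k) = real m / ?c" using wt_Suc_card[OF k1] .
    define W where "W s = (\<Sum>j<d. if A (Suc j) (Suc k) then
      real (level_count m A K s j k) * (G (Suc k) (Suc j))\<^sup>2 else 0)" for s
    have "(\<Sum>v\<in>tree_nodes m k. (Z (s(k := v)) (Suc k))\<^sup>2) / ?c \<le> (Z s k)\<^sup>2 + real m * wt m (Suc k) * W s"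
      if s: "s \<in> choices m k" for s
    proof -
      define B where "B = (\<Sum>j\<le>d. real (level_count m A K s j k) * G (Suc k) j)"
      define X where "X v = (\<Sum>j<d. if A (Suc j) (Suc k) \<and> level m A K s j v then G (Suc k) (Suc j) else 0)" for v
      have Zv: "Z (s(k := v)) (Suc k) = B + real m * X v" if v: "v \<in> tree_nodes m k" for v
      proof -
        have "Z (s(k := v)) (Suc k) = real (level_count m A K (s(k := v)) 0 (Suc k)) * G (Suc k) 0
          + (\<Sum>j<d. real (level_count m A K (s(k := v)) (Suc j) (Suc k)) * G (Suc k) (Suc j))"
          unfolding Z_def by (rule sum.atMost_shift)
        also have "level_count m A K (s(k := v)) 0 (Suc k) = level_count m A K s 0 k"
          using k by (simp add: level_count_0)
        also have "(\<Sum>j<d. real (level_count m A K (s(k := v)) (Suc j) (Suc k)) * G (Suc k) (Suc j))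
          = (\<Sum>j<d. real (level_count m A K s (Suc j) k) * G (Suc k) (Suc j)
              + real m * (if A (Suc j) (Suc k) \<and> level m A K s j v then G (Suc k) (Suc j) else 0))"
          using level_count_Suc[OF s assms(1) k(1) v]
          by (intro sum.cong) (auto simp: algebra_simps)
        also have "\<dots> = (\<Sum>j<d. real (level_count m A K s (Suc j) k) * G (Suc k) (Suc j)) + real m * X v"
          by (simp add: sum.distrib sum_distrib_left X_def)
        also have "real (level_count m A K s 0 k) * G (Suc k) 0 + ((\<Sum>j<d. real (level_count m A K s (Suc j) k) * G (Suc k) (Suc j)) + real m * X v)
          = B + real m * X v"
          unfolding B_def by (simp add: sum.atMost_shift)
        finally show ?thesis .
      qed
      have sumX: "(\<Sum>v\<in>tree_nodes m k. X v)
        = (\<Sum>j<d. if A (Suc j) (Suc k) then real (level_count m A K s j k) * G (Suc k) (Suc j) else 0)"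
      proof -
        have "(\<Sum>v\<in>tree_nodes m k. X v) = (\<Sum>j<d. \<Sum>v\<in>tree_nodes m k. if level m A K s j v then
            (if A (Suc j) (Suc k) then G (Suc k) (Suc j) else 0) else 0)"
          unfolding X_def by (subst sum.swap) (auto intro!: sum.cong)
        then show ?thesis by (auto simp: sum_level_indicator mult.commute intro!: sum.cong)
      qed
      \<comment> \<open>A node has only one relative depth, so the square of \<open>X v\<close> has
        no cross terms.\<close>
      have sumX2: "(\<Sum>v\<in>tree_nodes m k. (X v)\<^sup>2) = W s"
      proof -
        have "(\<Sum>v\<in>tree_nodes m k. (X v)\<^sup>2) = (\<Sum>v\<in>tree_nodes m k. \<Sum>j<d.
            if A (Suc j) (Suc k) \<and> level m A K s j v then (G (Suc k) (Suc j))\<^sup>2 else 0)"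
          unfolding X_def using level_unique[OF assms(1)]
          by (intro sum.cong refl sum_unique_square) auto
        also have "\<dots> = (\<Sum>j<d. \<Sum>v\<in>tree_nodes m k. if level m A K s j v then
            (if A (Suc j) (Suc k) then (G (Suc k) (Suc j))\<^sup>2 else 0) else 0)"
          by (subst sum.swap) (auto intro!: sum.cong)
        finally show ?thesis by (auto simp: sum_level_indicator W_def mult.commute intro!: sum.cong)
      qed
      \<comment> \<open>The martingale property: by the backward recursion, the mean jump
        compensates the change from \<open>G k\<close> to \<open>G (Suc k)\<close>.\<close>
      have drift: "B + wt m (Suc k) * (\<Sum>v\<in>tree_nodes m k. X v) = Z s k"
      proof -
        have "Z s k = (\<Sum>j<d. real (level_count m A K s j k) * G k j) + real (level_count m A K s d k) * G k d"
          unfolding Z_def by (simp add: lessThan_Suc_atMost[symmetric])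
        also have "(\<Sum>j<d. real (level_count m A K s j k) * G k j)
            = (\<Sum>j<d. real (level_count m A K s j k) * G (Suc k) j
              + wt m (Suc k) * (if A (Suc j) (Suc k) then real (level_count m A K s j k) * G (Suc k) (Suc j) else 0))"
          using split[OF k(2)] by (intro sum.cong) (auto simp: algebra_simps)
        also have "\<dots> = (\<Sum>j<d. real (level_count m A K s j k) * G (Suc k) j)
            + wt m (Suc k) * (\<Sum>v\<in>tree_nodes m k. X v)"
          unfolding sumX by (simp add: sum.distrib sum_distrib_left)
        finally show ?thesis by (simp add: B_def lessThan_Suc_atMost[symmetric] top)
      qed
      have "(\<Sum>v\<in>tree_nodes m k. (Z (s(k := v)) (Suc k))\<^sup>2)
          = (\<Sum>v\<in>tree_nodes m k. B\<^sup>2 + 2 * B * real m * X v + (real m)\<^sup>2 * (X v)\<^sup>2)"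
        by (intro sum.cong) (auto simp: Zv power2_eq_square algebra_simps)
      also have "\<dots> = ?c * B\<^sup>2 + 2 * B * real m * (\<Sum>v\<in>tree_nodes m k. X v) + (real m)\<^sup>2 * W s"
        by (simp add: sum.distrib sum_distrib_left[symmetric] sumX2)
      finally have "(\<Sum>v\<in>tree_nodes m k. (Z (s(k := v)) (Suc k))\<^sup>2) / ?c
          = B\<^sup>2 + 2 * B * (wt m (Suc k) * (\<Sum>v\<in>tree_nodes m k. X v)) + real m * wt m (Suc k) * W s"
        using c by (simp add: w field_simps power2_eq_square)
      \<comment> \<open>Only the square of the mean jump is given away, that is, the variance of the
        jump is bounded by its second moment.\<close>
      also have "\<dots> \<le> (B + wt m (Suc k) * (\<Sum>v\<in>tree_nodes m k. X v))\<^sup>2 + real m * wt m (Suc k) * W s"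
        by (simp add: power2_sum)
      finally show ?thesis unfolding drift .
    qed
    then have "avg m (Suc k) (\<lambda>s. (Z s (Suc k))\<^sup>2) \<le> avg m k (\<lambda>s. (Z s k)\<^sup>2 + real m * wt m (Suc k) * W s)"
      unfolding avg_Suc[OF k1] by (intro avg_mono)
    also have "\<dots> = avg m k (\<lambda>s. (Z s k)\<^sup>2) + real m * wt m (Suc k) * avg m k W"
      by (simp only: avg_add avg_mult)
    also have "avg m k W = (\<Sum>j<d. avg m k (\<lambda>s. if A (Suc j) (Suc k) then
      real (level_count m A K s j k) * (G (Suc k) (Suc j))\<^sup>2 else 0))"
      unfolding W_def by (rule avg_sum)
    also have "\<dots> = (\<Sum>j<d. if A (Suc j) (Suc k) then
      R * green m A K j k * (G (Suc k) (Suc j))\<^sup>2 else 0)"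
    proof (intro sum.cong refl)
      fix j
      show "avg m k (\<lambda>s. if A (Suc j) (Suc k) then real (level_count m A K s j k) * (G (Suc k) (Suc j))\<^sup>2 else 0)
        = (if A (Suc j) (Suc k) then R * green m A K j k * (G (Suc k) (Suc j))\<^sup>2 else 0)"
        using avg_mult[of m k "(G (Suc k) (Suc j))\<^sup>2" "\<lambda>s. real (level_count m A K s j k)"]
          avg_level_count[OF assms(1) k(1), of m A j]
        by (simp add: R_def mult.commute)
    qed
    finally show ?thesis by (simp add: V_def)
  qed
  have "avg m k (\<lambda>s. (Z s k)\<^sup>2) \<le> (R * green m A K d n)\<^sup>2 + (\<Sum>k\<in>{K..<k}. V k)" if "K \<le> k" "k \<le> n" for k
    using that
  proof (induction k rule: dec_induct)
    case base
    have "Z s K = R * green m A K d n" for s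
    proof -
      have "Z s K = (\<Sum>j\<le>d. if j = 0 then R * G K 0 else 0)"
        unfolding Z_def
      proof (intro sum.cong refl)
        fix j
        show "real (level_count m A K s j K) * G K j = (if j = 0 then R * G K 0 else 0)"
          using assms(1) by (cases j) (auto simp: level_count_0 level_count_base R_def)
      qed
      then show ?thesis by (simp add: G_def)
    qed
    then show ?case by simp
  next
    case (step k)
    then show ?case using \<open>\<And>k. K \<le> k \<Longrightarrow> k < n \<Longrightarrow> _ k \<le> _\<close>[of k] by (simp add: sum.atLeastLessThan_Suc)
  qed
  from this[OF assms(2) order_refl]
  have "avg m n (\<lambda>s. (Z s n)\<^sup>2) \<le> (R * green m A K d n)\<^sup>2 + (\<Sum>k\<in>{K..<n}. V k)" .
  moreover have "Z s n = real (level_count m A K s d n)" for s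
  proof -
    have "Z s n = (\<Sum>j\<le>d. if j = d then real (level_count m A K s d n) else 0)"
      unfolding Z_def
    proof (intro sum.cong refl)
      fix j assume "j \<in> {..d}"
      then show "real (level_count m A K s j n) * G n j = (if j = d then real (level_count m A K s d n) else 0)"
        by (cases "d - j") (auto simp: G_def green_eq_0)
    qed
    then show ?thesis by simp
  qed
  moreover have "(\<Sum>k\<in>{K..<n}. V k) = R * pair_sum m A K d n"
    unfolding V_def G_def pair_sum_def sum_distrib_left by (intro sum.cong refl) auto
  ultimately show ?thesis by (simp only: R_def)
qed

text \<open>Chebyshev's inequality without division: where the count vanishes, its squared distance
  from the mean equals the squared mean.\<close>

lemma avg_no_level_le:
  assumes "1 \<le> K" "K \<le> n"
  shows "avg m n (\<lambda>s. if level_count m A K s d n = 0 then 1 else 0)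
      * (real (card (tree_nodes m K)) * green m A K d n)\<^sup>2
    \<le> real (card (tree_nodes m K)) * pair_sum m A K d n"
proof -
  define e where "e = real (card (tree_nodes m K)) * green m A K d n"
  let ?c = "\<lambda>s. real (level_count m A K s d n)"
  have "avg m n (\<lambda>s. if level_count m A K s d n = 0 then 1 else 0) * e\<^sup>2
      = avg m n (\<lambda>s. e\<^sup>2 * (if level_count m A K s d n = 0 then 1 else 0))"
    by (simp only: avg_mult mult.commute)
  also have "\<dots> \<le> avg m n (\<lambda>s. (?c s)\<^sup>2 - (2 * e) * ?c s + e\<^sup>2)"
  proof (rule avg_mono)
    fix s
    have "0 \<le> (?c s - e)\<^sup>2" by simp
    then show "e\<^sup>2 * (if level_count m A K s d n = 0 then 1 else 0) \<le> (?c s)\<^sup>2 - (2 * e) * ?c s + e\<^sup>2"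
      by (auto simp: power2_diff algebra_simps)
  qed
  also have "\<dots> = avg m n (\<lambda>s. (?c s)\<^sup>2) - 2 * e * avg m n ?c + e\<^sup>2"
    by (simp only: avg_add avg_diff avg_mult avg_const)
  also have "\<dots> = avg m n (\<lambda>s. (?c s)\<^sup>2) - e\<^sup>2"
    using avg_level_count[OF assms, of m A d] by (simp add: e_def power2_eq_square)
  finally show ?thesis using avg_level_count_square_le[OF assms, of m A d] by (simp add: e_def)
qed

section \<open>Height and probabilities\<close>

abbreviation depth :: "nat \<Rightarrow> (nat \<Rightarrow> node) \<Rightarrow> nat \<Rightarrow> node \<Rightarrow> bool" where
  "depth m s \<equiv> level m (\<lambda>_ _. True) 1 s"

definition valid_choices :: "nat \<Rightarrow> nat \<Rightarrow> (nat \<Rightarrow> node) \<Rightarrow> bool" where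
  "valid_choices m n s \<longleftrightarrow> (\<forall>k. 1 \<le> k \<longrightarrow> k < n \<longrightarrow> s k \<in> tree_nodes m k)"

lemma valid_choicesD: "valid_choices m n s \<Longrightarrow> 1 \<le> k \<Longrightarrow> k < n \<Longrightarrow> s k \<in> tree_nodes m k"
  by (simp add: valid_choices_def)

lemma valid_choicesI: "s \<in> choices m n \<Longrightarrow> valid_choices m n s"
  by (simp add: valid_choices_def choicesD)

lemma tree_nodes_one: "tree_nodes m (Suc 0) = {tree_root}"
  by (auto simp: tree_nodes_def)

lemma parent_in_nodes:
  assumes "valid_choices m n s" "(k, i) \<in> tree_nodes m n" "1 < k" "1 \<le> n"
  shows "s (k - 1) \<in> tree_nodes m (k - 1)" "s (k - 1) \<in> tree_nodes m n" "k - 1 < n"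
proof -
  have "k \<le> n" using label_le[OF assms(2,4)] by simp
  then show "k - 1 < n" using assms by simp
  show "s (k - 1) \<in> tree_nodes m (k - 1)"
    using \<open>k \<le> n\<close> assms by (intro valid_choicesD[OF assms(1)]) auto
  then show "s (k - 1) \<in> tree_nodes m n"
    using tree_nodes_mono[of "k - 1" n m] \<open>k - 1 < n\<close> by auto
qed

lemma depth_less_label:
  assumes "valid_choices m n s" "1 \<le> n" "v \<in> tree_nodes m n" "depth m s j v"
  shows "j < fst v"
  using assms(3,4)
proof (induction j arbitrary: v)
  case 0
  then show ?case by (simp add: level_0_iff tree_nodes_one tree_root_def)
next
  case (Suc j)
  obtain k i where v: "v = (k, i)" by force
  have k: "1 < k" "depth m s j (s (k - 1))" using Suc.prems by (auto simp: v level_Suc_iff)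
  note p = parent_in_nodes[OF assms(1) Suc.prems(1)[unfolded v] k(1) assms(2)]
  have "j < fst (s (k - 1))" using Suc.IH k p by blast
  moreover have "fst (s (k - 1)) \<le> k - 1" using label_le[OF p(1)] k(1) by linarith
  ultimately show ?case by (simp add: v)
qed

lemma node_has_depth:
  assumes "valid_choices m n s" "1 \<le> n" "v \<in> tree_nodes m n"
  shows "\<exists>j. depth m s j v"
  using assms(2,1,3)
proof (induction n arbitrary: v rule: dec_induct)
  case base
  then show ?case by (auto intro: level_0)
next
  case (step n)
  have val: "valid_choices m n s" using step.prems by (simp add: valid_choices_def)
  show ?case
  proof (cases "v \<in> tree_nodes m n")
    case True
    then show ?thesis using step.IH val by blast
  next
    case False
    then obtain i where v: "v = (Suc n, i)" "i < m"
      using step.prems(2) step.hyps by (auto simp: tree_nodes_Suc)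
    have "s n \<in> tree_nodes m n"
      using step.prems(1) step.hyps(1) by (rule valid_choicesD) simp
    then obtain j where "depth m s j (s n)" using step.IH val by blast
    then have "depth m s (Suc j) v" using v step.hyps by (simp add: level_Suc_iff)
    then show ?thesis by blast
  qed
qed

text \<open>A relative path may start at any node of the tree with highest label \<open>K\<close>;
  the depth of its start is added.\<close>

lemma level_imp_depth:
  assumes "valid_choices m n s" "1 \<le> K" "K \<le> n" "v \<in> tree_nodes m n" "level m A K s j v"
  shows "\<exists>i\<ge>j. depth m s i v"
  using assms(4,5)
proof (induction j arbitrary: v)
  case 0
  then show ?case using node_has_depth[OF assms(1) _ 0(1)] assms by auto
next
  case (Suc j)
  obtain k i where v: "v = (k, i)" by force
  have k: "K < k" "i < m" "level m A K s j (s (k - 1))" using Suc.prems by (auto simp: v level_Suc_iff)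
  have "s (k - 1) \<in> tree_nodes m n"
    using parent_in_nodes(2)[OF assms(1) Suc.prems(1)[unfolded v]] k assms by auto
  then obtain l where "j \<le> l" "depth m s l (s (k - 1))" using Suc.IH k by blast
  then have "depth m s (Suc l) v" "Suc j \<le> Suc l" using k assms by (auto simp: v level_Suc_iff)
  then show ?case by blast
qed

text \<open>The labels \<open>f\<close> of the ancestors are fixed before the constraint
  \<open>A\<close> is chosen. This allows \<open>hit_union\<close> to select a constraint that
  depends on where the path peaks.\<close>

lemma level_path:
  assumes "valid_choices m n s" "1 \<le> n" "v \<in> tree_nodes m n" "depth m s j v"
  shows "\<exists>f. (\<forall>i. 1 \<le> i \<longrightarrow> i \<le> j \<longrightarrow> (\<exists>u \<in> tree_nodes m n. fst u = f i \<and> depth m s i u))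
    \<and> (\<forall>A. (\<forall>i. 1 \<le> i \<longrightarrow> i \<le> j \<longrightarrow> A i (f i)) \<longrightarrow> level m A 1 s j v)"
  using assms(3,4)
proof (induction j arbitrary: v)
  case 0
  then show ?case by (auto simp: level_0_iff)
next
  case (Suc j)
  obtain k i where v: "v = (k, i)" by force
  have k: "1 < k" "i < m" "depth m s j (s (k - 1))" using Suc.prems by (auto simp: v level_Suc_iff)
  have "s (k - 1) \<in> tree_nodes m n"
    using parent_in_nodes(2)[OF assms(1) Suc.prems(1)[unfolded v]] k assms by auto
  from Suc.IH[OF this k(3)] obtain f where
    f: "\<And>i. 1 \<le> i \<Longrightarrow> i \<le> j \<Longrightarrow> \<exists>u \<in> tree_nodes m n. fst u = f i \<and> depth m s i u"
      "\<And>A. (\<And>i. 1 \<le> i \<Longrightarrow> i \<le> j \<Longrightarrow> A i (f i)) \<Longrightarrow> level m A 1 s j (s (k - 1))"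
    by blast
  let ?f = "f(Suc j := k)"
  have "\<exists>u \<in> tree_nodes m n. fst u = ?f l \<and> depth m s l u" if "1 \<le> l" "l \<le> Suc j" for l
  proof (cases "l = Suc j")
    case True
    then show ?thesis using Suc.prems v by (intro bexI[of _ v]) auto
  next
    case False
    then show ?thesis using f(1)[of l] that by auto
  qed
  moreover have "level m A 1 s (Suc j) v" if A: "\<forall>i. 1 \<le> i \<longrightarrow> i \<le> Suc j \<longrightarrow> A i (?f i)" for A
  proof -
    have "A i (f i)" if "1 \<le> i" "i \<le> j" for i using A[rule_format, of i] that by simp
    then have "level m A 1 s j (s (k - 1))" by (rule f(2))
    moreover have "A (Suc j) k" using A[rule_format, of "Suc j"] by simp
    ultimately show ?thesis using k by (simp add: v level_Suc_iff)
  qed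
  ultimately show ?case by blast
qed

text \<open>A node of greatest depth has no child, so the maximum over leaves is the maximum over
  all nodes. The occurring depths form an initial segment, because parents are nodes too.\<close>

lemma height_ge_iff:
  assumes "valid_choices m n s" "1 \<le> n"
  shows "j \<le> tree_height m s n \<longleftrightarrow> (\<exists>v\<in>tree_nodes m n. depth m s j v)"
proof -
  let ?E = "tree_edges m s n"
  define D where "D = {d. \<exists>v\<in>tree_nodes m n. depth m s d v}"
  have D_iff: "d \<in> D \<longleftrightarrow> (\<exists>v\<in>tree_nodes m n. depth m s d v)" for d by (simp add: D_def)
  have edge: "depth m s (Suc d) w" "w \<in> tree_nodes m n"
    if "(u, w) \<in> ?E" "depth m s d u" for d u w
    using that by (auto simp: tree_edges_def level_Suc_iff tree_nodes_def)
  have reach: "v \<in> tree_nodes m n \<and> depth m s d v" if "(tree_root, v) \<in> ?E ^^ d" for d v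
    using that
  proof (induction d arbitrary: v)
    case 0
    then show ?case by (simp add: level_0_iff)
  next
    case (Suc d)
    then show ?case using edge by (elim relpow_Suc_E) blast
  qed
  have conv: "(tree_root, v) \<in> ?E ^^ d" if "v \<in> tree_nodes m n" "depth m s d v" for d v
    using that
  proof (induction d arbitrary: v)
    case 0
    then show ?case by (simp add: level_0_iff tree_nodes_one)
  next
    case (Suc d)
    obtain k i where v: "v = (k, i)" by force
    have k: "1 < k" "i < m" "depth m s d (s (k - 1))" using Suc.prems by (auto simp: v level_Suc_iff)
    note p = parent_in_nodes[OF assms(1) Suc.prems(1)[unfolded v] k(1) assms(2)]
    have "(s (k - 1), (Suc (k - 1), i)) \<in> ?E"
      unfolding tree_edges_def using p k by auto
    then have "(s (k - 1), v) \<in> ?E" using k v by simp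
    moreover have "(tree_root, s (k - 1)) \<in> ?E ^^ d" using Suc.IH p k by blast
    ultimately show ?case by (rule relpow_Suc_I[rotated])
  qed
  have "D \<subseteq> {..n}"
    using depth_less_label[OF assms] label_le[OF _ assms(2)] by (fastforce simp: D_def)
  then have fin: "finite D" by (rule finite_subset) simp
  have "0 \<in> D" by (auto simp: D_def level_0_iff intro!: bexI[of _ tree_root])
  then have M: "Max D \<in> D" using fin by (intro Max_in) auto
  then obtain v where v: "v \<in> tree_nodes m n" "depth m s (Max D) v" by (auto simp: D_def)
  have "v \<in> tree_leaves m s n"
  proof -
    have "(v, w) \<notin> ?E" for w
    proof
      assume "(v, w) \<in> ?E"
      then have "Suc (Max D) \<in> D" unfolding D_iff using edge[OF _ v(2)] by blast
      then show False using Max_ge[OF fin] by fastforce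
    qed
    then show ?thesis using v by (simp add: tree_leaves_def)
  qed
  then have "Max D \<in> {d. \<exists>v\<in>tree_leaves m s n. (tree_root, v) \<in> ?E ^^ d}"
    using conv v by blast
  moreover have "d \<le> Max D" if "\<exists>v\<in>tree_leaves m s n. (tree_root, v) \<in> ?E ^^ d" for d
    using that reach fin by (intro Max_ge) (auto simp: D_def)
  ultimately have H: "tree_height m s n = Max D"
    unfolding tree_height_def using \<open>D \<subseteq> {..n}\<close>
    by (intro Max_eqI) (auto intro!: finite_subset[of _ "{..Max D}"])
  have down: "j \<in> D" if S: "Suc j \<in> D" for j
  proof -
    obtain u where "u \<in> tree_nodes m n" "depth m s (Suc j) u"
      using S unfolding D_iff by blast
    then obtain k i where v: "(k, i) \<in> tree_nodes m n" "depth m s (Suc j) (k, i)"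
      by (cases u) blast
    then have k: "1 < k" "depth m s j (s (k - 1))" by (auto simp: level_Suc_iff)
    then show ?thesis using parent_in_nodes(2)[OF assms(1) v(1) k(1) assms(2)] unfolding D_iff by blast
  qed
  have "j \<in> D" if "j \<le> Max D"
    using that
  proof (induction rule: inc_induct)
    case base
    show ?case by (rule M)
  next
    case (step k)
    show ?case by (rule down) (rule step.IH)
  qed
  then have "j \<le> Max D \<longleftrightarrow> j \<in> D" using Max_ge[OF fin] by blast
  then show ?thesis unfolding H by (simp add: D_def)
qed

lemma height_mono:
  assumes "valid_choices m n s" "1 \<le> k" "k \<le> n"
  shows "tree_height m s k \<le> tree_height m s n"
proof -
  have "valid_choices m k s" using assms by (simp add: valid_choices_def)
  then obtain v where "v \<in> tree_nodes m k" "depth m s (tree_height m s k) v"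
    using height_ge_iff[of m k s "tree_height m s k"] assms by auto
  then show ?thesis
    using height_ge_iff[of m n s "tree_height m s k"] assms tree_nodes_mono[OF assms(3), of m] by auto
qed

lemma height_cong:
  assumes "\<And>i. 1 \<le> i \<Longrightarrow> i < n \<Longrightarrow> s i = s' i"
  shows "tree_height m s n = tree_height m s' n"
proof -
  have E: "tree_edges m s n = tree_edges m s' n"
    using assms by (auto simp: tree_edges_def)
  show ?thesis by (simp add: tree_height_def tree_leaves_def E)
qed

section \<open>From averages to probabilities\<close>

context recursive_tree
begin

lemma S_measurable: "1 \<le> i \<Longrightarrow> S i \<in> M \<rightarrow>\<^sub>M count_space UNIV"
  using indep_selections by (auto simp: indep_vars_def2)

text \<open>Nodes form a countable type, so an event that depends on finitely many selections is a
  countable union of cylinders.\<close>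

lemma event_prefix:
  assumes "\<And>s s'. (\<And>i. 1 \<le> i \<Longrightarrow> i < n \<Longrightarrow> s i = s' i) \<Longrightarrow> P s = P s'"
  shows "{\<omega> \<in> space M. P (\<lambda>k. S k \<omega>)} \<in> events"
proof -
  let ?L = "{l::node list. length l = n \<and> P (\<lambda>i. l ! i)}"
  have "{\<omega> \<in> space M. P (\<lambda>k. S k \<omega>)} = (\<Union>l\<in>?L. {\<omega> \<in> space M. \<forall>i\<in>{1..<n}. S i \<omega> = l ! i})"
  proof (intro equalityI subsetI)
    fix \<omega> assume \<omega>: "\<omega> \<in> {\<omega> \<in> space M. P (\<lambda>k. S k \<omega>)}"
    let ?l = "map (\<lambda>i. S i \<omega>) [0..<n]"
    have "P (\<lambda>i. ?l ! i) = P (\<lambda>k. S k \<omega>)" by (rule assms) simp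
    then have "?l \<in> ?L" using \<omega> by simp
    then show "\<omega> \<in> (\<Union>l\<in>?L. {\<omega> \<in> space M. \<forall>i\<in>{1..<n}. S i \<omega> = l ! i})"
      using \<omega> by (intro UN_I[of ?l]) auto
  next
    fix \<omega> assume "\<omega> \<in> (\<Union>l\<in>?L. {\<omega> \<in> space M. \<forall>i\<in>{1..<n}. S i \<omega> = l ! i})"
    then obtain l where l: "P (\<lambda>i. l ! i)" "\<omega> \<in> space M" "\<forall>i\<in>{1..<n}. S i \<omega> = l ! i" by auto
    have "P (\<lambda>k. S k \<omega>) = P (\<lambda>i. l ! i)" using l by (intro assms) auto
    then show "\<omega> \<in> {\<omega> \<in> space M. P (\<lambda>k. S k \<omega>)}" using l by simp
  qed
  moreover have "{\<omega> \<in> space M. \<forall>i\<in>{1..<n}. S i \<omega> = l ! i} \<in> events" for l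
  proof (rule sets.sets_Collect_finite_All)
    fix i assume "i \<in> {1..<n}"
    then have "S i -` {l ! i} \<inter> space M \<in> events"
      by (intro measurable_sets[OF S_measurable]) auto
    moreover have "S i -` {l ! i} \<inter> space M = {\<omega> \<in> space M. S i \<omega> = l ! i}" by auto
    ultimately show "{\<omega> \<in> space M. S i \<omega> = l ! i} \<in> events" by simp
  qed simp
  ultimately show ?thesis by (auto intro!: sets.countable_UN')
qed

lemma prob_select:
  assumes "1 \<le> i" "v \<in> tree_nodes m i"
  shows "prob (S i -` {v} \<inter> space M) = 1 / real (card (tree_nodes m i))"
proof -
  have "prob (S i -` {v} \<inter> space M) = measure (distr M (count_space UNIV) (S i)) {v}"
    using S_measurable[OF assms(1)] by (simp add: measure_distr)
  also have "\<dots> = pmf (pmf_of_set (tree_nodes m i)) v"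
    by (simp add: uniform_selections[OF assms(1)] measure_pmf_single)
  finally show ?thesis using assms by simp
qed

lemma AE_valid: "AE \<omega> in M. \<forall>n. valid_choices m n (\<lambda>k. S k \<omega>)"
proof -
  have "AE \<omega> in M. S i \<omega> \<in> tree_nodes m i" if "1 \<le> i" for i
  proof -
    have "AE v in distr M (count_space UNIV) (S i). v \<in> tree_nodes m i"
      unfolding uniform_selections[OF that] by (simp add: AE_measure_pmf_iff)
    then show ?thesis using S_measurable[OF that] by (simp add: AE_distr_iff)
  qed
  then have "AE \<omega> in M. 1 \<le> i \<longrightarrow> S i \<omega> \<in> tree_nodes m i" for i by (cases "1 \<le> i") auto
  then have "AE \<omega> in M. \<forall>i. 1 \<le> i \<longrightarrow> S i \<omega> \<in> tree_nodes m i" by (subst AE_all_countable) simp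
  then show ?thesis by eventually_elim (simp add: valid_choices_def)
qed

lemma prob_choices:
  assumes "s \<in> choices m n"
  shows "prob {\<omega> \<in> space M. \<forall>i\<in>{1..<n}. S i \<omega> = s i} = 1 / (\<Prod>i\<in>{1..<n}. card (tree_nodes m i))"
proof (cases "{1..<n} = {}")
  case False
  have "{\<omega> \<in> space M. \<forall>i\<in>{1..<n}. S i \<omega> = s i} = (\<Inter>i\<in>{1..<n}. S i -` {s i} \<inter> space M)"
    using False by auto
  also have "prob \<dots> = (\<Prod>i\<in>{1..<n}. prob (S i -` {s i} \<inter> space M))"
    using indep_selections False by (intro indep_varsD) auto
  also have "\<dots> = (\<Prod>i\<in>{1..<n}. 1 / real (card (tree_nodes m i)))"
    using choicesD[OF assms] by (intro prod.cong prob_select) auto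
  finally show ?thesis by (simp add: prod_dividef)
next
  case True
  then show ?thesis by (simp add: prob_space)
qed

text \<open>Almost surely all selections are valid, and then their restriction to
  \<open>{1..<n}\<close> is an element of \<open>choices m n\<close>. Each element has the same
  probability, by independence and uniformity.\<close>

lemma prob_eq_avg:
  assumes P: "\<And>s s'. (\<And>i. 1 \<le> i \<Longrightarrow> i < n \<Longrightarrow> s i = s' i) \<Longrightarrow> P s = P s'"
  shows "prob {\<omega> \<in> space M. P (\<lambda>k. S k \<omega>)} = avg m n (\<lambda>s. if P s then 1 else 0)"
proof -
  define E where "E s = {\<omega> \<in> space M. \<forall>i\<in>{1..<n}. S i \<omega> = s i}" for s
  define C where "C = {s \<in> choices m n. P s}"
  have fin: "finite (choices m n)" by (simp add: choices_def finite_PiE)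
  have E: "E s \<in> events" for s
    unfolding E_def using event_prefix[of n "\<lambda>s'. \<forall>i\<in>{1..<n}. s' i = s i"] by simp
  have "prob {\<omega> \<in> space M. P (\<lambda>k. S k \<omega>)} = prob (\<Union>s\<in>C. E s)"
  proof (rule finite_measure_eq_AE)
    show "AE \<omega> in M. (\<omega> \<in> {\<omega> \<in> space M. P (\<lambda>k. S k \<omega>)}) = (\<omega> \<in> (\<Union>s\<in>C. E s))"
      using AE_valid AE_space
    proof eventually_elim
      case (elim \<omega>)
      define s where "s = restrict (\<lambda>k. S k \<omega>) {1..<n}"
      have s: "s \<in> choices m n" "\<omega> \<in> E s"
        using elim by (auto simp: s_def choices_def E_def valid_choices_def)
      have "P t = P (\<lambda>k. S k \<omega>)" if "\<omega> \<in> E t" for t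
        using that by (intro P) (auto simp: E_def)
      then show ?case using s elim by (auto simp: C_def)
    qed
    show "{\<omega> \<in> space M. P (\<lambda>k. S k \<omega>)} \<in> events" using P by (rule event_prefix)
    show "(\<Union>s\<in>C. E s) \<in> events" using E fin by (intro sets.finite_UN) (auto simp: C_def)
  qed
  also have "\<dots> = (\<Sum>s\<in>C. prob (E s))"
  proof (rule finite_measure_finite_Union)
    show "disjoint_family_on E C"
      unfolding disjoint_family_on_def
    proof (intro ballI impI equals0I)
      fix s t \<omega> assume st: "s \<in> C" "t \<in> C" "s \<noteq> t" and \<omega>: "\<omega> \<in> E s \<inter> E t"
      then have "s i = t i" for i
        by (cases "i \<in> {1..<n}") (auto simp: E_def C_def choices_def PiE_def extensional_def)
      then show False using st by auto
    qed
  qed (use E fin in \<open>auto simp: C_def\<close>)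
  also have "\<dots> = (\<Sum>s\<in>C. 1 / (\<Prod>i\<in>{1..<n}. card (tree_nodes m i)))"
    unfolding E_def by (intro sum.cong refl prob_choices) (simp add: C_def)
  also have "\<dots> = (\<Sum>s\<in>choices m n. if P s then 1 else 0) / (\<Prod>i\<in>{1..<n}. card (tree_nodes m i))"
    by (simp add: sum.If_cases[OF fin] C_def Int_def)
  finally show ?thesis by (simp add: avg_def)
qed

end

section \<open>Upper tail\<close>

lemma sum_min_reflect_le:
  fixes f :: "nat \<Rightarrow> real"
  assumes "\<And>r. 0 \<le> f r"
  shows "(\<Sum>i\<in>{1..J}. f (min i (Suc J - i))) \<le> 2 * (\<Sum>r\<in>{1..J}. f r)"
proof -
  have "(\<Sum>i\<in>{1..J}. f (min i (Suc J - i))) \<le> (\<Sum>i\<in>{1..J}. f i + f (Suc J - i))"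
    using assms by (intro sum_mono) (auto simp: min_def)
  also have "\<dots> = (\<Sum>i\<in>{1..J}. f i) + (\<Sum>i\<in>{1..J}. f (Suc J - i))"
    by (rule sum.distrib)
  also have "(\<Sum>i\<in>{1..J}. f (Suc J - i)) = (\<Sum>i\<in>{1..J}. f i)"
    by (rule sum.reindex_bij_witness[of _ "\<lambda>i. Suc J - i" "\<lambda>i. Suc J - i"]) auto
  finally show ?thesis by simp
qed

lemma sum_inverse_squares_le: "(\<Sum>r\<in>{1..J}. 1 / (real r)\<^sup>2) \<le> 2"
proof -
  have "(\<Sum>r\<in>{1..J}. 1 / (real r)\<^sup>2) \<le> 2 - 1 / real J" if "1 \<le> J"
    using that
  proof (induction J rule: dec_induct)
    case (step J)
    have "1 / (real (Suc J))\<^sup>2 \<le> 1 / (real J * real (Suc J))"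
      using step by (intro divide_left_mono) (auto simp: power2_eq_square)
    also have "\<dots> = 1 / real J - 1 / real (Suc J)"
      using step by (simp add: field_simps)
    finally show ?case using step by simp
  qed simp
  moreover have "0 \<le> 1 / real J" by simp
  ultimately show ?thesis by (cases "1 \<le> J") (linarith, simp)
qed

lemma sum_powr_bounded:
  fixes p :: real
  assumes "p < -1"
  obtains C where "0 < C" "\<And>J. (\<Sum>r\<in>{1..J}. real r powr p) \<le> C"
proof -
  have s: "summable (\<lambda>n. real n powr p)" using assms by (simp add: summable_real_powr_iff)
  have "(\<Sum>r\<in>{1..J}. real r powr p) \<le> suminf (\<lambda>n. real n powr p) + 1" for J
    using sum_le_suminf[OF s, of "{1..J}"] by simp
  moreover have "0 \<le> suminf (\<lambda>n. real n powr p)" using s by (intro suminf_nonneg) auto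
  ultimately show ?thesis using that[of "suminf (\<lambda>n. real n powr p) + 1"] by force
qed

text \<open>Along a straight line to depth \<open>J\<close>, the correction at depth
  \<open>i\<close> is the fraction \<open>i / J\<close> of the final one. Up to a constant it is no
  larger than the logarithm belonging to depth \<open>i\<close> itself.\<close>

lemma ln_fraction_le:
  assumes "1 \<le> i" "i \<le> (J::nat)"
  shows "real i / real J * ln (real J) \<le> ln (real i) + 1"
proof -
  have J: "real J > 0" "real i > 0" using assms by auto
  have "ln (real J) = ln (real i) + ln (real J / real i)" using J by (simp add: ln_div)
  also have "ln (real J / real i) \<le> real J / real i - 1" using J by (intro ln_le_minus_one) auto
  finally have "real i / real J * ln (real J) \<le> real i / real J * (ln (real i) + real J / real i)"
    using J by (intro mult_left_mono) auto
  also have "\<dots> = real i / real J * ln (real i) + 1" using J by (simp add: field_simps)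
  also have "real i / real J * ln (real i) \<le> 1 * ln (real i)"
    using assms by (intro mult_right_mono) auto
  finally show ?thesis by simp
qed

text \<open>A cut at depth \<open>i\<close> produces one power \<open>3 / 2\<close> for each piece.
  The longer piece has at least half the length and cancels the power of \<open>J\<close>; the
  shorter one leaves a summable factor.\<close>

lemma split_factor_le:
  assumes "1 \<le> i" "i \<le> J"
  shows "real J powr (3/2) / (real i powr (3/2) * real (Suc J - i) powr (3/2))
    \<le> 3 * real (min i (Suc J - i)) powr (- (3/2))"
proof -
  let ?a = "real (min i (Suc J - i))" and ?b = "real (max i (Suc J - i))"
  have ab: "real i * real (Suc J - i) = ?a * ?b" by (auto simp: min_def max_def)
  have pos: "?a > 0" "?b > 0" using assms by (auto simp: min_def max_def)
  have b: "real J \<le> 2 * ?b" using assms by (auto simp: max_def)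
  have "real J powr (3/2) / (real i powr (3/2) * real (Suc J - i) powr (3/2))
      = (real J / (?a * ?b)) powr (3/2)"
    unfolding ab[symmetric] by (simp only: powr_divide powr_mult of_nat_0_le_iff mult_nonneg_nonneg)
  also have "\<dots> \<le> (2 / ?a) powr (3/2)"
    using b pos assms by (intro powr_mono2) (auto simp: field_simps)
  also have "\<dots> = 2 powr (3/2) * ?a powr (- (3/2))"
    unfolding powr_divide powr_minus by (simp only: divide_inverse)
  also have "(2::real) powr (3/2) \<le> 3"
  proof -
    have "(2::real) powr (3/2) = 2 powr (1 + 1/2)" by simp
    also have "\<dots> = 2 * sqrt 2" by (simp only: powr_add powr_half_sqrt) simp
    also have "\<dots> \<le> 2 * (3/2)" by (intro mult_left_mono real_le_lsqrt) (auto simp: power2_eq_square)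
    finally show ?thesis by simp
  qed
  finally show ?thesis by (simp add: mult_right_mono)
qed

text \<open>The paths whose maximal excess over the line of slope \<open>1 / b\<close> is attained at depth \<open>i\<close>,
  by the label \<open>x\<close>.\<close>

definition peak :: "nat \<Rightarrow> real \<Rightarrow> nat \<Rightarrow> nat \<Rightarrow> nat \<Rightarrow> nat \<Rightarrow> bool" where
  "peak m b i x j k \<longleftrightarrow> (j = i \<longrightarrow> k = x) \<and> real j - tau m k / b \<le> real i - tau m x / b"

text \<open>Up to the peak the path stays under a barrier with initial slack about
  \<open>b * h\<close> and ends close to it. After the peak it starts close to a barrier and ends
  with slack about \<open>b * h\<close>. The factors \<open>exp (1 - h)\<close> and
  \<open>exp h\<close> of the two pieces compensate, so only a polynomial in \<open>h\<close>
  remains.\<close>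

lemma green_peak_le:
  assumes m: "1 \<le> m" and b: "1 / 4 \<le> b" "b \<le> 1 / 2" and n: "tau m n = b * real J"
    and i: "1 \<le> i" "i \<le> J" and x: "2 \<le> x" "x \<le> n"
    and h: "h = real i - tau m x / b" "0 \<le> h"
  shows "green m (peak m b i x) 1 J n
    \<le> wt m x * ((24 * exp 9)\<^sup>2 * exp 1 * (real m + 1) ^ 3 * (h + real m) ^ 3
      * (b * exp 1) ^ (J - 1) / (real i powr (3/2) * real (Suc J - i) powr (3/2)))"
proof -
  define C :: real where "C = 24 * exp 9"
  have C: "C > 0" by (simp add: C_def)
  obtain i' where i': "i = Suc i'" using i by (cases i) auto
  define j where "j = J - i"
  have J: "J = Suc i' + j" using i by (simp add: i' j_def)
  have b0: "b > 0" using b by simp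
  have tx: "tau m x = b * (real i - h)" using b0 by (simp add: h)
  \<comment> \<open>\<open>green_le\<close> reads its barrier one label earlier than
    \<open>peak\<close> does; a slack of \<open>m\<close> makes up for one clock step.\<close>
  have step: "tau m (Suc k) \<le> tau m k + real m" if "1 \<le> k" for k
    using tau_Suc[OF that, of m] wt_le[of m "Suc k"] by simp
  have peak: "b * real l - b * h \<le> tau m k" if "peak m b i x l k" for l k
  proof -
    have "real l - h \<le> tau m k / b" using that by (simp add: peak_def h)
    then have "(real l - h) * b \<le> tau m k" using b0 by (simp add: pos_le_divide_eq)
    then show ?thesis by (simp add: algebra_simps)
  qed
  have bD: "b * h \<le> h" using h(2) b by (simp add: mult_left_le_one_le)
  let ?u = "b * h + real m"
  have u: "1 \<le> ?u" "?u \<le> h + real m" using mult_nonneg_nonneg[of b h] m b0 h(2) bD by linarith+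
  let ?a = "tau m (x - 1) - tau m 1 + ?u - b * real i'"
  have t1: "tau m (x - 1) \<le> b * (real i - h)" using tau_mono[of "x - 1" x m] tx by simp
  have "green m (peak m b i x) 1 i' (x - 1) \<le> C * max 0 ?a * ?u\<^sup>2 * (b * exp 1) ^ i'
      * exp ((?a - ?u) / b) / real (i' + 1) powr (3/2)"
    unfolding C_def
  proof (rule green_le)
    fix l k assume "1 \<le> k" "peak m b i x (Suc l) (Suc k)"
    then show "b * real (Suc l) - ?u \<le> tau m k - tau m 1"
      using peak step by fastforce
  qed (use b u x in auto)
  also have "\<dots> \<le> C * (real m + 1) * (h + real m)\<^sup>2 * (b * exp 1) ^ i' * exp (1 - h) / real i powr (3/2)"
  proof (rule frac_le)
    have 1: "?a - ?u \<le> (1 - h) * b" using t1 by (simp add: i' algebra_simps)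
    have "(1 - h) * b + ?u = b + real m" by (simp add: algebra_simps)
    then have 2: "max 0 ?a \<le> real m + 1" using 1 b by simp
    have 3: "exp ((?a - ?u) / b) \<le> exp (1 - h)" using 1 b0 by (simp add: pos_divide_le_eq)
    have 4: "?u\<^sup>2 \<le> (h + real m)\<^sup>2" using u by (intro power_mono) auto
    show "C * max 0 ?a * ?u\<^sup>2 * (b * exp 1) ^ i' * exp ((?a - ?u) / b)
      \<le> C * (real m + 1) * (h + real m)\<^sup>2 * (b * exp 1) ^ i' * exp (1 - h)"
      by (intro mult_mono order_refl 2 3 4) (use C b0 in auto)
  qed (use C b0 i' in auto)
  finally have 1: "green m (peak m b i x) 1 i' (x - 1)
    \<le> C * (real m + 1) * (h + real m)\<^sup>2 * (b * exp 1) ^ i' * exp (1 - h) / real i powr (3/2)" .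
  let ?a = "tau m n - tau m x + real m - b * real j"
  have a: "?a = b * h + real m" by (simp add: n tx J i' algebra_simps)
  have "green m (\<lambda>l. peak m b i x (Suc i' + l)) x j n \<le> C * max 0 ?a * (real m)\<^sup>2 * (b * exp 1) ^ j
      * exp ((?a - real m) / b) / real (j + 1) powr (3/2)"
    unfolding C_def
  proof (rule green_le)
    fix l k assume k: "x \<le> k" "peak m b i x (Suc i' + Suc l) (Suc k)"
    have "b * real (Suc i' + Suc l) - b * h \<le> tau m (Suc k)" using peak[OF k(2)] .
    also have "\<dots> \<le> tau m k + real m" using step k x by simp
    finally show "b * real (Suc l) - real m \<le> tau m k - tau m x"
      by (simp add: tx i' algebra_simps)
  qed (use b m x in auto)
  also have "\<dots> = C * (b * h + real m) * (real m)\<^sup>2 * (b * exp 1) ^ j * exp h / real (Suc J - i) powr (3/2)"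
  proof -
    have "max 0 ?a = b * h + real m" unfolding a using u(1) by simp
    moreover have "(?a - real m) / b = h" unfolding a using b0 by simp
    moreover have "j + 1 = Suc J - i" using i by (simp add: j_def)
    ultimately show ?thesis by (simp only:)
  qed
  also have "\<dots> \<le> C * (h + real m) * (real m + 1)\<^sup>2 * (b * exp 1) ^ j * exp h / real (Suc J - i) powr (3/2)"
    using C b0 bD h(2) by (intro divide_right_mono mult_mono order_refl power_mono mult_nonneg_nonneg) auto
  finally have 2: "green m (\<lambda>l. peak m b i x (Suc i' + l)) x j n
    \<le> C * (h + real m) * (real m + 1)\<^sup>2 * (b * exp 1) ^ j * exp h / real (Suc J - i) powr (3/2)" .
  have "green m (peak m b i x) 1 J n \<le> wt m x * green m (peak m b i x) 1 i' (x - 1)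
      * green m (\<lambda>l. peak m b i x (Suc i' + l)) x j n"
    using green_pinned[of "peak m b i x" i' x m j n] x unfolding J by (simp add: peak_def i')
  also have "\<dots> \<le> wt m x * (C * (real m + 1) * (h + real m)\<^sup>2 * (b * exp 1) ^ i' * exp (1 - h) / real i powr (3/2))
      * (C * (h + real m) * (real m + 1)\<^sup>2 * (b * exp 1) ^ j * exp h / real (Suc J - i) powr (3/2))"
    using C b0 h(2) by (intro mult_mono 1 2 order_refl) (auto intro!: mult_nonneg_nonneg divide_nonneg_nonneg)
  also have "\<dots> = wt m x * (C\<^sup>2 * (exp (1 - h) * exp h) * ((real m + 1) * (real m + 1)\<^sup>2)
      * ((h + real m)\<^sup>2 * (h + real m))
      * ((b * exp 1) ^ i' * (b * exp 1) ^ j) / (real i powr (3/2) * real (Suc J - i) powr (3/2)))"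
    by (simp add: power2_eq_square)
  also have "(b * exp 1) ^ i' * (b * exp 1) ^ j = (b * exp 1) ^ (J - 1)"
    unfolding power_add[symmetric] J by simp
  also have "exp (1 - h) * exp h = exp 1" by (simp add: mult_exp_exp)
  also have "(real m + 1) * (real m + 1)\<^sup>2 = (real m + 1) ^ 3" by (simp add: power3_eq_cube power2_eq_square)
  also have "(h + real m)\<^sup>2 * (h + real m) = (h + real m) ^ 3" by (simp add: power3_eq_cube power2_eq_square)
  finally show ?thesis unfolding C_def .
qed

section \<open>First moment bounds and early ancestors\<close>

definition hit :: "nat \<Rightarrow> nat \<Rightarrow> nat \<Rightarrow> real" where
  "hit m n j = avg m n (\<lambda>s. if \<exists>v\<in>tree_nodes m n. depth m s j v then 1 else 0)"

lemma hit_le_1: "hit m n j \<le> 1"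
proof -
  have "hit m n j \<le> avg m n (\<lambda>_. 1)" unfolding hit_def by (intro avg_mono) auto
  then show ?thesis by simp
qed

lemma card_pos_if_mem: "finite A \<Longrightarrow> x \<in> A \<Longrightarrow> 0 < card A"
  by (auto simp: card_gt_0_iff)

lemma level_count_pos:
  assumes "v \<in> tree_nodes m n" "level m A K s j v"
  shows "0 < level_count m A K s j n"
  unfolding level_count_def
proof (rule card_pos_if_mem)
  show "v \<in> {v \<in> tree_nodes m n. level m A K s j v}" using assms by (intro CollectI conjI)
qed simp

lemma hit_le_power:
  assumes "1 \<le> n"
  shows "hit m n j \<le> tau m n ^ j / fact j"
proof -
  let ?A = "\<lambda>_ _. True"
  have "hit m n j \<le> avg m n (\<lambda>s. real (level_count m ?A 1 s j n))"
    unfolding hit_def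
  proof (rule avg_mono)
    fix s
    have "0 < level_count m ?A 1 s j n" if "v \<in> tree_nodes m n" "depth m s j v" for v
      using that by (rule level_count_pos)
    then show "(if \<exists>v\<in>tree_nodes m n. depth m s j v then 1 else 0) \<le> real (level_count m ?A 1 s j n)"
      by (auto simp: Suc_leI)
  qed
  also have "\<dots> = green m ?A 1 j n"
    using assms by (simp add: avg_level_count card_tree_nodes)
  finally show ?thesis using green_le_power[OF assms, of m ?A j] by simp
qed

lemma line_power_le:
  assumes "1 \<le> J" "0 \<le> b" "b * exp 1 = 1 + (3/2 * ln (real J) - y) / real J"
  shows "(b * exp 1) ^ J \<le> real J powr (3/2) * exp (- y)"
proof -
  have J: "real J > 0" using assms by simp
  have "(b * exp 1) ^ J \<le> exp ((3/2 * ln (real J) - y) / real J) ^ J"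
  proof (rule power_mono)
    show "b * exp 1 \<le> exp ((3/2 * ln (real J) - y) / real J)"
      unfolding assms(3) by (rule exp_ge_add_one_self)
  qed (use assms(2) in simp)
  also have "\<dots> = exp (3/2 * ln (real J) - y)"
    using J by (simp add: exp_of_nat_mult[symmetric])
  also have "\<dots> = real J powr (3/2) * exp (- y)"
    using J by (simp add: powr_def mult_exp_exp)
  finally show ?thesis .
qed

lemma line_slope:
  assumes "1 \<le> J" "t = exp (- 1) * (real J + x)"
  shows "t / real J * exp 1 = 1 + x / real J"
proof -
  have J: "real J > 0" using assms by simp
  have "exp (- 1) * exp 1 = (1::real)" by (simp add: mult_exp_exp)
  then have "t / real J * exp 1 = (real J + x) / real J" unfolding assms(2) by (simp add: mult_ac)
  then show ?thesis using J by (simp add: add_divide_distrib)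
qed

text \<open>Without a barrier the bound carries an extra power of \<open>J\<close>. It still
  suffices for \<open>y\<close> at least \<open>3 * ln (real J)\<close>, where half of the exponent
  absorbs this power.\<close>

lemma hit_le_first_moment:
  assumes "1 \<le> n" "1 \<le> J" "tau m n = exp (- 1) * (real J + 3/2 * ln (real J) - y)"
  shows "hit m n J \<le> real J powr (3/2) * exp (- y)"
proof -
  define b where "b = tau m n / real J"
  have J: "real J > 0" using assms by simp
  have be: "b * exp 1 = 1 + (3/2 * ln (real J) - y) / real J"
    unfolding b_def by (rule line_slope[OF assms(2)]) (simp add: assms(3) algebra_simps)
  have b0: "0 \<le> b" using tau_nonneg[of m n] by (simp add: b_def)
  have "hit m n J \<le> tau m n ^ J / fact J" by (rule hit_le_power[OF assms(1)])
  also have "\<dots> \<le> tau m n ^ J / (J / exp 1) ^ J"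
  proof (intro divide_left_mono zero_le_power tau_nonneg mult_pos_pos)
    have "1 * (real J / exp 1) ^ J \<le> sqrt J * (real J / exp 1) ^ J"
      using assms by (intro mult_right_mono) auto
    then show "(real J / exp 1) ^ J \<le> fact J" using fact_bounds(1)[OF assms(2)] by linarith
  qed (use J in auto)
  also have "\<dots> = (b * exp 1) ^ J" by (simp add: b_def power_divide power_mult_distrib)
  also have "\<dots> \<le> real J powr (3/2) * exp (- y)" using assms b0 be by (intro line_power_le)
  finally show ?thesis .
qed

abbreviation early :: "nat \<Rightarrow> nat \<Rightarrow> real \<Rightarrow> nat \<Rightarrow> (nat \<Rightarrow> node) \<Rightarrow> bool" where
  "early m n t i s \<equiv> \<exists>k u. 1 \<le> k \<and> k \<le> n \<and> tau m k \<le> t \<and> u \<in> tree_nodes m k \<and> depth m s i u"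

text \<open>The trees grow and \<open>tau\<close> increases, so the events for all labels up to time
  \<open>t\<close> coincide with the one for the last such label. This avoids a union bound over
  labels.\<close>

lemma avg_crossing_le:
  assumes "\<And>k. 1 \<le> k \<Longrightarrow> k \<le> n \<Longrightarrow> tau m k \<le> t \<Longrightarrow> hit m k i \<le> B" "0 \<le> B"
  shows "avg m n (\<lambda>s. if early m n t i s
    then 1 else 0) \<le> B"
proof -
  let ?P = "\<lambda>s. early m n t i s"
  define Q where "Q = {k. 1 \<le> k \<and> k \<le> n \<and> tau m k \<le> t}"
  have fin: "finite Q" by (rule finite_subset[of _ "{..n}"]) (auto simp: Q_def)
  show ?thesis
  proof (cases "Q = {}")
    case True
    have no: "\<not> ?P s" for s
    proof
      assume "?P s"
      then have "\<exists>k. k \<in> Q" unfolding Q_def by blast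
      then show False using True by blast
    qed
    have "(\<lambda>s. if ?P s then 1 else 0) = (\<lambda>_. 0::real)"
    proof
      fix s
      show "(if ?P s then 1 else 0) = (0::real)" using no[of s] by (rule if_not_P)
    qed
    then have "avg m n (\<lambda>s. if ?P s then 1 else 0) = avg m n (\<lambda>_. 0)" by (rule arg_cong)
    then show ?thesis using assms(2) by (simp only: avg_const)
  next
    case False
    define k where "k = Max Q"
    have "k \<in> Q" using Max_in[OF fin False] by (simp add: k_def)
    then have k: "1 \<le> k" "k \<le> n" "tau m k \<le> t" by (auto simp: Q_def)
    have "?P s \<longleftrightarrow> (\<exists>u\<in>tree_nodes m k. depth m s i u)" for s
    proof
      assume "?P s"
      then obtain l u where l: "l \<in> Q" "u \<in> tree_nodes m l" "depth m s i u"
        unfolding Q_def by blast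
      have "l \<le> k" unfolding k_def using fin l(1) by (rule Max_ge)
      then show "\<exists>u\<in>tree_nodes m k. depth m s i u" using l(2,3) tree_nodes_mono[of l k m] by blast
    next
      assume "\<exists>u\<in>tree_nodes m k. depth m s i u"
      then show "?P s" using k by blast
    qed
    then have "avg m n (\<lambda>s. if ?P s then 1 else 0)
        = avg m n (\<lambda>s. if \<exists>u\<in>tree_nodes m k. depth m s i u then 1 else 0)" by simp
    also have "\<dots> = hit m k i"
      unfolding hit_def
    proof (rule avg_prefix[OF k(1,2)])
      fix s l w assume l: "k \<le> l" "s \<in> choices m l"
      have "depth m (s(l := w)) i u \<longleftrightarrow> depth m s i u" if "u \<in> tree_nodes m k" for u
        using label_le[OF that k(1)] l by (intro level_fun_upd) auto
      then show "(if \<exists>u\<in>tree_nodes m k. depth m (s(l := w)) i u then 1 else (0::real))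
          = (if \<exists>u\<in>tree_nodes m k. depth m s i u then 1 else 0)" by auto
    qed
    finally show ?thesis using assms(1)[OF k] by simp
  qed
qed

definition peak_labels :: "nat \<Rightarrow> nat \<Rightarrow> real \<Rightarrow> real \<Rightarrow> nat \<Rightarrow> nat set" where
  "peak_labels m n b D i = {x \<in> {2..n}. 0 \<le> real i - tau m x / b \<and> real i - tau m x / b < D}"

text \<open>If no ancestor is early, the largest excess \<open>dev\<close> over the line stays below
  \<open>D\<close>. It is nonnegative, since the last node lies on or above the line at time
  \<open>tau m n\<close>. The depth and label of this maximum determine the \<open>peak\<close>
  constraint that the path obeys.\<close>

lemma hit_union:
  assumes "1 \<le> n" "1 \<le> J" "0 < b" "tau m n = b * real J"
  shows "hit m n J \<le> (\<Sum>i\<in>{1..J}. avg m n (\<lambda>s. if early m n (b * (real i - D i)) i s then 1 else 0))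
    + (\<Sum>i\<in>{1..J}. \<Sum>x\<in>peak_labels m n b (D i) i. green m (peak m b i x) 1 J n)"
proof -
  let ?P = "\<lambda>i s. early m n (b * (real i - D i)) i s"
  let ?X = "\<lambda>i. peak_labels m n b (D i) i"
  let ?c = "\<lambda>i x s. real (level_count m (peak m b i x) 1 s J n)"
  have fin: "finite (?X i)" for i by (simp add: peak_labels_def)
  have "hit m n J \<le> avg m n (\<lambda>s. (\<Sum>i\<in>{1..J}. if ?P i s then 1 else 0) + (\<Sum>i\<in>{1..J}. \<Sum>x\<in>?X i. ?c i x s))"
    unfolding hit_def
  proof (rule avg_mono)
    fix s assume "s \<in> choices m n"
    then have val: "valid_choices m n s" by (rule valid_choicesI)
    have nonneg: "0 \<le> (\<Sum>i\<in>{1..J}. if ?P i s then 1 else (0::real))" "0 \<le> (\<Sum>i\<in>{1..J}. \<Sum>x\<in>?X i. ?c i x s)"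
      by (auto intro!: sum_nonneg)
    show "(if \<exists>v\<in>tree_nodes m n. depth m s J v then 1 else 0)
      \<le> (\<Sum>i\<in>{1..J}. if ?P i s then 1 else 0) + (\<Sum>i\<in>{1..J}. \<Sum>x\<in>?X i. ?c i x s)"
    proof (cases "\<exists>v\<in>tree_nodes m n. depth m s J v")
      case False
      then show ?thesis using nonneg by simp
    next
      case True
      then obtain v where v: "v \<in> tree_nodes m n" "depth m s J v" by blast
      show ?thesis
      proof (cases "\<exists>i\<in>{1..J}. ?P i s")
        case True
        then obtain i where i: "i \<in> {1..J}" "?P i s" by blast
        have "(if ?P i s then 1 else (0::real)) \<le> (\<Sum>i\<in>{1..J}. if ?P i s then 1 else 0)"
          using i(1) by (intro member_le_sum) auto
        then show ?thesis using i(2) nonneg by auto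
      next
        case noP: False
        obtain f where
          f: "\<And>i. 1 \<le> i \<Longrightarrow> i \<le> J \<Longrightarrow> \<exists>u \<in> tree_nodes m n. fst u = f i \<and> depth m s i u"
          and lev: "\<And>A. (\<And>i. 1 \<le> i \<Longrightarrow> i \<le> J \<Longrightarrow> A i (f i)) \<Longrightarrow> level m A 1 s J v"
          using level_path[OF val assms(1) v] by blast
        have label: "2 \<le> f i" "f i \<le> n" and above: "b * (real i - D i) < tau m (f i)"
          if i: "1 \<le> i" "i \<le> J" for i
        proof -
          obtain u where u: "u \<in> tree_nodes m n" "fst u = f i" "depth m s i u" using f[OF i] by blast
          have lu: "i < f i" using depth_less_label[OF val assms(1) u(1,3)] u(2) by simp
          then show "2 \<le> f i" using i by simp
          show fn: "f i \<le> n" using label_le[OF u(1) assms(1)] u(2) by simp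
          have "u \<in> tree_nodes m (f i)"
            using u lu i unfolding tree_nodes_def by auto
          then have "\<not> tau m (f i) \<le> b * (real i - D i)"
            using noP u i fn lu by (metis Suc_leI atLeastAtMost_iff le_trans less_imp_le_nat)
          then show "b * (real i - D i) < tau m (f i)" by simp
        qed
        define dev where "dev i = real i - tau m (f i) / b" for i
        have "Max (dev ` {1..J}) \<in> dev ` {1..J}" using assms(2) by (intro Max_in) auto
        then obtain i where i: "1 \<le> i" "i \<le> J" "dev i = Max (dev ` {1..J})" by auto
        have max: "dev l \<le> dev i" if "1 \<le> l" "l \<le> J" for l
          unfolding i(3) using that by (intro Max_ge) auto
        have "0 \<le> dev J"
          using tau_mono[of "f J" n m] label[of J] assms by (simp add: dev_def pos_divide_le_eq mult.commute)
        then have "0 \<le> dev i" using max[of J] assms(2) by simp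
        moreover have "dev i < D i"
        proof -
          have "real i - D i < tau m (f i) / b"
            using above[OF i(1,2)] assms(3) by (simp add: pos_less_divide_eq mult.commute)
          then show ?thesis by (simp add: dev_def)
        qed
        ultimately have x: "f i \<in> ?X i" using label[OF i(1,2)] by (simp add: peak_labels_def dev_def)
        have "level m (peak m b i (f i)) 1 s J v"
          using max by (intro lev) (auto simp: peak_def dev_def)
        then have "0 < level_count m (peak m b i (f i)) 1 s J n"
          using level_count_pos[OF v(1)] by simp
        then have "1 \<le> ?c i (f i) s" by simp
        also have "\<dots> \<le> (\<Sum>x\<in>?X i. ?c i x s)"
          using x fin by (intro member_le_sum) auto
        also have "\<dots> \<le> (\<Sum>i\<in>{1..J}. \<Sum>x\<in>?X i. ?c i x s)"
          using i by (intro member_le_sum[of i "{1..J}" "\<lambda>i. \<Sum>x\<in>?X i. ?c i x s"]) (auto intro!: sum_nonneg)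
        finally show ?thesis using nonneg by auto
      qed
    qed
  qed
  also have "\<dots> = (\<Sum>i\<in>{1..J}. avg m n (\<lambda>s. if ?P i s then 1 else 0))
      + (\<Sum>i\<in>{1..J}. \<Sum>x\<in>?X i. avg m n (?c i x))"
    by (simp only: avg_add avg_sum)
  also have "(\<Sum>i\<in>{1..J}. \<Sum>x\<in>?X i. avg m n (?c i x)) = (\<Sum>i\<in>{1..J}. \<Sum>x\<in>?X i. green m (peak m b i x) 1 J n)"
    using assms(1) by (intro sum.cong refl) (simp add: avg_level_count card_tree_nodes)
  finally show ?thesis .
qed

text \<open>The logarithm makes the probabilities of crossing the barrier at depth \<open>i\<close> summable, and the
  constant \<open>15/2\<close> makes their sum at most half of the bound to be proved by induction.\<close>

definition barrier_width :: "real \<Rightarrow> nat \<Rightarrow> nat \<Rightarrow> real" where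
  "barrier_width y J i = 2 * (y + 15/2 + 4 * ln (real (min i (Suc J - i))))"

text \<open>The logarithm is traded for the power \<open>1 / 16\<close>, as the width enters
  \<open>sum_peak_le\<close> in fourth power: \<open>3 / 2 - 1 / 4 = 5 / 4\<close> is still a
  summable exponent.\<close>

lemma barrier_width_le:
  assumes "0 \<le> y" "1 \<le> i" "i \<le> J"
  shows "barrier_width y J i + real m \<le> (143 + real m) * (1 + y) * real (min i (Suc J - i)) powr (1/16)"
proof -
  define \<mu> where "\<mu> = real (min i (Suc J - i))"
  have \<mu>: "1 \<le> \<mu>" using assms by (auto simp: \<mu>_def)
  define q where "q = \<mu> powr (1/16)"
  have q: "1 \<le> q" using \<mu> by (simp add: q_def ge_one_powr_ge_zero)
  have "ln \<mu> = 16 * ln q" using \<mu> by (simp add: q_def ln_powr)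
  also have "\<dots> \<le> 16 * q" using ln_le_minus_one[of q] q by simp
  finally have "barrier_width y J i + real m \<le> 2 * y + (15 + real m) + 128 * q"
    by (simp add: barrier_width_def \<mu>_def[symmetric])
  also have "\<dots> \<le> (2 * y) * q + (15 + real m) * q + 128 * q"
    using q assms(1) mult_left_mono[of 1 q "2 * y"] mult_left_mono[of 1 q "15 + real m"]
    by (intro add_mono order_refl) simp_all
  also have "\<dots> = (2 * y + (143 + real m)) * q" by (simp add: algebra_simps)
  also have "\<dots> \<le> ((143 + real m) * (1 + y)) * q"
    using q assms by (intro mult_right_mono) (auto simp: algebra_simps)
  finally show ?thesis by (simp add: q_def \<mu>_def)
qed

text \<open>\<open>green_peak_le\<close> contributes a third power of the width, and the time window
  of the possible peak labels a fourth. The resulting polynomial in \<open>y\<close> is why only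
  \<open>exp (- (y / 2))\<close> survives of \<open>exp (- y)\<close>.\<close>

lemma sum_peak_le:
  assumes m: "1 \<le> m"
  obtains C where "0 < C"
    "\<And>J n y b. 1 \<le> J \<Longrightarrow> 0 \<le> y \<Longrightarrow> 1 / 4 \<le> b \<Longrightarrow> b \<le> 1 / 2 \<Longrightarrow> tau m n = b * real J
      \<Longrightarrow> b * exp 1 = 1 + (3/2 * ln (real J) - y) / real J
      \<Longrightarrow> (\<Sum>i\<in>{1..J}. \<Sum>x\<in>peak_labels m n b (barrier_width y J i) i. green m (peak m b i x) 1 J n)
        \<le> C * exp (- (y / 2))"
proof -
  obtain C3 where C3: "0 < C3" "\<And>J. (\<Sum>r\<in>{1..J}. real r powr (- (5/4))) \<le> C3"
    using sum_powr_bounded[of "- (5/4)"] by auto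
  define E where "E = (24 * exp 9)\<^sup>2 * exp 1 * (real m + 1) ^ 3"
  define G where "G = 143 + real m"
  have E: "E > 0" unfolding E_def by (intro mult_pos_pos zero_less_power) auto
  have G: "G > 0" by (simp add: G_def)
  have "(\<Sum>i\<in>{1..J}. \<Sum>x\<in>peak_labels m n b (barrier_width y J i) i. green m (peak m b i x) 1 J n)
      \<le> (E * 6 * G ^ 4 * 4096 * (2 * C3)) * exp (- (y / 2))"
    if J: "1 \<le> J" and y: "0 \<le> y" and b: "1 / 4 \<le> b" "b \<le> 1 / 2" and n: "tau m n = b * real J"
      and be: "b * exp 1 = 1 + (3/2 * ln (real J) - y) / real J" for J n y b
  proof -
    have e2: "2 \<le> exp (1::real)" using exp_ge_add_one_self[of 1] by simp
    have b0: "b > 0" "1 / 2 \<le> b * exp 1" using b mult_mono[OF b(1) e2] by auto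
    define w where "w i = real (min i (Suc J - i))" for i
    define D where "D = barrier_width y J"
    have summand: "(\<Sum>x\<in>peak_labels m n b (D i) i. green m (peak m b i x) 1 J n)
        \<le> E * 6 * G ^ 4 * 4096 * exp (- (y / 2)) * w i powr (- (5/4))"
      if i: "i \<in> {1..J}" for i
    proof -
      let ?X = "peak_labels m n b (D i) i"
      let ?den = "real i powr (3/2) * real (Suc J - i) powr (3/2)"
      have i': "1 \<le> i" "i \<le> J" using i by auto
      have w: "1 \<le> w i" using i' by (auto simp: w_def)
      have den: "?den > 0" using i' by simp
      have D0: "0 \<le> D i" using y w by (simp add: D_def barrier_width_def w_def[symmetric])
      define q where "q = (b * exp 1) ^ (J - 1) / ?den"
      have q0: "0 \<le> q" using b0 den by (simp add: q_def)
      have "(\<Sum>x\<in>?X. green m (peak m b i x) 1 J n) \<le> (\<Sum>x\<in>?X. wt m x * (E * (D i + real m) ^ 3 * q))"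
      proof (rule sum_mono)
        fix x assume x: "x \<in> ?X"
        define h where "h = real i - tau m x / b"
        have h: "0 \<le> h" "h \<le> D i" and x2: "2 \<le> x" "x \<le> n" using x by (auto simp: peak_labels_def h_def)
        have "green m (peak m b i x) 1 J n \<le> wt m x * (E * (h + real m) ^ 3 * (b * exp 1) ^ (J - 1) / ?den)"
          unfolding E_def by (rule green_peak_le[OF m b n i' x2 h_def h(1)])
        also have "E * (h + real m) ^ 3 * (b * exp 1) ^ (J - 1) / ?den = E * (h + real m) ^ 3 * q"
          by (simp add: q_def)
        also have "wt m x * \<dots> \<le> wt m x * (E * (D i + real m) ^ 3 * q)"
          using h E q0 by (intro mult_left_mono mult_right_mono power_mono) auto
        finally show "green m (peak m b i x) 1 J n \<le> wt m x * (E * (D i + real m) ^ 3 * q)" .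
      qed
      also have "\<dots> = (\<Sum>x\<in>?X. wt m x) * (E * (D i + real m) ^ 3 * q)"
        by (simp add: sum_distrib_right)
      also have "\<dots> \<le> (D i + real m) * (E * (D i + real m) ^ 3 * q)"
      proof (intro mult_right_mono)
        have bD: "b * D i \<le> D i" using D0 b by (simp add: mult_left_le_one_le)
        have "(\<Sum>x\<in>?X. wt m x) \<le> b * real i - b * (real i - D i) + real m"
        proof (rule sum_wt_le)
          show "0 \<le> b * real i - b * (real i - D i)" using D0 b0 by (simp add: algebra_simps)
          fix x assume x: "x \<in> ?X"
          have "tau m x / b \<le> real i" "real i - D i \<le> tau m x / b" using x by (auto simp: peak_labels_def)
          then show "2 \<le> x \<and> b * (real i - D i) \<le> tau m x \<and> tau m x \<le> b * real i"
            using b0 x by (simp add: pos_divide_le_eq pos_le_divide_eq mult.commute peak_labels_def)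
        qed (simp add: peak_labels_def)
        then show "(\<Sum>x\<in>?X. wt m x) \<le> D i + real m" using bD by (simp add: algebra_simps)
      qed (use E D0 q0 in auto)
      also have "\<dots> = E * (D i + real m) ^ 4 * q" by (simp add: power4_eq_xxxx power3_eq_cube)
      also have "\<dots> \<le> E * (G ^ 4 * 4096 * exp (y / 2) * w i powr (1/4)) * (6 * exp (- y) * w i powr (- (3/2)))"
      proof (intro mult_mono order_refl)
        have "(D i + real m) ^ 4 \<le> (G * (1 + y) * w i powr (1/16)) ^ 4"
          using barrier_width_le[OF y i', of m] D0 by (intro power_mono) (auto simp: G_def D_def w_def)
        also have "\<dots> = G ^ 4 * (1 + y) ^ 4 * (w i powr (1/16)) ^ 4" by (simp add: power_mult_distrib)
        also have "(w i powr (1/16)) ^ 4 = w i powr (1/4)"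
          using w by (simp add: powr_power)
        also have "(1 + y) ^ 4 \<le> (8 * exp (y / 8)) ^ 4"
          using exp_ge_add_one_self[of "y / 8"] y by (intro power_mono) linarith+
        also have "(8 * exp (y / 8)) ^ 4 = 4096 * exp (y / 2)"
          by (simp add: power_mult_distrib exp_of_nat_mult[symmetric])
        finally show "(D i + real m) ^ 4 \<le> G ^ 4 * 4096 * exp (y / 2) * w i powr (1/4)"
          using G by (simp add: mult_left_mono mult_right_mono mult.assoc)
        \<comment> \<open>The step to the peak is counted by \<open>wt m x\<close>, hence the
          exponent \<open>J - 1\<close>. Completing it costs a factor 2, as \<open>b * exp 1\<close>
          is at least \<open>1 / 2\<close>.\<close>
        have "(b * exp 1) ^ (J - 1) * 1 \<le> (b * exp 1) ^ (J - 1) * (2 * (b * exp 1))"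
          using b0 by (intro mult_left_mono) auto
        also have "\<dots> = 2 * (b * exp 1) ^ J"
          using J by (cases J) auto
        also have "\<dots> \<le> 2 * (real J powr (3/2) * exp (- y))"
          using J be b0 by (intro mult_left_mono line_power_le) auto
        finally have "q \<le> 2 * (real J powr (3/2) * exp (- y)) / ?den"
          unfolding q_def using den by (intro divide_right_mono) auto
        also have "\<dots> = 2 * exp (- y) * (real J powr (3/2) / ?den)" by simp
        also have "\<dots> \<le> 2 * exp (- y) * (3 * w i powr (- (3/2)))"
          unfolding w_def by (intro mult_left_mono split_factor_le i') auto
        finally show "q \<le> 6 * exp (- y) * w i powr (- (3/2))" by simp
      qed (use E G q0 D0 in \<open>auto intro!: mult_nonneg_nonneg\<close>)
      also have "\<dots> = E * 6 * G ^ 4 * 4096 * (exp (y / 2) * exp (- y)) * (w i powr (1/4) * w i powr (- (3/2)))"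
        by simp
      also have "exp (y / 2) * exp (- y) = exp (- (y / 2))" by (simp add: mult_exp_exp)
      also have "w i powr (1/4) * w i powr (- (3/2)) = w i powr (- (5/4))"
        by (simp add: powr_add[symmetric])
      finally show ?thesis .
    qed
    have "(\<Sum>i\<in>{1..J}. \<Sum>x\<in>peak_labels m n b (D i) i. green m (peak m b i x) 1 J n)
        \<le> (\<Sum>i\<in>{1..J}. E * 6 * G ^ 4 * 4096 * exp (- (y / 2)) * w i powr (- (5/4)))"
      by (intro sum_mono summand)
    also have "\<dots> = E * 6 * G ^ 4 * 4096 * exp (- (y / 2)) * (\<Sum>i\<in>{1..J}. w i powr (- (5/4)))"
      by (simp add: sum_distrib_left)
    also have "\<dots> \<le> E * 6 * G ^ 4 * 4096 * exp (- (y / 2)) * (2 * C3)"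
    proof (intro mult_left_mono)
      have "(\<Sum>i\<in>{1..J}. w i powr (- (5/4))) \<le> 2 * (\<Sum>r\<in>{1..J}. real r powr (- (5/4)))"
        unfolding w_def by (rule sum_min_reflect_le) simp
      then show "(\<Sum>i\<in>{1..J}. w i powr (- (5/4))) \<le> 2 * C3" using C3(2)[of J] by simp
    qed (use E G in auto)
    finally show ?thesis by (simp add: D_def mult_ac)
  qed
  moreover have "0 < E * 6 * G ^ 4 * 4096 * (2 * C3)" using E G C3 by simp
  ultimately show ?thesis using that by blast
qed

lemma slope_bounds:
  assumes "b * exp 1 = 1 + q" "\<bar>q\<bar> \<le> 1 / 4"
  shows "1 / 4 \<le> b" "b \<le> (1 / 2 :: real)"
proof -
  have e: "exp 1 \<le> (3::real)" "5 / 2 \<le> exp (1::real)"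
    using exp_le exp_lower_Taylor_quadratic[of 1] by auto
  have 1: "3 / 4 \<le> b * exp 1" "b * exp 1 \<le> 5 / 4" using assms by auto
  show "1 / 4 \<le> b"
  proof (rule ccontr)
    assume "\<not> 1 / 4 \<le> b"
    then have "b * exp 1 < 1 / 4 * exp 1" by (intro mult_strict_right_mono) auto
    then show False using e 1 by linarith
  qed
  show "b \<le> 1 / 2"
  proof (rule ccontr)
    assume "\<not> b \<le> 1 / 2"
    then have "1 / 2 * exp 1 < b * exp 1" by (intro mult_strict_right_mono) auto
    then show False using e 1 by linarith
  qed
qed

lemma ln_small:
  obtains J0 :: nat where "1 \<le> J0" "\<And>J. J0 \<le> J \<Longrightarrow> ln (real J) \<le> real J / 6"
proof -
  have "eventually (\<lambda>J::nat. ln (real J) \<le> real J / 6) sequentially" by real_asymp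
  then obtain N where N: "\<And>J. N \<le> J \<Longrightarrow> ln (real J) \<le> real J / 6"
    unfolding eventually_sequentially by blast
  show ?thesis by (rule that[of "max N 1"]) (use N in auto)
qed

text \<open>For nonpositive \<open>y\<close> the claim is trivial, for large \<open>y\<close> the
  plain first moment suffices, and small \<open>J\<close> is absorbed in \<open>K\<close>. In the
  remaining range \<open>b\<close> is close to \<open>1 / exp 1\<close>, and an early ancestor falls
  under the induction hypothesis with a larger \<open>y\<close>.\<close>

lemma hit_upper:
  assumes m: "1 \<le> m"
  obtains K where "1 \<le> K" "\<And>n J y. 1 \<le> n \<Longrightarrow> 1 \<le> J
    \<Longrightarrow> tau m n = exp (- 1) * (real J + 3/2 * ln (real J) - y) \<Longrightarrow> hit m n J \<le> K * exp (- (y / 2))"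
proof -
  obtain C where C: "0 < C" and peaks: "\<And>J n y b. 1 \<le> J \<Longrightarrow> 0 \<le> y \<Longrightarrow> 1 / 4 \<le> b \<Longrightarrow> b \<le> 1 / 2
      \<Longrightarrow> tau m n = b * real J \<Longrightarrow> b * exp 1 = 1 + (3/2 * ln (real J) - y) / real J
      \<Longrightarrow> (\<Sum>i\<in>{1..J}. \<Sum>x\<in>peak_labels m n b (barrier_width y J i) i. green m (peak m b i x) 1 J n)
        \<le> C * exp (- (y / 2))"
    using sum_peak_le[OF m] by blast
  obtain J0 :: nat where J0: "1 \<le> J0" "\<And>J. J0 \<le> J \<Longrightarrow> ln (real J) \<le> real J / 6"
    using ln_small by blast
  \<comment> \<open>The term \<open>2 * C\<close> makes the peaks cost at most half of the bound,
    which leaves the other half for early ancestors.\<close>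
  define K where "K = 1 + real J0 powr (3/2) + 2 * C"
  have K: "1 \<le> K" "real J0 powr (3/2) \<le> K" "2 * C \<le> K" using C by (auto simp: K_def)
  have "hit m n J \<le> K * exp (- (y / 2))"
    if "1 \<le> n" "1 \<le> J" "tau m n = exp (- 1) * (real J + 3/2 * ln (real J) - y)" for n J y
    using that
  proof (induction n arbitrary: J y rule: less_induct)
    case (less n)
    note n = less.prems(1) and J = less.prems(2) and t = less.prems(3)
    have Jpos: "real J > 0" and lnJ: "0 \<le> ln (real J)" using J by auto
    consider "y \<le> 0" | "3 * ln (real J) \<le> y" | "0 < y" "y < 3 * ln (real J)" "J < J0"
      | "0 < y" "y < 3 * ln (real J)" "J0 \<le> J" by linarith
    then show ?case
    proof cases
      case 1
      have "hit m n J \<le> 1 * 1" using hit_le_1 by simp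
      also have "\<dots> \<le> K * exp (- (y / 2))" using K 1 by (intro mult_mono) auto
      finally show ?thesis .
    next
      case 2
      have "hit m n J \<le> real J powr (3/2) * exp (- y)" using n J t by (rule hit_le_first_moment)
      also have "\<dots> = exp (3/2 * ln (real J) - y)" using Jpos by (simp add: powr_def mult_exp_exp)
      also have "\<dots> \<le> 1 * exp (- (y / 2))" using 2 by simp
      also have "\<dots> \<le> K * exp (- (y / 2))" using K by (intro mult_right_mono) auto
      finally show ?thesis .
    next
      case 3
      have "exp (y / 2) \<le> exp (3/2 * ln (real J))" using 3 by simp
      also have "\<dots> = real J powr (3/2)" using Jpos by (simp add: powr_def)
      also have "\<dots> \<le> real J0 powr (3/2)" using 3 by (intro powr_mono2) auto
      also have "\<dots> \<le> K" by (rule K)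
      finally have "exp (y / 2) * exp (- (y / 2)) \<le> K * exp (- (y / 2))" by (intro mult_right_mono) auto
      then show ?thesis using hit_le_1[of m n J] by (simp add: mult_exp_exp)
    next
      case 4
      define x where "x = 3/2 * ln (real J) - y"
      define b where "b = tau m n / real J"
      define w where "w i = real (min i (Suc J - i))" for i
      define D where "D = barrier_width y J"
      have tn: "tau m n = b * real J" using Jpos by (simp add: b_def)
      have be: "b * exp 1 = 1 + x / real J"
        unfolding b_def using line_slope[OF J, of "tau m n" x] t by (simp add: x_def)
      have "\<bar>x\<bar> \<le> real J / 4" unfolding x_def using 4 J0(2)[of J] by (intro abs_leI) linarith+
      then have xJ: "\<bar>x / real J\<bar> \<le> 1 / 4" using Jpos by (simp add: pos_divide_le_eq)
      have b: "1 / 4 \<le> b" "b \<le> 1 / 2" using slope_bounds[OF be xJ] by auto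
      have w: "1 \<le> w i" if "i \<in> {1..J}" for i using that by (auto simp: w_def)
      have D: "D i = 2 * (y + 15/2 + 4 * ln (w i))" for i by (simp add: D_def barrier_width_def w_def)
      have cross: "avg m n (\<lambda>s. if early m n (b * (real i - D i)) i s then 1 else 0) \<le> K * exp (- (y / 2)) / 8 * (1 / (w i)\<^sup>2)"
        if i: "i \<in> {1..J}" for i
      proof (rule avg_crossing_le)
        show "0 \<le> K * exp (- (y / 2)) / 8 * (1 / (w i)\<^sup>2)" using K by simp
        fix k assume k: "1 \<le> k" "k \<le> n" "tau m k \<le> b * (real i - D i)"
        have i': "1 \<le> i" "i \<le> J" using i by auto
        have lw: "0 \<le> ln (w i)" using w[OF i] by simp
        then have D0: "0 < D i" using 4 by (simp add: D)
        have "b * (real i - D i) < b * real J" using D0 i' b by (intro mult_strict_left_mono) auto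
        then have "tau m k < tau m n" using k tn by simp
        then have kn: "k < n" using k(2) by (cases "k = n") auto
        define y' where "y' = real i + 3/2 * ln (real i) - exp 1 * tau m k"
        have ee: "exp (- 1) * exp 1 = (1::real)" by (simp add: mult_exp_exp)
        have "exp (- 1) * (real i + 3/2 * ln (real i) - y') = (exp (- 1) * exp 1) * tau m k"
          by (simp add: y'_def)
        then have tk: "tau m k = exp (- 1) * (real i + 3/2 * ln (real i) - y')" by (simp only: ee)
        have hit: "hit m k i \<le> K * exp (- (y' / 2))" by (rule less.IH[OF kn k(1) i'(1) tk])
        \<comment> \<open>Half of the barrier width arrives here, because \<open>b * exp 1\<close>
          is at least \<open>1 / 2\<close>. Of its \<open>15/2\<close>,
          \<open>ln_fraction_le\<close> consumes \<open>3/2\<close>.\<close>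
        have y': "y + 6 + 4 * ln (w i) \<le> y'"
        proof -
          have "exp 1 * tau m k \<le> exp 1 * (b * (real i - D i))" using k by (intro mult_left_mono) auto
          also have "\<dots> = (b * exp 1) * real i - (b * exp 1) * D i" by (simp add: algebra_simps)
          finally have 1: "exp 1 * tau m k \<le> (b * exp 1) * real i - (b * exp 1) * D i" .
          have 2: "(b * exp 1) * real i = real i + 3/2 * (real i / real J * ln (real J)) - y * (real i / real J)"
            unfolding be x_def by (simp add: algebra_simps diff_divide_distrib)
          have 3: "real i / real J * ln (real J) \<le> ln (real i) + 1" by (rule ln_fraction_le[OF i'])
          have "1 / 2 \<le> b * exp 1" unfolding be using xJ by linarith
          then have 4: "1 / 2 * D i \<le> (b * exp 1) * D i" using D0 by (intro mult_right_mono) auto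
          have 5: "0 \<le> y * (real i / real J)" using \<open>0 < y\<close> by simp
          have 6: "1 / 2 * D i = y + 15/2 + 4 * ln (w i)" by (simp add: D)
          have "y + 6 + 4 * u \<le> p + 3/2 * l - A"
            if "A \<le> B - E" "B = p + 3/2 * R - z" "R \<le> l + 1" "1 / 2 * q \<le> E" "0 \<le> z"
              "1 / 2 * q = y + 15/2 + 4 * u" for A B E R z u q l p :: real
            using that by linarith
          from this[OF 1 2 3 4 5 6] show ?thesis unfolding y'_def .
        qed
        have "exp (- (y' / 2)) \<le> exp (- (y / 2) + (- 3) + (- (2 * ln (w i))))" using y' by simp
        also have "\<dots> = exp (- (y / 2)) * exp (- 3) * (1 / (w i)\<^sup>2)"
        proof -
          have "exp (2 * ln (w i)) = (w i)\<^sup>2" using w[OF i] by (simp add: exp_double)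
          then show ?thesis by (simp only: exp_add exp_minus divide_inverse mult_1_left)
        qed
        \<comment> \<open>The surplus 6 gives \<open>exp (- 3) \<le> 1 / 8\<close>. The inverse
          squares sum to at most 4, so the early ancestors contribute at most
          \<open>K / 2\<close>.\<close>
        also have "\<dots> \<le> exp (- (y / 2)) * (1 / 8) * (1 / (w i)\<^sup>2)"
        proof (intro mult_right_mono mult_left_mono)
          have "(2::real) ^ 3 \<le> exp 1 ^ 3" using exp_ge_add_one_self[of 1] by (intro power_mono) auto
          also have "\<dots> = exp 3" by (simp add: exp_of_nat_mult[symmetric])
          finally have "exp (- 3) \<le> inverse (8::real)" unfolding exp_minus by (intro le_imp_inverse_le) auto
          then show "exp (- 3) \<le> (1 / 8 :: real)" by (simp add: inverse_eq_divide)
        qed auto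
        finally have "K * exp (- (y' / 2)) \<le> K * (exp (- (y / 2)) * (1 / 8) * (1 / (w i)\<^sup>2))"
          using K by (intro mult_left_mono) auto
        then show "hit m k i \<le> K * exp (- (y / 2)) / 8 * (1 / (w i)\<^sup>2)" using hit by simp
      qed
      have "hit m n J \<le> (\<Sum>i\<in>{1..J}. avg m n (\<lambda>s. if early m n (b * (real i - D i)) i s then 1 else 0))
        + (\<Sum>i\<in>{1..J}. \<Sum>x\<in>peak_labels m n b (D i) i. green m (peak m b i x) 1 J n)"
        using b by (intro hit_union[OF n J _ tn]) auto
      also have "\<dots> \<le> (\<Sum>i\<in>{1..J}. K * exp (- (y / 2)) / 8 * (1 / (w i)\<^sup>2)) + C * exp (- (y / 2))"
      proof (intro add_mono sum_mono cross)
        show "(\<Sum>i\<in>{1..J}. \<Sum>x\<in>peak_labels m n b (D i) i. green m (peak m b i x) 1 J n) \<le> C * exp (- (y / 2))"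
          unfolding D_def using 4 be by (intro peaks[OF J _ b tn]) (auto simp: x_def)
      qed
      also have "(\<Sum>i\<in>{1..J}. K * exp (- (y / 2)) / 8 * (1 / (w i)\<^sup>2))
          = K * exp (- (y / 2)) / 8 * (\<Sum>i\<in>{1..J}. 1 / (w i)\<^sup>2)"
        by (simp only: sum_distrib_left)
      also have "\<dots> \<le> K * exp (- (y / 2)) / 8 * 4"
      proof (rule mult_left_mono)
        have "(\<Sum>i\<in>{1..J}. 1 / (w i)\<^sup>2) \<le> 2 * (\<Sum>r\<in>{1..J}. 1 / (real r)\<^sup>2)"
          unfolding w_def by (rule sum_min_reflect_le) simp
        then show "(\<Sum>i\<in>{1..J}. 1 / (w i)\<^sup>2) \<le> 4" using sum_inverse_squares_le[of J] by linarith
      qed (use K in simp)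
      also have "K * exp (- (y / 2)) / 8 * 4 + C * exp (- (y / 2)) = (K / 2 + C) * exp (- (y / 2))"
        by (simp add: algebra_simps)
      also have "\<dots> \<le> K * exp (- (y / 2))" using K by (intro mult_right_mono) auto
      finally show ?thesis by simp
    qed
  qed
  then show ?thesis using that K by blast
qed

section \<open>Lower tail\<close>

text \<open>The time at which the expected number of paths of length \<open>d\<close> under the linear barrier is of
  order \<open>1\<close>.\<close>

definition critical :: "nat \<Rightarrow> real" where
  "critical d = exp (- 1) * (real d + 3/2 * ln (real d))"

lemma power_le_exp_line:
  fixes b :: real
  assumes "0 \<le> b" "b \<le> 1 + x" 
  shows "b ^ k \<le> exp (x * real k)"
proof -
  have "b \<le> exp x" using assms(2) exp_ge_add_one_self[of x] by linarith
  then have "b ^ k \<le> exp x ^ k" using assms(1) by (intro power_mono)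
  then show ?thesis by (simp add: exp_of_nat_mult[symmetric] mult.commute)
qed

text \<open>The slope leaves slack 1 at time \<open>critical d\<close>, so
  \<open>ballot_lower\<close> applies with \<open>u = 1\<close>. There
  \<open>(b * exp 1) ^ d\<close> is of order \<open>d powr (3/2)\<close> and cancels the
  denominator.\<close>

lemma green_barrier_lower:
  obtains d0 :: nat and c :: real where "1 \<le> d0" "0 < c"
    "\<And>d. d0 \<le> d \<Longrightarrow> 1 / 4 \<le> (critical d - 1) / real d \<and> (critical d - 1) / real d \<le> 1 / 2
      \<and> 1 \<le> (critical d - 1) / real d * exp 1"
    "\<And>d m K n. d0 \<le> d \<Longrightarrow> 1 \<le> m \<Longrightarrow> 1 \<le> K \<Longrightarrow> K \<le> n \<Longrightarrow> critical d \<le> theta K n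
      \<Longrightarrow> c \<le> green m (\<lambda>j k. (critical d - 1) / real d * real j \<le> theta K k) K d n"
proof -
  have "eventually (\<lambda>d::nat. \<bar>(3/2 * ln (real d) - exp 1) / real d\<bar> \<le> 1 / 4 \<and> 0 \<le> 3/2 * ln (real d) - exp 1
      \<and> (3/2 * ln (real d) - exp 1)\<^sup>2 \<le> 2 * real d) sequentially"
    by (intro eventually_conj) real_asymp+
  then obtain N where N: "\<And>d. N \<le> d \<Longrightarrow> \<bar>(3/2 * ln (real d) - exp 1) / real d\<bar> \<le> 1 / 4"
    "\<And>d. N \<le> d \<Longrightarrow> 0 \<le> 3/2 * ln (real d) - exp 1"
    "\<And>d. N \<le> d \<Longrightarrow> (3/2 * ln (real d) - exp 1)\<^sup>2 \<le> 2 * real d"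
    unfolding eventually_sequentially by blast
  define d0 where "d0 = max N 1"
  have slope: "(critical d - 1) / real d * exp 1 = 1 + (3/2 * ln (real d) - exp 1) / real d" if "d0 \<le> d" for d
  proof (rule line_slope)
    have "exp (- 1) * exp 1 = (1::real)" by (simp add: mult_exp_exp)
    then show "critical d - 1 = exp (- 1) * (real d + (3/2 * ln (real d) - exp 1))"
      by (simp add: critical_def algebra_simps)
  qed (use that in \<open>simp add: d0_def\<close>)
  have bounds: "1 / 4 \<le> (critical d - 1) / real d \<and> (critical d - 1) / real d \<le> 1 / 2
      \<and> 1 \<le> (critical d - 1) / real d * exp 1" if d: "d0 \<le> d" for d
  proof (intro conjI)
    have "N \<le> d" using d by (simp add: d0_def)
    note N' = N[OF this]
    show "1 / 4 \<le> (critical d - 1) / real d" "(critical d - 1) / real d \<le> 1 / 2"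
      using slope_bounds[OF slope[OF d] N'(1)] by auto
    show "1 \<le> (critical d - 1) / real d * exp 1" unfolding slope[OF d] using N'(2) by simp
  qed
  have "exp (- 14) / 2 \<le> green m (\<lambda>j k. (critical d - 1) / real d * real j \<le> theta K k) K d n"
    if d: "d0 \<le> d" and m: "1 \<le> m" and K: "1 \<le> K" "K \<le> n" and th: "critical d \<le> theta K n" for d m K n
  proof -
    define b where "b = (critical d - 1) / real d"
    define x where "x = 3/2 * ln (real d) - exp 1"
    have d1: "1 \<le> d" and dN: "N \<le> d" using d by (auto simp: d0_def)
    then have dpos: "real d > 0" by simp
    have b: "1 / 4 \<le> b" "b \<le> 1 / 2" using bounds[OF d] by (auto simp: b_def)
    have be: "b * exp 1 = 1 + x / real d" unfolding b_def x_def by (rule slope[OF d])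
    have pw: "real d powr (3/2) = real d * sqrt (real d)"
    proof -
      have "real d powr (3/2) = real d powr (1 + 1/2)" by simp
      then show ?thesis using dpos by (simp only: powr_add powr_half_sqrt) simp
    qed
    have "exp (- 4) * (real d * sqrt (real d)) \<le> (b * exp 1) ^ d"
    proof -
      have "x\<^sup>2 / (2 * real d) \<le> 1" using N(3)[OF dN] dpos by (simp add: x_def pos_divide_le_eq)
      \<comment> \<open>The 4 covers \<open>exp 1 \<le> 3\<close> from the slack in the slope and 1
        from the second-order term.\<close>
      then have "- 4 + 3/2 * ln (real d) \<le> x - x\<^sup>2 / (2 * real d)" using exp_le by (simp add: x_def)
      then have "exp (- 4 + 3/2 * ln (real d)) \<le> exp (x - x\<^sup>2 / (2 * real d))" by simp
      also have "\<dots> \<le> (1 + x / real d) ^ d"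
        using N(2)[OF dN] d1 by (intro one_plus_power_ge[of x d, simplified]) (auto simp: x_def)
      also have "exp (- 4 + 3/2 * ln (real d)) = exp (- 4) * real d powr (3/2)"
        using dpos by (simp add: powr_def mult_exp_exp)
      finally show ?thesis unfolding pw be .
    qed
    then have "exp (- 4) * (real d * sqrt (real d)) * exp (1 / b - 9) / (2 * real d * sqrt (real d))
        \<le> 1 * (b * exp 1) ^ d * exp (1 / b - 9) / (2 * real d * sqrt (real d))"
      by (intro divide_right_mono mult_right_mono) auto
    also have "\<dots> \<le> ballot b d (b * d + 1)"
      using b d1 by (intro ballot_lower) auto
    also have "b * d + 1 = critical d" using dpos by (simp add: b_def)
    also have "ballot b d (critical d) \<le> ballot b d (theta K n)"
      using b th dpos by (intro ballot_mono) (auto simp: b_def)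
    also have "\<dots> \<le> green m (\<lambda>j k. b * real j \<le> theta K k) K d n"
      by (rule ballot_le_green) (use b m K in auto)
    finally have g: "exp (- 4) * (real d * sqrt (real d)) * exp (1 / b - 9) / (2 * real d * sqrt (real d))
      \<le> green m (\<lambda>j k. b * real j \<le> theta K k) K d n" .
    have "exp (- 14) / 2 \<le> exp (- 4) * exp (1 / b - 9) / (2::real)"
      using b by (simp add: mult_exp_exp)
    also have "\<dots> = exp (- 4) * (real d * sqrt (real d)) * exp (1 / b - 9) / (2 * real d * sqrt (real d))"
      using dpos by simp
    finally show ?thesis using g by (simp add: b_def)
  qed
  then show ?thesis using that[of d0 "exp (- 14) / 2"] bounds by (simp add: d0_def)
qed

text \<open>If two paths separate with slack \<open>s\<close>, the common part weighs
  \<open>exp (s / b)\<close> and each continuation \<open>exp (- (s / b))\<close>. As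
  \<open>1 / b\<close> is at least 2, the net factor beats \<open>s ^ 5\<close> and leaves
  \<open>exp (- s)\<close>, which \<open>sum_wt_exp_le\<close> sums over the labels. The remaining
  powers of \<open>d\<close> are summable over the branching depth by
  \<open>split_factor_le\<close>.\<close>

lemma second_moment_bound:
  assumes m: "1 \<le> m"
  obtains C where "0 < C"
    "\<And>d b K n. 1 \<le> d \<Longrightarrow> b = (critical d - 1) / real d \<Longrightarrow> 1 / 4 \<le> b \<Longrightarrow> b \<le> 1 / 2
      \<Longrightarrow> 1 \<le> b * exp 1 \<Longrightarrow> 1 \<le> K \<Longrightarrow> K \<le> n \<Longrightarrow> theta K n \<le> critical d + 1
      \<Longrightarrow> pair_sum m (\<lambda>j k. b * real j \<le> theta K k) K d n \<le> C"
proof -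
  obtain C3 where C3: "0 < C3" "\<And>J. (\<Sum>r\<in>{1..J}. real r powr (- (3/2))) \<le> C3"
    using sum_powr_bounded[of "- (3/2)"] by auto
  define C0 :: real where "C0 = 24 * exp 9"
  define G1 where "G1 = C0 * (real m + 1) * (real m)\<^sup>2"
  define G2 where "G2 = C0 * (real m + 16) * exp (4 * (real m + 16))"
  have C0: "C0 > 0" by (simp add: C0_def)
  have G: "G1 > 0" "G2 > 0" using C0 m by (auto simp: G1_def G2_def intro!: mult_pos_pos)
  define CC where "CC = real m * (G1 * G2\<^sup>2 * 3125 * exp (real m) * exp (3/2) * 3 * (2 * C3))"
  have "pair_sum m (\<lambda>j k. b * real j \<le> theta K k) K d n \<le> CC"
    if d: "1 \<le> d" and b_def: "b = (critical d - 1) / real d" and b: "1 / 4 \<le> b" "b \<le> 1 / 2"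
      and be1: "1 \<le> b * exp 1" and K: "1 \<le> K" "K \<le> n" and th: "theta K n \<le> critical d + 1" for d b K n
  proof -
    have dpos: "real d > 0" using d by simp
    have bd: "b * real d = critical d - 1" using dpos by (simp add: b_def)
    let ?be = "b * exp 1"
    let ?g = "\<lambda>j k. green m (\<lambda>j k. b * real j \<le> theta K k) K j k"
    let ?h = "\<lambda>j k. green m (\<lambda>l k. b * real (Suc j + l) \<le> theta K k) (Suc k) (d - Suc j) n"
    let ?den = "\<lambda>j. real (Suc j) powr (3/2) * real (d - j) ^ 3"
    \<comment> \<open>The barrier of \<open>A\<close> is stated in the clock \<open>theta\<close> at
      the new label, that of \<open>green_le\<close> in \<open>tau\<close> at the label before;
      slack 1 covers the change.\<close>
    have th_step: "theta K (Suc k) \<le> tau m k - tau m K + 1" if "K \<le> k" for k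
    proof -
      have "1 / (real k + 12) \<le> 1" by simp
      then show ?thesis using theta_Suc[OF that] theta_le_tau[OF m K(1) that] by linarith
    qed
    have summand: "wt m (Suc k) * (?g j k
            * (?h j k)\<^sup>2)
        \<le> wt m (Suc k) * exp (- tau m (Suc k)) * (G1 * G2\<^sup>2 * 3125 * exp (tau m K + b * real (Suc j) - 1)
            * ?be ^ (d + (d - j)) / ?den j)"
      if k: "K \<le> k" "k < n" and j: "j < d" and A: "b * real (Suc j) \<le> theta K (Suc k)" for j k
    proof -
      define s where "s = tau m (Suc k) - tau m K - b * real (Suc j) + 1"
      have s1: "1 \<le> s" using A theta_le_tau[OF m K(1), of "Suc k"] k by (simp add: s_def)
      have tk: "tau m k \<le> tau m (Suc k)" by (rule tau_mono) simp
      define a where "a = tau m k - tau m K + real m - b * real j"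
      have as: "a - real m \<le> s" using tk b by (simp add: a_def s_def algebra_simps)
      have "?g j k
          \<le> C0 * max 0 a * (real m)\<^sup>2 * ?be ^ j * exp ((a - real m) / b) / real (j + 1) powr (3/2)"
        unfolding C0_def
      proof (rule green_le)
        fix l k' assume "K \<le> k'" "b * real (Suc l) \<le> theta K (Suc k')"
        then show "b * real (Suc l) - real m \<le> tau m k' - tau m K"
          using th_step[of k'] m by simp
      qed (use b m K k in \<open>auto simp: a_def\<close>)
      also have "\<dots> \<le> C0 * ((real m + 1) * s) * (real m)\<^sup>2 * ?be ^ j * exp (s / b) / real (Suc j) powr (3/2)"
      proof (intro frac_le mult_mono order_refl)
        have "real m \<le> real m * s" using s1 mult_left_mono[of 1 s "real m"] by simp
        then show "max 0 a \<le> (real m + 1) * s" using as s1 by (simp add: algebra_simps)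
        show "exp ((a - real m) / b) \<le> exp (s / b)"
          using as b by (simp add: divide_right_mono)
      qed (use C0 s1 be1 in \<open>auto intro!: mult_nonneg_nonneg\<close>)
      finally have g1: "?g j k
          \<le> G1 * s * ?be ^ j * exp (s / b) / real (Suc j) powr (3/2)"
        by (simp add: G1_def mult_ac)
      define a' where "a' = tau m n - tau m (Suc k) + s - b * real (d - Suc j)"
      have dj: "real (Suc j) + real (d - Suc j) = real d" using j by simp
      have "a' = tau m n - tau m K + 1 - b * (real (Suc j) + real (d - Suc j))"
        by (simp add: a'_def s_def algebra_simps)
      \<comment> \<open>The 16 below is 13 for the comparison of the clocks and 1 each for the slack
        in \<open>s\<close>, the slack of the slope at time \<open>critical d\<close>, and the
        overshoot allowed for \<open>theta K n\<close>.\<close>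
      also have "\<dots> \<le> theta K n + real m + 13 + 1 - (critical d - 1)"
        unfolding dj bd using tau_le_theta[OF K, of m] by simp
      also have "\<dots> \<le> real m + 16" using th by simp
      finally have a': "a' \<le> real m + 16" .
      have "?h j k
          \<le> C0 * max 0 a' * s\<^sup>2 * ?be ^ (d - Suc j) * exp ((a' - s) / b) / real (d - Suc j + 1) powr (3/2)"
        unfolding C0_def
      proof (rule green_le)
        fix l k' assume k': "Suc k \<le> k'" "b * real (Suc j + Suc l) \<le> theta K (Suc k')"
        then have "b * real (Suc j + Suc l) \<le> tau m k' - tau m K + 1"
          using th_step[of k'] k by simp
        then show "b * real (Suc l) - s \<le> tau m k' - tau m (Suc k)"
          by (simp add: s_def algebra_simps)
      qed (use b s1 K k in \<open>auto simp: a'_def\<close>)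
      also have "\<dots> \<le> C0 * (real m + 16) * s\<^sup>2 * ?be ^ (d - Suc j) * (exp (4 * (real m + 16)) * exp (- (s / b)))
          / real (d - j) powr (3/2)"
      proof (intro frac_le mult_mono order_refl)
        have "a' / b \<le> (real m + 16) / b" using a' b by (intro divide_right_mono) auto
        also have "\<dots> \<le> (real m + 16) / (1 / 4)" using b by (intro divide_left_mono) auto
        finally have "(a' - s) / b \<le> 4 * (real m + 16) + - (s / b)" by (simp add: diff_divide_distrib)
        then show "exp ((a' - s) / b) \<le> exp (4 * (real m + 16)) * exp (- (s / b))"
          by (simp add: mult_exp_exp)
        have "d - Suc j + 1 = d - j" using j by simp
        then show "real (d - j) powr (3/2) \<le> real (d - Suc j + 1) powr (3/2)" by (simp only: order_refl)
      qed (use C0 s1 be1 a' j in \<open>auto intro!: mult_nonneg_nonneg\<close>)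
      finally have g2: "?h j k
          \<le> G2 * s\<^sup>2 * ?be ^ (d - Suc j) * exp (- (s / b)) / real (d - j) powr (3/2)"
        by (simp add: G2_def mult_ac)
      have "?g j k
            * (?h j k)\<^sup>2
          \<le> (G1 * s * ?be ^ j * exp (s / b) / real (Suc j) powr (3/2))
            * (G2 * s\<^sup>2 * ?be ^ (d - Suc j) * exp (- (s / b)) / real (d - j) powr (3/2))\<^sup>2"
        using G s1 be1 by (intro mult_mono power_mono g1 g2) (auto intro!: divide_nonneg_nonneg mult_nonneg_nonneg)
      also have "\<dots> = G1 * G2\<^sup>2 * (s ^ 5 * exp (- (s / b))) * ?be ^ (j + 2 * (d - Suc j))
          / ?den j"
      proof -
        have 1: "(real (d - j) powr (3/2))\<^sup>2 = real (d - j) ^ 3"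
          using j by (simp add: powr_power powr_numeral)
        have 2: "exp (s / b) * (exp (- (s / b)))\<^sup>2 = exp (- (s / b))"
          by (simp add: power2_eq_square mult_exp_exp)
        have 3: "s * (s\<^sup>2)\<^sup>2 = s ^ 5" by (simp add: power2_eq_square eval_nat_numeral)
        have 4: "?be ^ j * (?be ^ (d - Suc j))\<^sup>2 = ?be ^ (j + 2 * (d - Suc j))"
          unfolding power_mult[symmetric] power_add[symmetric] by (simp only: mult.commute)
        have "(G1 * s * ?be ^ j * exp (s / b) / real (Suc j) powr (3/2))
            * (G2 * s\<^sup>2 * ?be ^ (d - Suc j) * exp (- (s / b)) / real (d - j) powr (3/2))\<^sup>2
          = G1 * G2\<^sup>2 * ((s * (s\<^sup>2)\<^sup>2) * (exp (s / b) * (exp (- (s / b)))\<^sup>2)) * (?be ^ j * (?be ^ (d - Suc j))\<^sup>2)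
            / (real (Suc j) powr (3/2) * (real (d - j) powr (3/2))\<^sup>2)"
          by (simp only: power_mult_distrib power_divide times_divide_times_eq mult_ac)
        then show ?thesis unfolding 1 2 3 4 .
      qed
      also have "\<dots> \<le> G1 * G2\<^sup>2 * (3125 * exp (- s)) * ?be ^ (d + (d - j))
          / ?den j"
      proof (rule divide_right_mono)
        \<comment> \<open>The five powers of \<open>s\<close> are one from the end of the common
          part and two from the start of each continuation; \<open>3125 = 5 ^ 5\<close>.\<close>
        have "(s / 5) ^ 5 \<le> exp (s / 5) ^ 5"
          using s1 exp_ge_add_one_self[of "s / 5"] by (intro power_mono) linarith+
        then have "s ^ 5 \<le> 3125 * exp s"
          by (simp add: power_divide exp_of_nat_mult[symmetric])
        moreover have "exp (- (s / b)) \<le> exp (- 2 * s)"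
        proof -
          have "s / (1 / 2) \<le> s / b" using s1 b by (intro divide_left_mono) auto
          then show ?thesis by simp
        qed
        ultimately have "s ^ 5 * exp (- (s / b)) \<le> (3125 * exp s) * exp (- 2 * s)"
          using s1 by (intro mult_mono) auto
        also have "\<dots> = 3125 * exp (- s)" unfolding mult.assoc mult_exp_exp by simp
        finally have 1: "G1 * G2\<^sup>2 * (s ^ 5 * exp (- (s / b))) \<le> G1 * G2\<^sup>2 * (3125 * exp (- s))"
          using G by (intro mult_left_mono) auto
        have 2: "?be ^ (j + 2 * (d - Suc j)) \<le> ?be ^ (d + (d - j))"
          using be1 j by (intro power_increasing) auto
        show "G1 * G2\<^sup>2 * (s ^ 5 * exp (- (s / b))) * ?be ^ (j + 2 * (d - Suc j))
          \<le> G1 * G2\<^sup>2 * (3125 * exp (- s)) * ?be ^ (d + (d - j))"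
          using G be1 by (intro mult_mono[OF 1 2]) auto
      qed simp
      also have "exp (- s) = exp (- tau m (Suc k)) * exp (tau m K + b * real (Suc j) - 1)"
        by (simp add: s_def mult_exp_exp)
      finally have "?g j k
            * (?h j k)\<^sup>2
         \<le> exp (- tau m (Suc k)) * (G1 * G2\<^sup>2 * 3125 * exp (tau m K + b * real (Suc j) - 1)
            * ?be ^ (d + (d - j)) / ?den j)"
        by (simp only: mult_ac times_divide_eq_right times_divide_eq_left)
      then show ?thesis unfolding mult.assoc by (rule mult_left_mono) simp
    qed
    define H where "H j = G1 * G2\<^sup>2 * 3125 * exp (tau m K + b * real (Suc j) - 1)
            * ?be ^ (d + (d - j)) / ?den j" for j
    have H0: "0 \<le> H j" for j using G be1 by (auto simp: H_def intro!: divide_nonneg_nonneg mult_nonneg_nonneg)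
    have row: "(\<Sum>k\<in>{K..<n}. if b * real (Suc j) \<le> theta K (Suc k) then wt m (Suc k) * exp (- tau m (Suc k)) * H j else 0)
        \<le> G1 * G2\<^sup>2 * 3125 * exp (real m) * exp (3/2) * (3 * real (min (Suc j) (Suc d - Suc j)) powr (- (3/2)))"
      if j: "j < d" for j
    proof -
      define T where "T = tau m K + b * real (Suc j)"
      define X where "X = {k \<in> {K..<n}. b * real (Suc j) \<le> theta K (Suc k)}"
      have "(\<Sum>k\<in>{K..<n}. if b * real (Suc j) \<le> theta K (Suc k) then wt m (Suc k) * exp (- tau m (Suc k)) * H j else 0)
          = (\<Sum>k\<in>X. wt m (Suc k) * exp (- tau m (Suc k)) * H j)"
        unfolding X_def by (rule sum.inter_filter[symmetric]) simp
      also have "\<dots> = (\<Sum>x\<in>Suc ` X. wt m x * exp (- tau m x)) * H j"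
        by (simp add: sum.reindex sum_distrib_right)
      also have "\<dots> \<le> exp (real m - T) * H j"
      proof (intro mult_right_mono H0 sum_wt_exp_le)
        fix x assume "x \<in> Suc ` X"
        then obtain k where k: "x = Suc k" "K \<le> k" "b * real (Suc j) \<le> theta K (Suc k)" by (auto simp: X_def)
        then show "2 \<le> x \<and> T \<le> tau m x" using theta_le_tau[OF m K(1), of "Suc k"] K by (simp add: T_def)
      qed (simp add: X_def)
      also have "\<dots> = G1 * G2\<^sup>2 * 3125 * (exp (real m - T) * exp (T - 1)) * ?be ^ (d + (d - j))
          / ?den j"
        by (simp add: H_def T_def)
      also have "exp (real m - T) * exp (T - 1) = exp (real m - 1)" by (simp add: mult_exp_exp)
      also have "G1 * G2\<^sup>2 * 3125 * exp (real m - 1) * ?be ^ (d + (d - j)) / ?den j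
        \<le> G1 * G2\<^sup>2 * 3125 * exp (real m) * (exp (3/2) * (real d powr (3/2) * real (d - j) powr (3/2)))
          / ?den j"
      proof (intro divide_right_mono mult_mono order_refl)
        \<comment> \<open>Of the exponent \<open>d + (d - j)\<close>, the first \<open>d\<close>
          steps produce \<open>d powr (3/2)\<close>, and by \<open>ln_fraction_le\<close> the rest
          at most a constant times \<open>(d - j) powr (3/2)\<close>.\<close>
        define q where "q = 3/2 * ln (real d) / real d"
        have be: "?be = 1 + (3/2 * ln (real d) - exp 1) / real d"
          unfolding b_def by (rule line_slope[OF d]) (simp add: critical_def algebra_simps mult_exp_exp)
        have "?be ^ (d + (d - j)) \<le> exp (q * real (d + (d - j)))"
        proof (rule power_le_exp_line)
          have "(3/2 * ln (real d) - exp 1) / real d \<le> q"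
            unfolding q_def using dpos by (intro divide_right_mono) auto
          then show "?be \<le> 1 + q" unfolding be by simp
        qed (use be1 in simp)
        also have "exp (q * real (d + (d - j))) \<le> exp (3/2 * ln (real d) + 3/2 * (ln (real (d - j)) + 1))"
        proof (subst exp_le_cancel_iff)
          have "q * real (d + (d - j)) = 3/2 * ln (real d) + 3/2 * (real (d - j) / real d * ln (real d))"
            using dpos by (simp add: q_def field_simps)
          also have "\<dots> \<le> 3/2 * ln (real d) + 3/2 * (ln (real (d - j)) + 1)"
            using j by (intro add_left_mono mult_left_mono ln_fraction_le) auto
          finally show "q * real (d + (d - j)) \<le> 3/2 * ln (real d) + 3/2 * (ln (real (d - j)) + 1)" .
        qed
        also have "\<dots> = exp (3/2) * (exp (3/2 * ln (real d)) * exp (3/2 * ln (real (d - j))))"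
          unfolding mult_exp_exp by (simp add: algebra_simps)
        also have "\<dots> = exp (3/2) * (real d powr (3/2) * real (d - j) powr (3/2))"
          using dpos j by (simp add: powr_def)
        finally show "?be ^ (d + (d - j)) \<le> exp (3/2) * (real d powr (3/2) * real (d - j) powr (3/2))" .
      qed (use G be1 in \<open>auto intro!: mult_nonneg_nonneg\<close>)
      also have "\<dots> = G1 * G2\<^sup>2 * 3125 * exp (real m) * exp (3/2)
          * (real d powr (3/2) / (real (Suc j) powr (3/2) * real (Suc d - Suc j) powr (3/2)))"
      proof -
        have p: "real (d - j) ^ 3 = real (d - j) powr (3/2) * real (d - j) powr (3/2)"
          using j by (simp add: powr_add[symmetric] powr_numeral)
        have "real (d - j) powr (3/2) > 0" using j by simp
        then show ?thesis unfolding p by simp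
      qed
      also have "\<dots> \<le> G1 * G2\<^sup>2 * 3125 * exp (real m) * exp (3/2) * (3 * real (min (Suc j) (Suc d - Suc j)) powr (- (3/2)))"
        using G j by (intro mult_left_mono split_factor_le) (auto intro!: mult_nonneg_nonneg)
      finally show ?thesis .
    qed
    have "pair_sum m (\<lambda>j k. b * real j \<le> theta K k) K d n
        = real m * (\<Sum>k\<in>{K..<n}. \<Sum>j<d. if b * real (Suc j) \<le> theta K (Suc k) then
          wt m (Suc k) * (?g j k
            * (?h j k)\<^sup>2) else 0)"
      unfolding pair_sum_def sum_distrib_left by (intro sum.cong refl) auto
    also have "\<dots> \<le> real m * (\<Sum>k\<in>{K..<n}. \<Sum>j<d. if b * real (Suc j) \<le> theta K (Suc k) then
          wt m (Suc k) * exp (- tau m (Suc k)) * H j else 0)"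
      unfolding H_def using summand by (intro mult_left_mono sum_mono) auto
    also have "\<dots> = real m * (\<Sum>j<d. \<Sum>k\<in>{K..<n}. if b * real (Suc j) \<le> theta K (Suc k) then
          wt m (Suc k) * exp (- tau m (Suc k)) * H j else 0)"
      by (subst sum.swap) simp
    also have "\<dots> \<le> real m * (\<Sum>j<d. G1 * G2\<^sup>2 * 3125 * exp (real m) * exp (3/2) * (3 * real (min (Suc j) (Suc d - Suc j)) powr (- (3/2))))"
      using row by (intro mult_left_mono sum_mono) auto
    also have "\<dots> = real m * (G1 * G2\<^sup>2 * 3125 * exp (real m) * exp (3/2) * 3 * (\<Sum>j<d. real (min (Suc j) (Suc d - Suc j)) powr (- (3/2))))"
      by (simp only: sum_distrib_left mult.assoc)
    also have "(\<Sum>j<d. real (min (Suc j) (Suc d - Suc j)) powr (- (3/2))) = (\<Sum>i\<in>{1..d}. real (min i (Suc d - i)) powr (- (3/2)))"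
      by (rule sum.reindex_bij_witness[of _ "\<lambda>i. i - 1" Suc]) auto
    also have "real m * (G1 * G2\<^sup>2 * 3125 * exp (real m) * exp (3/2) * 3 * \<dots>) \<le> CC"
      unfolding CC_def
    proof (intro mult_left_mono)
      have "(\<Sum>i\<in>{1..d}. real (min i (Suc d - i)) powr (- (3/2))) \<le> 2 * (\<Sum>r\<in>{1..d}. real r powr (- (3/2)))"
        by (rule sum_min_reflect_le) simp
      then show "(\<Sum>i\<in>{1..d}. real (min i (Suc d - i)) powr (- (3/2))) \<le> 2 * C3" using C3(2)[of d] by linarith
    qed (use G in \<open>auto intro!: mult_nonneg_nonneg\<close>)
    finally show ?thesis .
  qed
  moreover have "0 < CC" using m G C3 by (auto simp: CC_def intro!: mult_pos_pos)
  ultimately show ?thesis using that by blast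
qed

text \<open>The second moment is controlled only shortly after the critical time. For later labels
  the estimate is made at \<open>n'\<close> and carried over by monotonicity of the height.\<close>

lemma theta_reaches:
  assumes "K \<le> n" "0 < L" "L \<le> theta K n"
  obtains n' where "K \<le> n'" "n' \<le> n" "L \<le> theta K n'" "theta K n' \<le> L + 1"
proof -
  define n' where "n' = (LEAST k. K \<le> k \<and> L \<le> theta K k)"
  have P: "K \<le> n' \<and> L \<le> theta K n'" unfolding n'_def by (rule LeastI[of _ n]) (use assms in auto)
  have le: "n' \<le> n" unfolding n'_def by (rule Least_le) (use assms in auto)
  have "n' \<noteq> K" using P assms(2) by auto
  then obtain k where k: "n' = Suc k" "K \<le> k" using P by (cases n') auto
  have "\<not> L \<le> theta K k"
    using not_less_Least[of k "\<lambda>k. K \<le> k \<and> L \<le> theta K k"] k n'_def by auto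
  moreover have "1 / (real k + 12) \<le> 1" by simp
  ultimately have "theta K n' \<le> L + 1" unfolding k(1) theta_Suc[OF k(2)] by linarith
  then show ?thesis using that P le by blast
qed

text \<open>With \<open>R \<ge> K\<close> starting nodes the squared mean is of order
  \<open>R\<^sup>2\<close>, but the variance only of order \<open>R\<close>, so Chebyshev's bound is
  of order \<open>1 / K\<close>.\<close>

lemma avg_height_less:
  assumes m: "1 \<le> m"
  obtains C :: real and d0 :: nat where "0 < C" "1 \<le> d0"
    "\<And>d K n. d0 \<le> d \<Longrightarrow> 1 \<le> K \<Longrightarrow> K \<le> n \<Longrightarrow> critical d \<le> theta K n
      \<Longrightarrow> avg m n (\<lambda>s. if tree_height m s n < d then 1 else 0) \<le> C / real K"
proof -
  obtain d0 c where d0: "1 \<le> d0" "0 < (c::real)"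
    and slope: "\<And>d. d0 \<le> d \<Longrightarrow> 1 / 4 \<le> (critical d - 1) / real d \<and> (critical d - 1) / real d \<le> 1 / 2
      \<and> 1 \<le> (critical d - 1) / real d * exp 1"
    and lower: "\<And>d m K n. d0 \<le> d \<Longrightarrow> 1 \<le> m \<Longrightarrow> 1 \<le> K \<Longrightarrow> K \<le> n \<Longrightarrow> critical d \<le> theta K n
      \<Longrightarrow> c \<le> green m (\<lambda>j k. (critical d - 1) / real d * real j \<le> theta K k) K d n"
    using green_barrier_lower by blast
  obtain C where C: "0 < C" and second: "\<And>d b K n. 1 \<le> d \<Longrightarrow> b = (critical d - 1) / real d \<Longrightarrow> 1 / 4 \<le> b
      \<Longrightarrow> b \<le> 1 / 2 \<Longrightarrow> 1 \<le> b * exp 1 \<Longrightarrow> 1 \<le> K \<Longrightarrow> K \<le> n \<Longrightarrow> theta K n \<le> critical d + 1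
      \<Longrightarrow> pair_sum m (\<lambda>j k. b * real j \<le> theta K k) K d n \<le> C"
    using second_moment_bound[OF m] by blast
  have "avg m n (\<lambda>s. if tree_height m s n < d then 1 else 0) \<le> C / c\<^sup>2 / real K"
    if d: "d0 \<le> d" and K: "1 \<le> K" "K \<le> n" and th: "critical d \<le> theta K n" for d K n
  proof -
    have d1: "1 \<le> d" using d d0 by simp
    have "0 < critical d" using d1 by (auto simp: critical_def intro!: mult_pos_pos add_pos_nonneg)
    then obtain n' where n': "K \<le> n'" "n' \<le> n" "critical d \<le> theta K n'" "theta K n' \<le> critical d + 1"
      using theta_reaches[OF K(2) _ th] by blast
    define b where "b = (critical d - 1) / real d"
    define A where "A = (\<lambda>j k. b * real j \<le> theta K k)"
    define R where "R = real (card (tree_nodes m K))"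
    have "real K \<le> R"
    proof -
      have "K - 1 \<le> m * (K - 1)" using m by simp
      then have "K \<le> m * (K - 1) + 1" using K by linarith
      then show ?thesis by (simp only: R_def card_tree_nodes of_nat_le_iff)
    qed
    then have R: "0 < R" "real K \<le> R" using K by auto
    define p where "p = avg m n' (\<lambda>s. if level_count m A K s d n' = 0 then 1 else 0)"
    have p0: "0 \<le> p"
    proof -
      have "avg m n' (\<lambda>_. 0) \<le> p" unfolding p_def by (intro avg_mono) auto
      then show ?thesis by simp
    qed
    have c: "c \<le> green m A K d n'" unfolding A_def b_def by (rule lower[OF d m K(1) n'(1,3)])
    have "p * (R * c)\<^sup>2 \<le> p * (R * green m A K d n')\<^sup>2"
      using p0 c d0 R by (intro mult_left_mono power_mono) auto
    also have "\<dots> \<le> R * pair_sum m A K d n'"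
      unfolding p_def R_def by (rule avg_no_level_le[OF K(1) n'(1)])
    also have "\<dots> \<le> R * C"
      unfolding A_def using slope[OF d] R
      by (intro mult_left_mono second[OF d1 b_def _ _ _ K(1) n'(1,4)]) (auto simp: b_def)
    finally have "(p * (R * c\<^sup>2)) * R \<le> C * R" by (simp add: power2_eq_square mult_ac)
    then have "p * (R * c\<^sup>2) \<le> C" using R(1) by (rule mult_right_le_imp_le)
    then have "p \<le> C / (R * c\<^sup>2)" using R d0 by (simp add: pos_le_divide_eq)
    also have "\<dots> \<le> C / (real K * c\<^sup>2)"
      using R K d0 C by (intro divide_left_mono mult_right_mono mult_pos_pos) auto
    finally have p: "p \<le> C / c\<^sup>2 / real K" by (simp add: mult.commute)
    have n1: "1 \<le> n'" using K n' by simp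
    have "avg m n (\<lambda>s. if tree_height m s n < d then 1 else 0)
        \<le> avg m n (\<lambda>s. if tree_height m s n' < d then 1 else 0)"
    proof (rule avg_mono)
      fix s assume "s \<in> choices m n"
      then have "tree_height m s n' \<le> tree_height m s n"
        using n1 n' by (intro height_mono valid_choicesI)
      then show "(if tree_height m s n < d then 1 else 0) \<le> (if tree_height m s n' < d then 1 else (0::real))" by simp
    qed
    also have "\<dots> = avg m n' (\<lambda>s. if tree_height m s n' < d then 1 else 0)"
    proof (rule avg_prefix[OF n1 n'(2)])
      fix s i v assume "n' \<le> i"
      then have "tree_height m (s(i := v)) n' = tree_height m s n'" by (intro height_cong) auto
      then show "(if tree_height m (s(i := v)) n' < d then 1 else (0::real)) = (if tree_height m s n' < d then 1 else 0)"
        by (simp only:)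
    qed
    also have "\<dots> \<le> p"
      unfolding p_def
    proof (rule avg_mono)
      fix s assume "s \<in> choices m n'"
      then have val: "valid_choices m n' s" by (rule valid_choicesI)
      have "d \<le> tree_height m s n'" if "level_count m A K s d n' \<noteq> 0"
      proof -
        have "{v \<in> tree_nodes m n'. level m A K s d v} \<noteq> {}"
          using that by (auto simp: level_count_def)
        then obtain v where v: "v \<in> tree_nodes m n'" "level m A K s d v" by blast
        obtain i where i: "d \<le> i" "depth m s i v" using level_imp_depth[OF val K(1) n'(1) v] by blast
        then have "i \<le> tree_height m s n'" using height_ge_iff[OF val n1] v by blast
        then show ?thesis using i by simp
      qed
      then show "(if tree_height m s n' < d then 1 else (0::real)) \<le> (if level_count m A K s d n' = 0 then 1 else 0)"
        by (cases "level_count m A K s d n' = 0") simp_all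
    qed
    finally show ?thesis using p by linarith
  qed
  moreover have "0 < C / c\<^sup>2" using C d0 by simp
  ultimately show ?thesis using that[of "C / c\<^sup>2" d0] d0 by blast
qed

section \<open>Tail bounds around the centering\<close>

definition center :: "nat \<Rightarrow> real" where
  "center n = exp 1 * ln (real n) - 3/2 * ln (ln (real n))"

lemma ln_le_center:
  assumes "2 \<le> n"
  shows "ln (real n) \<le> center n"
proof -
  define t where "t = ln (real n)"
  have t: "0 < t" using assms by (simp add: t_def)
  have "5 / 2 \<le> exp (1::real)" using exp_lower_Taylor_quadratic[of 1] by simp
  then have "5 / 2 * t \<le> exp 1 * t" using t by (intro mult_right_mono) auto
  moreover have "ln t \<le> t - 1" using t by (rule ln_le_minus_one)
  ultimately show ?thesis unfolding center_def t_def[symmetric] using t by argo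
qed

context recursive_tree
begin

abbreviation height :: "nat \<Rightarrow> 'a \<Rightarrow> nat" where
  "height n \<omega> \<equiv> tree_height m (\<lambda>k. S k \<omega>) n"

lemma height_event: "{\<omega> \<in> space M. P (height n \<omega>)} \<in> events"
  using event_prefix[of n "\<lambda>s. P (tree_height m s n)"] height_cong[of n] by metis

lemma height_measurable: "height n \<in> M \<rightarrow>\<^sub>M count_space UNIV"
proof (subst measurable_count_space_eq2_countable, safe)
  fix h
  have "height n -` {h} \<inter> space M = {\<omega> \<in> space M. height n \<omega> = h}" by auto
  then show "height n -` {h} \<inter> space M \<in> events" using height_event[of "\<lambda>x. x = h" n] by simp
qed auto

lemma prob_height_ge: "1 \<le> n \<Longrightarrow> prob {\<omega> \<in> space M. J \<le> height n \<omega>} = hit m n J"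
proof -
  assume n: "1 \<le> n"
  have "prob {\<omega> \<in> space M. J \<le> height n \<omega>} = avg m n (\<lambda>s. if J \<le> tree_height m s n then 1 else 0)"
    using prob_eq_avg[of n "\<lambda>s. J \<le> tree_height m s n"] height_cong[of n] by metis
  also have "\<dots> = hit m n J"
    unfolding hit_def by (intro avg_cong) (simp add: height_ge_iff[OF valid_choicesI n])
  finally show ?thesis .
qed

lemma prob_height_less:
  "prob {\<omega> \<in> space M. height n \<omega> < d} = avg m n (\<lambda>s. if tree_height m s n < d then 1 else 0)"
  using prob_eq_avg[of n "\<lambda>s. tree_height m s n < d"] height_cong[of n] by metis

lemma upper_tail:
  obtains C where "0 < C" "\<And>n y. 2 \<le> n \<Longrightarrow> 0 \<le> y
    \<Longrightarrow> prob {\<omega> \<in> space M. center n + y \<le> real (height n \<omega>)} \<le> C * exp (- (y / 2))"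
proof -
  obtain K where K: "1 \<le> K" "\<And>n J y. 1 \<le> n \<Longrightarrow> 1 \<le> J
    \<Longrightarrow> tau m n = exp (- 1) * (real J + 3/2 * ln (real J) - y) \<Longrightarrow> hit m n J \<le> K * exp (- (y / 2))"
    using hit_upper[OF m_pos] by blast
  define B where "B = exp 1 * (real m + 1)"
  have "prob {\<omega> \<in> space M. center n + y \<le> real (height n \<omega>)} \<le> (K * exp (B / 2)) * exp (- (y / 2))"
    if n: "2 \<le> n" and y: "0 \<le> y" for n y
  proof -
    define J where "J = nat \<lceil>center n + y\<rceil>"
    define t where "t = ln (real n)"
    have t: "0 < t" "t \<le> center n" using n ln_le_center[OF n] by (auto simp: t_def)
    have J: "center n + y \<le> real J" unfolding J_def by linarith
    then have tJ: "t \<le> real J" using t y by linarith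
    then have J1: "1 \<le> J" using t by (cases J) auto
    have lnJ: "ln t \<le> ln (real J)" using t tJ by simp
    define y' where "y' = real J + 3/2 * ln (real J) - exp 1 * tau m n"
    have "exp (- 1) * (real J + 3/2 * ln (real J) - y') = (exp (- 1) * exp 1) * tau m n" by (simp add: y'_def)
    then have tn: "tau m n = exp (- 1) * (real J + 3/2 * ln (real J) - y')"
      by (simp only: mult_exp_exp) simp
    have "exp 1 * tau m n \<le> exp 1 * (real m + 1 + t)"
      unfolding t_def using tau_le_ln[of n m] n by (intro mult_left_mono) auto
    then have "exp 1 * tau m n \<le> B + exp 1 * t" by (simp add: B_def algebra_simps)
    \<comment> \<open>The \<open>3/2 * ln (real J)\<close> in \<open>y'\<close> compensates the
      \<open>ln (ln (real n))\<close> in \<open>center n\<close>, since \<open>J\<close> is at least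
      \<open>ln (real n)\<close>. \<open>B\<close> pays for replacing \<open>tau m n\<close> by the
      logarithm.\<close>
    then have y': "y - B \<le> y'" using J lnJ unfolding y'_def center_def t_def[symmetric] by argo
    have "prob {\<omega> \<in> space M. center n + y \<le> real (height n \<omega>)} \<le> prob {\<omega> \<in> space M. J \<le> height n \<omega>}"
    proof (rule finite_measure_mono)
      show "{\<omega> \<in> space M. center n + y \<le> real (height n \<omega>)} \<subseteq> {\<omega> \<in> space M. J \<le> height n \<omega>}"
        unfolding J_def by (auto simp: nat_le_iff ceiling_le_iff)
    qed (rule height_event)
    also have "\<dots> \<le> K * exp (- (y' / 2))"
      using prob_height_ge[of n J] K(2)[OF _ J1 tn] n by simp
    also have "\<dots> \<le> K * exp (B / 2 + - (y / 2))"
      using K y' by (intro mult_left_mono) auto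
    finally show ?thesis by (simp only: mult_exp_exp mult.assoc)
  qed
  moreover have "0 < K * exp (B / 2)" using K by simp
  ultimately show ?thesis using that by blast
qed

text \<open>The clock started at \<open>K\<close> lags by \<open>ln (real K + 12)\<close>, which
  costs \<open>exp 1\<close> times as much depth. The \<open>5/2\<close> consists of 1 for rounding
  the depth up and \<open>3/2\<close> from \<open>ln (real d) \<le> 1 + ln t\<close>.
  \<open>D\<close> ensures that depth \<open>d0\<close>, from which the estimates hold, is within
  reach.\<close>

lemma lower_tail:
  obtains C D :: real where "0 < C" "0 \<le> D"
    "\<And>n K y. 1 \<le> K \<Longrightarrow> exp 1 * ln (real K + 12) + D \<le> exp 1 * ln (real n)
      \<Longrightarrow> exp 1 * ln (real K + 12) + 5/2 \<le> y
      \<Longrightarrow> prob {\<omega> \<in> space M. real (height n \<omega>) < center n - y} \<le> C / real K"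
proof -
  obtain C d0 where C: "(0::real) < C" "1 \<le> d0"
    and less: "\<And>d K n. d0 \<le> d \<Longrightarrow> 1 \<le> K \<Longrightarrow> K \<le> n \<Longrightarrow> critical d \<le> theta K n
      \<Longrightarrow> avg m n (\<lambda>s. if tree_height m s n < d then 1 else 0) \<le> C / real K"
    using avg_height_less[OF m_pos] by blast
  define D where "D = real d0 + 3/2 * ln (real d0)"
  have D: "0 \<le> D" using C by (simp add: D_def)
  have "prob {\<omega> \<in> space M. real (height n \<omega>) < center n - y} \<le> C / real K"
    if K: "1 \<le> K" and n: "exp 1 * ln (real K + 12) + D \<le> exp 1 * ln (real n)"
      and y: "exp 1 * ln (real K + 12) + 5/2 \<le> y" for n K y
  proof -
    define t where "t = ln (real n)"
    define d where "d = max d0 (nat \<lceil>center n - y\<rceil>)"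
    have K12: "0 < ln (real K + 12)" by simp
    have "exp 1 * ln (real K + 12) \<le> exp 1 * t" using n D unfolding t_def by linarith
    then have Kt: "ln (real K + 12) \<le> t" using exp_gt_zero by (rule mult_left_le_imp_le)
    have n0: "0 < n" using Kt K12 by (cases n) (auto simp: t_def)
    then have "real K + 12 \<le> real n" using Kt by (simp add: t_def)
    then have Kn: "K + 12 \<le> n" by linarith
    have t1: "1 \<le> t"
    proof -
      have "1 = ln (exp (1::real))" by simp
      also have "\<dots> \<le> ln (real K + 12)" using exp_le by (subst ln_le_cancel_iff) auto
      finally show ?thesis using Kt by simp
    qed
    have key: "real d + 3/2 * ln (real d) \<le> exp 1 * t - exp 1 * ln (real K + 12)"
    proof (cases "nat \<lceil>center n - y\<rceil> \<le> d0")
      case True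
      then have "d = d0" by (simp add: d_def)
      then show ?thesis using n by (simp add: D_def t_def)
    next
      case False
      then have d: "d = nat \<lceil>center n - y\<rceil>" "1 \<le> d" using False C unfolding d_def by linarith+
      have dle: "real d \<le> center n - y + 1" using d by linarith
      have "0 \<le> exp 1 * ln (real K + 12)" by simp
      then have "y \<ge> 5 / 2" using y by linarith
      moreover have lt: "0 \<le> ln t" using t1 by simp
      ultimately have "real d \<le> exp 1 * t" using dle unfolding center_def t_def[symmetric] by argo
      then have "ln (real d) \<le> ln (exp 1 * t)" using d(2) by (subst ln_le_cancel_iff) auto
      also have "\<dots> = 1 + ln t" using t1 by (simp add: ln_mult)
      finally show ?thesis using dle y unfolding center_def t_def[symmetric] by argo
    qed
    have crit: "critical d \<le> theta K n"
    proof -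
      have "critical d \<le> exp (- 1) * (exp 1 * t - exp 1 * ln (real K + 12))"
        unfolding critical_def using key by (intro mult_left_mono) auto
      also have "\<dots> = (exp (- 1) * exp 1) * (t - ln (real K + 12))" by (simp add: algebra_simps)
      also have "\<dots> = t - ln (real K + 12)" by (simp only: mult_exp_exp) simp
      also have "\<dots> \<le> ln (real n + 12) - ln (real K + 12)" using n0 by (simp add: t_def)
      also have "\<dots> = ln ((real n + 12) / (real K + 12))" by (simp add: ln_div)
      also have "\<dots> \<le> theta K n" using Kn by (intro theta_ge_ln) simp
      finally show ?thesis .
    qed
    have "prob {\<omega> \<in> space M. real (height n \<omega>) < center n - y} \<le> prob {\<omega> \<in> space M. height n \<omega> < d}"
    proof (rule finite_measure_mono)
      have "center n - y \<le> real d" unfolding d_def by linarith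
      then show "{\<omega> \<in> space M. real (height n \<omega>) < center n - y} \<subseteq> {\<omega> \<in> space M. height n \<omega> < d}" by auto
    qed (rule height_event)
    also have "\<dots> \<le> C / real K"
      unfolding prob_height_less using K Kn crit by (intro less) (auto simp: d_def)
    finally show ?thesis .
  qed
  then show ?thesis using that C D by blast
qed

end

section \<open>Tightness and almost sure convergence\<close>

context recursive_tree
begin

lemma tight_height: "tight (\<lambda>n. distr M borel (\<lambda>\<omega>. real (height (n + 2) \<omega>) - center (n + 2)))"
proof -
  have meas: "(\<lambda>\<omega>. real (height n \<omega>) - center n) \<in> borel_measurable M" for n
    by (rule measurable_compose[OF height_measurable]) simp
  obtain C where C: "0 < C" and up: "\<And>n y. 2 \<le> n \<Longrightarrow> 0 \<le> y
    \<Longrightarrow> prob {\<omega> \<in> space M. center n + y \<le> real (height n \<omega>)} \<le> C * exp (- (y / 2))"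
    using upper_tail by blast
  obtain C' D :: real where C': "0 < C'" "0 \<le> D" and low:
    "\<And>n K y. 1 \<le> K \<Longrightarrow> exp 1 * ln (real K + 12) + D \<le> exp 1 * ln (real n)
      \<Longrightarrow> exp 1 * ln (real K + 12) + 5/2 \<le> y
      \<Longrightarrow> prob {\<omega> \<in> space M. real (height n \<omega>) < center n - y} \<le> C' / real K"
    using lower_tail by blast
  have "\<exists>a b. a < b \<and> (\<forall>n. 1 - e < measure (distr M borel (\<lambda>\<omega>. real (height (n + 2) \<omega>) - center (n + 2))) {a<..b})"
    if e: "0 < e" for e :: real
  proof -
    have "((\<lambda>y. C * exp (- (y / 2))) \<longlongrightarrow> 0) at_top" by real_asymp
    then have "eventually (\<lambda>y. C * exp (- (y / 2)) < e / 2) at_top"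
      using e by (intro order_tendstoD(2)[of _ 0]) auto
    then have "eventually (\<lambda>y. C * exp (- (y / 2)) < e / 2 \<and> 0 < y) at_top"
      by (intro eventually_conj eventually_gt_at_top)
    then obtain b where b: "C * exp (- (b / 2)) < e / 2" "0 < b"
      unfolding eventually_at_top_linorder by blast
    obtain K :: nat where K: "2 * C' / e < real K" using reals_Archimedean2 by blast
    moreover have "0 < 2 * C' / e" using C' e by simp
    ultimately have K0: "0 < real K" by linarith
    then have CK: "C' / real K < e / 2" using K e by (simp add: field_simps)
    define L where "L = exp 1 * ln (real K + 12)"
    have "eventually (\<lambda>n::nat. L + D \<le> exp 1 * ln (real n)) sequentially" by real_asymp
    then obtain N where N: "\<And>n. N \<le> n \<Longrightarrow> L + D \<le> exp 1 * ln (real n)"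
      unfolding eventually_sequentially by blast
    have L0: "0 \<le> L" by (simp add: L_def)
    define y where "y = L + 5/2 + (\<Sum>n\<le>N. \<bar>center n\<bar>)"
    \<comment> \<open>The interval is open on the left, so one unit more turns values at most
      \<open>a\<close> into values strictly below \<open>- y\<close>.\<close>
    define a where "a = - y - 1"
    have y: "L + 5/2 \<le> y" by (auto simp: y_def intro!: sum_nonneg)
    have low': "prob {\<omega> \<in> space M. real (height n \<omega>) < center n - y} < e / 2" for n
    proof (cases "N \<le> n")
      case True
      then have "prob {\<omega> \<in> space M. real (height n \<omega>) < center n - y} \<le> C' / real K"
        using N[OF True] y K0 unfolding L_def by (intro low) auto
      then show ?thesis using CK by linarith
    next
      case False
      have "\<bar>center n\<bar> \<le> (\<Sum>n\<le>N. \<bar>center n\<bar>)"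
        using False by (intro member_le_sum[of n "{..N}" "\<lambda>n. \<bar>center n\<bar>"]) auto
      then have "center n - y \<le> 0" using L0 unfolding y_def by linarith
      then have "\<not> real h < center n - y" for h :: nat by (smt (verit) of_nat_0_le_iff)
      then show ?thesis using e by simp
    qed
    have "1 - e < measure (distr M borel (\<lambda>\<omega>. real (height n \<omega>) - center n)) {a<..b}" if n: "2 \<le> n" for n
    proof -
      let ?G = "{\<omega> \<in> space M. a < real (height n \<omega>) - center n \<and> real (height n \<omega>) - center n \<le> b}"
      let ?U = "{\<omega> \<in> space M. center n + b \<le> real (height n \<omega>)}"
      let ?L = "{\<omega> \<in> space M. real (height n \<omega>) < center n - y}"
      have ev: "?G \<in> events" "?U \<in> events" "?L \<in> events"
        using height_event[of "\<lambda>h. a < real h - center n \<and> real h - center n \<le> b" n]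
          height_event[of "\<lambda>h. center n + b \<le> real h" n] height_event[of "\<lambda>h. real h < center n - y" n] by auto
      have "space M - ?G \<subseteq> ?U \<union> ?L" by (auto simp: a_def)
      then have "prob (space M - ?G) \<le> prob (?U \<union> ?L)" using ev by (intro finite_measure_mono) auto
      also have "\<dots> \<le> prob ?U + prob ?L" using ev by (intro measure_Un_le) auto
      also have "\<dots> < e / 2 + e / 2" using up[OF n, of b] b low'[of n] by simp
      finally have "1 - e < prob ?G" using prob_compl[OF ev(1)] by simp
      moreover have "measure (distr M borel (\<lambda>\<omega>. real (height n \<omega>) - center n)) {a<..b} = prob ?G"
        by (subst measure_distr[OF meas]) (auto intro!: arg_cong[of _ _ prob])
      ultimately show ?thesis by simp
    qed
    moreover have "a < b" using y L0 b unfolding a_def by linarith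
    ultimately show ?thesis by (intro exI[of _ a] exI[of _ b]) simp
  qed
  then show ?thesis using meas unfolding tight_def by blast
qed

text \<open>With \<open>y = 4 * ln r\<close> above and \<open>K = r\<^sup>2\<close> below, both
  failure probabilities are of order \<open>1 / r\<^sup>2\<close>, hence summable. The deviations
  are of order \<open>ln r\<close>, negligible against \<open>ln (2 ^ r)\<close>.\<close>

lemma height_dyadic_bounds:
  "AE \<omega> in M. eventually (\<lambda>r. center (2 ^ r) - (exp 1 * ln (real (r\<^sup>2) + 12) + 5/2) \<le> real (height (2 ^ r) \<omega>)
    \<and> real (height (2 ^ r) \<omega>) \<le> center (2 ^ r) + 4 * ln (real r)) sequentially"
proof -
  obtain C where C: "0 < C" and up: "\<And>n y. 2 \<le> n \<Longrightarrow> 0 \<le> y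
    \<Longrightarrow> prob {\<omega> \<in> space M. center n + y \<le> real (height n \<omega>)} \<le> C * exp (- (y / 2))"
    using upper_tail by blast
  obtain C' D :: real where C': "0 < C'" "0 \<le> D" and low:
    "\<And>n K y. 1 \<le> K \<Longrightarrow> exp 1 * ln (real K + 12) + D \<le> exp 1 * ln (real n)
      \<Longrightarrow> exp 1 * ln (real K + 12) + 5/2 \<le> y
      \<Longrightarrow> prob {\<omega> \<in> space M. real (height n \<omega>) < center n - y} \<le> C' / real K"
    using lower_tail by blast
  define y where "y r = exp 1 * ln (real (r\<^sup>2) + 12) + 5/2" for r :: nat
  define U where "U r = {\<omega> \<in> space M. center (2 ^ r) + 4 * ln (real r) \<le> real (height (2 ^ r) \<omega>)}" for r
  define L where "L r = {\<omega> \<in> space M. real (height (2 ^ r) \<omega>) < center (2 ^ r) - y r}" for r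
  have ev: "U r \<in> events" "L r \<in> events" for r
    using height_event[of "\<lambda>h. center (2 ^ r) + 4 * ln (real r) \<le> real h"]
      height_event[of "\<lambda>h. real h < center (2 ^ r) - y r"] by (auto simp: U_def L_def)
  have "eventually (\<lambda>r::nat. exp 1 * ln (real r ^ 2 + 12) + D \<le> exp 1 * (real r * ln 2)) sequentially"
    by real_asymp
  then obtain N where N: "\<And>r. N \<le> r \<Longrightarrow> exp 1 * ln (real r ^ 2 + 12) + D \<le> exp 1 * (real r * ln 2)"
    unfolding eventually_sequentially by blast
  have bound: "prob (U r \<union> L r) \<le> (C + C') * (1 / real r ^ 2)" if r: "max N 1 \<le> r" for r
  proof -
    have r1: "1 \<le> r" "N \<le> r" using r by auto
    have two: "(2::nat) \<le> 2 ^ r" using power_increasing[of 1 r "2::nat"] r1 by simp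
    have "prob (U r) \<le> C * exp (- (4 * ln (real r) / 2))"
      unfolding U_def using r1 by (intro up two) auto
    also have "exp (- (4 * ln (real r) / 2)) = 1 / real r ^ 2"
      using r1 exp_double[of "ln (real r)"] by (simp add: exp_minus inverse_eq_divide)
    finally have 1: "prob (U r) \<le> C * (1 / real r ^ 2)" .
    have "prob (L r) \<le> C' / real (r\<^sup>2)"
      unfolding L_def
    proof (rule low)
      show "exp 1 * ln (real (r\<^sup>2) + 12) + D \<le> exp 1 * ln (real (2 ^ r))"
        using N[OF r1(2)] by (simp add: ln_realpow)
    qed (use r1 in \<open>auto simp: y_def\<close>)
    then have 2: "prob (L r) \<le> C' * (1 / real r ^ 2)" by simp
    have "prob (U r \<union> L r) \<le> prob (U r) + prob (L r)" using ev by (intro measure_Un_le) auto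
    then show ?thesis using 1 2 unfolding distrib_right by linarith
  qed
  have "summable (\<lambda>r. prob (U r \<union> L r))"
  proof (rule summable_comparison_test')
    show "summable (\<lambda>r. (C + C') * (1 / real r ^ 2))"
      using inverse_power_summable[of 2, where 'a = real] by (intro summable_mult) (simp add: inverse_eq_divide)
    show "norm (prob (U r \<union> L r)) \<le> (C + C') * (1 / real r ^ 2)" if "max N 1 \<le> r" for r
      using bound[OF that] by simp
  qed
  then have "AE \<omega> in M. eventually (\<lambda>r. \<omega> \<in> space M - (U r \<union> L r)) sequentially"
    using ev by (intro borel_cantelli_AE1) (auto simp: less_top[symmetric])
  then show ?thesis
  proof eventually_elim
    case (elim \<omega>)
    then show ?case by eventually_elim (auto simp: U_def L_def y_def)
  qed
qed

lemma AE_height_limit: "AE \<omega> in M. (\<lambda>n. real (height n \<omega>) / ln (real n)) \<longlonglongrightarrow> exp 1"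
  using height_dyadic_bounds AE_valid
proof eventually_elim
  case (elim \<omega>)
  \<comment> \<open>For \<open>n\<close> between two powers of 2, the height is compared with one of
    them and the logarithm with the other; the quotient of consecutive exponents tends to 1.\<close>
  define lo where "lo r = (center (2 ^ r) - (exp 1 * ln (real (r\<^sup>2) + 12) + 5/2)) / (real (Suc r) * ln 2)" for r
  define up where "up r = (center (2 ^ Suc r) + 4 * ln (real (Suc r))) / (real r * ln 2)" for r
  have lim: "lo \<longlonglongrightarrow> exp 1" "up \<longlonglongrightarrow> exp 1"
  proof -
    have "(\<lambda>r. (exp 1 * (real r * ln 2) - 3/2 * ln (real r * ln 2) - (exp 1 * ln (real r ^ 2 + 12) + 5/2))
        / ((real r + 1) * ln 2)) \<longlonglongrightarrow> exp 1" by real_asymp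
    then show "lo \<longlonglongrightarrow> exp 1"
      unfolding lo_def center_def by (simp add: ln_realpow add.commute)
    have "(\<lambda>r. (exp 1 * ((real r + 1) * ln 2) - 3/2 * ln ((real r + 1) * ln 2) + 4 * ln (real r + 1))
        / (real r * ln 2)) \<longlonglongrightarrow> exp 1" by real_asymp
    then show "up \<longlonglongrightarrow> exp 1"
      unfolding up_def center_def by (simp only: of_nat_power of_nat_numeral ln_realpow zero_less_numeral of_nat_Suc add.commute)
  qed
  have fl: "filterlim floor_log at_top sequentially"
    unfolding filterlim_at_top
  proof
    fix r
    show "eventually (\<lambda>n. r \<le> floor_log n) sequentially"
      using eventually_ge_at_top[of "2 ^ r"]
    proof eventually_elim
      case (elim n)
      then show ?case using floor_log_le_iff[of "2 ^ r" n] by simp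
    qed
  qed
  have lims: "(\<lambda>n. lo (floor_log n)) \<longlonglongrightarrow> exp 1" "(\<lambda>n. up (floor_log n)) \<longlonglongrightarrow> exp 1"
    using filterlim_compose[OF lim(1) fl] filterlim_compose[OF lim(2) fl] by auto
  have ev: "eventually (\<lambda>r. center (2 ^ r) - (exp 1 * ln (real (r\<^sup>2) + 12) + 5/2) \<le> real (height (2 ^ r) \<omega>)
    \<and> real (height (2 ^ Suc r) \<omega>) \<le> center (2 ^ Suc r) + 4 * ln (real (Suc r)) \<and> 1 \<le> r) sequentially"
  proof -
    have "eventually (\<lambda>r. real (height (2 ^ Suc r) \<omega>) \<le> center (2 ^ Suc r) + 4 * ln (real (Suc r))) sequentially"
      using eventually_sequentially_Suc[THEN iffD2, OF elim(1)] by eventually_elim simp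
    with elim(1) show ?thesis using eventually_ge_at_top[of 1] by eventually_elim simp
  qed
  have "eventually (\<lambda>n. lo (floor_log n) \<le> real (height n \<omega>) / ln (real n)
      \<and> real (height n \<omega>) / ln (real n) \<le> up (floor_log n)) sequentially"
    using filterlim_iff[THEN iffD1, OF fl, rule_format, OF ev] eventually_ge_at_top[of 2]
  proof eventually_elim
    case (elim n)
    define r where "r = floor_log n"
    have b: "center (2 ^ r) - (exp 1 * ln (real (r\<^sup>2) + 12) + 5/2) \<le> real (height (2 ^ r) \<omega>)"
      "real (height (2 ^ Suc r) \<omega>) \<le> center (2 ^ Suc r) + 4 * ln (real (Suc r))" "1 \<le> r"
      using elim by (auto simp: r_def)
    have n: "2 ^ r \<le> n" "n \<le> 2 ^ Suc r"
      using elim floor_log_exp2_le[of n] floor_log_exp2_ge[of n] by (auto simp: r_def)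
    have h: "height (2 ^ r) \<omega> \<le> height n \<omega>" "height n \<omega> \<le> height (2 ^ Suc r) \<omega>"
      using n elim \<open>\<forall>n. valid_choices m n (\<lambda>k. S k \<omega>)\<close> by (auto intro!: height_mono)
    have ln: "real r * ln 2 \<le> ln (real n)" "ln (real n) \<le> real (Suc r) * ln 2"
    proof -
      have "ln (real (2 ^ r)) \<le> ln (real n)" using n elim by (subst ln_le_cancel_iff) auto
      then show "real r * ln 2 \<le> ln (real n)" by (simp add: ln_realpow)
      have "real n \<le> real (2 ^ Suc r)" using n(2) by (simp only: of_nat_le_iff)
      then have "ln (real n) \<le> ln (real (2 ^ Suc r))" using elim by (intro ln_mono) auto
      then show "ln (real n) \<le> real (Suc r) * ln 2" by (simp only: of_nat_power of_nat_numeral ln_realpow zero_less_numeral)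
    qed
    have pos: "0 < real r * ln 2" "0 < real (Suc r) * ln 2" using b(3) by auto
    have "lo r \<le> real (height (2 ^ r) \<omega>) / (real (Suc r) * ln 2)"
      unfolding lo_def using b pos by (intro divide_right_mono) auto
    also have "\<dots> \<le> real (height n \<omega>) / ln (real n)"
      using h ln pos by (intro frac_le) auto
    finally have 1: "lo r \<le> real (height n \<omega>) / ln (real n)" .
    have "real (height n \<omega>) / ln (real n) \<le> real (height (2 ^ Suc r) \<omega>) / (real r * ln 2)"
      using h ln pos by (intro frac_le) auto
    also have "\<dots> \<le> up r" unfolding up_def using b pos by (intro divide_right_mono) auto
    finally show ?case using 1 by (simp add: r_def)
  qed
  then show ?case
    by (intro tendsto_sandwich[OF _ _ lims]) (auto elim: eventually_mono)
qed

end

theorem corollary5p1: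
  fixes M :: "'a measure" and m :: nat and S :: "nat \<Rightarrow> 'a \<Rightarrow> node"
  assumes "recursive_tree M m S"
  shows "(AE \<omega> in M. (\<lambda>n. real (tree_height m (\<lambda>k. S k \<omega>) n) / ln (real n)) \<longlonglongrightarrow> exp 1) \<and>
    tight (\<lambda>n. distr M borel
      (\<lambda>\<omega>. real (tree_height m (\<lambda>k. S k \<omega>) (n + 2))
        - exp 1 * ln (real (n + 2)) + 3 / 2 * ln (ln (real (n + 2)))))"
proof -
  interpret recursive_tree M m S by (rule assms)
  have "(\<lambda>n. distr M borel (\<lambda>\<omega>. real (tree_height m (\<lambda>k. S k \<omega>) (n + 2))
        - exp 1 * ln (real (n + 2)) + 3 / 2 * ln (ln (real (n + 2)))))
      = (\<lambda>n. distr M borel (\<lambda>\<omega>. real (height (n + 2) \<omega>) - center (n + 2)))"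
    by (simp add: center_def diff_diff_eq2 diff_add_eq)
  then show ?thesis using AE_height_limit tight_height by simp
qed

end
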